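(* Let $n\ge1$ be an integer, $k\ge\frac{n-1}{2n}$, $a,b,C>0$ and $p,q\in[1,+\infty]$. Let $f$ be a measurable function on $\mathbb{R}$ such that $x\mapsto e^{na|x|^{2/n}}f(x)$ belongs to $L^p_{k,n}+L^q_{k,n}$ and $$\int_{\mathbb{R}}\log^+\left|\frac{e^{nb|x|^{2/n}}\mathcal{F}_{k,n}f(x)}{C}\right|\,d\mu_{k,n}(x)<+\infty.$$ Then: 1. If $ab>\frac14$, then $f=0$ almost everywhere. 2. If $ab=\frac14$, then $f(x)=\lambda e^{-na|x|^{2/n}}$ almost everywhere for some $\lambda\in\mathbb{C}$ with $|\lambda|\le(2a)^{kn-\frac n2+1}C$. 3. If $ab<\frac14$, there exist multiple (nonzero) functions satisfying these conditions.
   Context: Here $\log^+r=\log r$ if $r>1$ and $\log^+r=0$ otherwise. Notation: $\alpha=kn-\frac n2$; $j_\beta(z)=\Gamma(\beta+1)\sum_{m\ge0}\frac{(-1)^m}{m!\,\Gamma(\beta+m+1)}(z/2)^{2m}$; $d\mu_{k,n}(x)=\frac{1}{2\Gamma(kn-\frac n2+1)}(\frac n2)^{kn-\frac n2}|x|^{2k+\frac2n-2}dx$, $L^p_{k,n}=L^p(\mathbb{R},d\mu_{k,n})$. The $(k,\frac2n)$-generalized Fourier transform is $\mathcal{F}_{k,n}f(\lambda)=\int_{\mathbb{R}}f(x)B_{k,n}(x,\lambda)\,d\mu_{k,n}(x)$ with kernel $B_{k,n}(x,\lambda)=j_\alpha(n|\lambda x|^{1/n})+(-i)^n(\frac n2)^n\frac{\Gamma(\alpha+1)}{\Gamma(\alpha+n+1)}\lambda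 x\,j_{\alpha+n}(n|\lambda x|^{1/n})$. *)

theory Defs
  imports "HOL-Analysis.Analysis"
begin

definition alpha_kn :: "real \<Rightarrow> nat \<Rightarrow> real" where
  "alpha_kn k n = k * real n - real n / 2"

definition bessel_j :: "real \<Rightarrow> real \<Rightarrow> real" where
  "bessel_j \<beta> z = Gamma (\<beta> + 1) *
     (\<Sum>m. (-1) ^ m / (fact m * Gamma (\<beta> + real m + 1)) * (z / 2) ^ (2 * m))"

definition mu_kn :: "real \<Rightarrow> nat \<Rightarrow> real measure" where
  "mu_kn k n = density lborel (\<lambda>x. ennreal
      (1 / (2 * Gamma (alpha_kn k n + 1)) * (real n / 2) powr (alpha_kn k n)
       * \<bar>x\<bar> powr (2 * k + 2 / real n - 2)))"

definition B_kn :: "real \<Rightarrow> nat \<Rightarrow> real \<Rightarrow> real \<Rightarrow> complex" where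
  "B_kn k n x y =
     complex_of_real (bessel_j (alpha_kn k n) (real n * \<bar>y * x\<bar> powr (1 / real n)))
     + (- \<i>) ^ n * complex_of_real ((real n / 2) ^ n * Gamma (alpha_kn k n + 1)
         / Gamma (alpha_kn k n + real n + 1) * y * x
         * bessel_j (alpha_kn k n + real n) (real n * \<bar>y * x\<bar> powr (1 / real n)))"

definition F_kn :: "real \<Rightarrow> nat \<Rightarrow> (real \<Rightarrow> complex) \<Rightarrow> real \<Rightarrow> complex" where
  "F_kn k n f y = (LINT x|mu_kn k n. f x * B_kn k n x y)"

definition Lp_mem :: "'a measure \<Rightarrow> ennreal \<Rightarrow> ('a \<Rightarrow> complex) \<Rightarrow> bool" where
  "Lp_mem M p g \<longleftrightarrow> g \<in> borel_measurable M \<and>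
     (if p = \<infinity> then (\<exists>B. AE x in M. norm (g x) \<le> B)
      else (\<integral>\<^sup>+ x. ennreal (norm (g x) powr enn2real p) \<partial>M) < \<infinity>)"

definition Lp_plus_Lq :: "'a measure \<Rightarrow> ennreal \<Rightarrow> ennreal \<Rightarrow> ('a \<Rightarrow> complex) \<Rightarrow> bool" where
  "Lp_plus_Lq M p q g \<longleftrightarrow>
     (\<exists>g1 g2. Lp_mem M p g1 \<and> Lp_mem M q g2 \<and> (\<forall>x. g x = g1 x + g2 x))"

definition log_plus :: "real \<Rightarrow> real" where
  "log_plus r = (if r > 1 then ln r else 0)"

definition GH_cond :: "nat \<Rightarrow> real \<Rightarrow> real \<Rightarrow> real \<Rightarrow> real \<Rightarrow> ennreal \<Rightarrow> ennreal
                         \<Rightarrow> (real \<Rightarrow> complex) \<Rightarrow> bool" where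
  "GH_cond n k a b C p q f \<longleftrightarrow>
     f \<in> borel_measurable lborel \<and>
     Lp_plus_Lq (mu_kn k n) p q
        (\<lambda>x. complex_of_real (exp (real n * a * \<bar>x\<bar> powr (2 / real n))) * f x) \<and>
     (\<integral>\<^sup>+ x. ennreal (log_plus (norm (complex_of_real (exp (real n * b * \<bar>x\<bar> powr (2 / real n)))
                                     * F_kn k n f x) / C)) \<partial>mu_kn k n) < \<infinity>"

end

theory Submission
  imports Defs "HOL-Complex_Analysis.Complex_Analysis" "HOL-Probability.Probability"
    "HOL-Real_Asymp.Real_Asymp"
begin

text \<open>
  In the variable \<open>t = |x| ^ (1 / n)\<close> the even and the odd part of the transform of \<open>f\<close> are Hankel
  transforms, and the Gaussian decay of \<open>f\<close> makes them restrictions of entire functions of size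
  \<open>O((1 + |z|) ^ M exp (n (Im z)\<^sup>2 / (4 a)))\<close>. It suffices to treat \<open>b = 1 / (4 a)\<close>. After
  multiplication by \<open>exp (n b z\<^sup>2)\<close> one has an entire function \<open>h\<close> with
  \<open>|h z| \<le> A (1 + |z|) ^ M exp (B (Re z)\<^sup>2)\<close> for which \<open>log\<^sup>+ |h|\<close> is integrable on the real line;
  by a Phragmen-Lindelof argument such a function is a constant of modulus at most 1. The
  polynomial factor is harmless: a polynomial with integrable \<open>log\<^sup>+\<close> is constant. Hence the even
  part of the transform is a multiple of a Gaussian and the odd part, which vanishes at 0, is zero.
  Comparing Taylor coefficients at 0 determines all even moments of the even and the (weighted) odd
  part of \<open>f\<close>, and these determine \<open>f\<close> by Fourier uniqueness.
\<close>

section \<open>Entire functions with integrable logarithm on the real line\<close>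

text \<open>Growth of order 2 is critical for Phragmen-Lindelof in a quadrant: there no multiple of
  \<open>z^2\<close> has real part at least \<open>|z|^2\<close>. The damping is therefore used in
  sectors of smaller opening, and the limit to the quadrant is taken afterwards. A second obstacle
  is that integrability of \<open>log_plus\<close> gives by itself no pointwise bound on the real
  line. A Poisson majorant replaces it, but the resulting estimate degenerates at the axis, so a
  narrow sector around the axis has to be recovered from its edges. The critical case
  \<open>a * b = 1/4\<close> also needs sharp exponents throughout: the Bessel kernel must be
  bounded by \<open>exp |Im w|\<close> with constant 1 in the exponent, and completing the square
  may lose only powers of \<open>1 + |z|\<close>. The lower bound on \<open>k\<close> says that the
  order is at least -1/2. This gives the Bessel estimate, and it makes the weight
  \<open>t powr (2 \<alpha> + 1)\<close> at least 1 for \<open>t \<ge> 1\<close>, so that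
  integrability passes from the given measure to Lebesgue measure on the half line.\<close>

text \<open>
  The damping factor \<open>exp (- \<epsilon> \<kappa> z\<^sup>2 Ln (z + L))\<close> beats every \<open>exp (B |z|\<^sup>2)\<close>, since
  \<open>Re (\<kappa> z\<^sup>2) \<ge> |z|\<^sup>2\<close> on \<open>S\<close>; the shift \<open>L\<close> keeps its modulus at most 1 on \<open>S\<close>.
  \<open>R0\<close> does not depend on \<open>g\<close>, so \<open>g\<close> may be chosen after \<open>R\<close>.
\<close>

lemma phragmen_lindelof_truncated:
  fixes S :: "complex set" and \<kappa> :: complex and A B \<epsilon> :: real
  defines "D \<equiv> \<lambda>z. \<kappa> * z\<^sup>2 * Ln (z + of_real (exp (pi * norm \<kappa>)))"
  assumes S: "closed S" "\<And>z. z \<in> S \<Longrightarrow> Re z \<ge> 0"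
    and \<kappa>: "\<And>z. z \<in> S \<Longrightarrow> Re (\<kappa> * z\<^sup>2) \<ge> (norm z)\<^sup>2"
    and "A > 0" "\<epsilon> > 0"
  obtains R0 where
    "\<And>R g z. \<lbrakk>R \<ge> R0; g holomorphic_on S;
       \<And>z. z \<in> frontier S \<Longrightarrow> norm z \<le> R \<Longrightarrow> norm (g z) \<le> A;
       \<And>z. z \<in> S \<Longrightarrow> norm z = R \<Longrightarrow> norm (g z) \<le> A * exp (B * R\<^sup>2);
       z \<in> S; norm z \<le> R\<rbrakk> \<Longrightarrow> norm (g z) \<le> A * exp (\<epsilon> * Re (D z))"
proof
  define L where "L = exp (pi * norm \<kappa>)"
  \<comment> \<open>For \<open>norm z = R\<close> the exponent of the damping is at least
    \<open>\<epsilon> R^2 (ln R - pi * norm \<kappa>)\<close>; from \<open>R0\<close> on this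
    exceeds \<open>|B| R^2\<close>.\<close>
  define R0 where "R0 = exp (pi * norm \<kappa> + \<bar>B\<bar> / \<epsilon>)"
  have L1: "L \<ge> 1" by (simp add: L_def)
  have Lnorm: "norm (z + of_real L) \<ge> L" "norm (z + of_real L) \<ge> norm z" "Re (z + of_real L) > 0"
    if "z \<in> S" for z
  proof -
    have x: "Re z \<ge> 0" using S that by auto
    show "Re (z + of_real L) > 0" using x L1 by simp
    have "norm (z + of_real L) \<ge> Re (z + of_real L)" by (rule complex_Re_le_cmod)
    then show "norm (z + of_real L) \<ge> L" using x by simp
    have "(Re z)\<^sup>2 \<le> (Re z + L)\<^sup>2" using x L1 by (intro power_mono) auto
    then show "norm (z + of_real L) \<ge> norm z" by (simp add: cmod_def)
  qed
  \<comment> \<open>The argument of the logarithm, at most pi in modulus, costs at most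
    \<open>pi * norm \<kappa> * (norm z)^2\<close>; the shift \<open>L\<close> is chosen so that
    \<open>ln L\<close> pays for exactly this.\<close>
  have ReD: "Re (D z) \<ge> (norm z)\<^sup>2 * (ln (norm (z + of_real L)) - pi * norm \<kappa>)" if z: "z \<in> S" for z
  proof -
    define w where "w = z + of_real L"
    have w: "norm w \<ge> L" "w \<noteq> 0" using Lnorm[OF z] L1 unfolding w_def by auto
    have "\<bar>Im (\<kappa> * z\<^sup>2)\<bar> \<le> norm \<kappa> * (norm z)\<^sup>2"
      using abs_Im_le_cmod[of "\<kappa> * z\<^sup>2"] by (simp add: norm_mult norm_power)
    moreover have "\<bar>Im (Ln w)\<bar> \<le> pi" using mpi_less_Im_Ln[OF w(2)] Im_Ln_le_pi[OF w(2)] by linarith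
    ultimately have "\<bar>Im (\<kappa> * z\<^sup>2)\<bar> * \<bar>Im (Ln w)\<bar> \<le> norm \<kappa> * (norm z)\<^sup>2 * pi"
      by (intro mult_mono) auto
    then have i: "Im (\<kappa> * z\<^sup>2) * Im (Ln w) \<le> norm \<kappa> * (norm z)\<^sup>2 * pi"
      by (metis abs_ge_self abs_mult order_trans)
    have "ln (norm w) \<ge> 0" using w L1 by simp
    then have "(norm z)\<^sup>2 * ln (norm w) \<le> Re (\<kappa> * z\<^sup>2) * ln (norm w)"
      using \<kappa>[OF z] by (intro mult_right_mono)
    moreover have "Re (D z) = Re (\<kappa> * z\<^sup>2) * ln (norm w) - Im (\<kappa> * z\<^sup>2) * Im (Ln w)"
      using w(2) by (simp add: D_def L_def w_def del: times_complex.sel) (simp add: times_complex.sel(1)[of "\<kappa> * z\<^sup>2"] del: times_complex.sel)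
    ultimately show ?thesis using i by (simp add: w_def algebra_simps)
  qed
  have ReD0: "Re (D z) \<ge> 0" if z: "z \<in> S" for z
  proof -
    have "pi * norm \<kappa> = ln L" by (simp add: L_def)
    also have "\<dots> \<le> ln (norm (z + of_real L))" using Lnorm(1)[OF z] L1 by (intro ln_mono) auto
    finally show ?thesis using ReD[OF z] by (smt (verit) mult_nonneg_nonneg zero_le_power2)
  qed
  fix R g z
  assume R: "R \<ge> R0" and g: "g holomorphic_on S"
    and fr: "\<And>z. z \<in> frontier S \<Longrightarrow> norm z \<le> R \<Longrightarrow> norm (g z) \<le> A"
    and arc: "\<And>z. z \<in> S \<Longrightarrow> norm z = R \<Longrightarrow> norm (g z) \<le> A * exp (B * R\<^sup>2)"
    and z: "z \<in> S" "norm z \<le> R"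
  define G where "G = (\<lambda>z. g z * exp (- of_real \<epsilon> * D z))"
  have nG: "norm (G z) = norm (g z) * exp (- \<epsilon> * Re (D z))" for z
    by (simp add: G_def norm_mult)
  have "D holomorphic_on S"
    unfolding D_def L_def[symmetric]
    by (intro holomorphic_intros) (use Lnorm(3) in \<open>fastforce simp: complex_nonpos_Reals_iff\<close>)
  then have hG: "G holomorphic_on S"
    unfolding G_def by (intro holomorphic_intros g) auto
  have "norm (G z) \<le> A"
  proof (rule maximum_modulus_frontier[of G "S \<inter> cball 0 R"])
    show "G holomorphic_on interior (S \<inter> cball 0 R)"
      using hG interior_subset by (blast intro: holomorphic_on_subset)
    have "closed (S \<inter> cball 0 R)" using S by blast
    then show "continuous_on (closure (S \<inter> cball 0 R)) G"
      using hG by (auto intro: continuous_on_subset dest: holomorphic_on_imp_continuous_on)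
    show "bounded (S \<inter> cball 0 R)" by (simp add: bounded_Int)
    show "z \<in> S \<inter> cball 0 R" using z by auto
    fix w assume w: "w \<in> frontier (S \<inter> cball 0 R)"
    then have wS: "w \<in> S" "norm w \<le> R"
      using \<open>closed (S \<inter> cball 0 R)\<close> by (auto simp: frontier_def)
    show "norm (G w) \<le> A"
    proof (cases "norm w = R")
      case False
      then have "w \<in> frontier S" using w wS by (auto simp: frontier_def closure_closed S)
      then have "norm (g w) \<le> A" using fr wS by auto
      moreover have "exp (- \<epsilon> * Re (D w)) \<le> 1" using ReD0[OF wS(1)] \<open>\<epsilon> > 0\<close> by simp
      ultimately show ?thesis unfolding nG using \<open>A > 0\<close>
        by (smt (verit) exp_ge_zero mult_right_le_one_le norm_ge_zero)
    next
      case True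
      have Rp: "R > 0" using R by (smt (verit) R0_def exp_gt_zero)
      have "pi * norm \<kappa> + \<bar>B\<bar> / \<epsilon> = ln R0" by (simp add: R0_def)
      also have "\<dots> \<le> ln R" using R by (intro ln_mono) (auto simp: R0_def)
      also have "\<dots> \<le> ln (norm (w + of_real L))" using Lnorm(2)[OF wS(1)] True Rp by (intro ln_mono) auto
      finally have "\<bar>B\<bar> / \<epsilon> \<le> ln (norm (w + of_real L)) - pi * norm \<kappa>" by simp
      then have "R\<^sup>2 * (\<bar>B\<bar> / \<epsilon>) \<le> R\<^sup>2 * (ln (norm (w + of_real L)) - pi * norm \<kappa>)"
        by (intro mult_left_mono) auto
      also have "\<dots> \<le> Re (D w)" using ReD[OF wS(1)] True by simp
      finally have "R\<^sup>2 * \<bar>B\<bar> \<le> \<epsilon> * Re (D w)" using \<open>\<epsilon> > 0\<close> by (simp add: field_simps)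
      then have "B * R\<^sup>2 \<le> \<epsilon> * Re (D w)"
        by (smt (verit) mult.commute mult_left_mono zero_le_power2)
      have "norm (G w) \<le> A * exp (B * R\<^sup>2) * exp (- \<epsilon> * Re (D w))"
        unfolding nG using arc[OF wS(1) True] by (intro mult_right_mono) auto
      also have "\<dots> = A * exp (B * R\<^sup>2 - \<epsilon> * Re (D w))" by (simp add: exp_diff exp_minus field_simps)
      also have "\<dots> \<le> A" using \<open>B * R\<^sup>2 \<le> \<epsilon> * Re (D w)\<close> \<open>A > 0\<close> by simp
      finally show ?thesis .
    qed
  qed
  then show "norm (g z) \<le> A * exp (\<epsilon> * Re (D z))"
    unfolding nG by (simp add: exp_minus field_simps)
qed

section \<open>Truncated Poisson integrals of a continuous function\<close>

text \<open>The kernel is pi times the Poisson kernel at height \<open>\<eta>\<close>, an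
  approximate identity; uniform continuity on a compact interval lets one \<open>\<eta>\<close>
  serve every \<open>x\<close> in \<open>{0..R}\<close>. The allowed loss of 1 is spent in halves:
  one for the oscillation of \<open>\<phi>\<close> near \<open>x\<close>, one for the kernel mass
  far from \<open>x\<close>.\<close>

lemma poisson_integral_lower_bound:
  fixes \<phi> :: "real \<Rightarrow> real"
  assumes cont: "continuous_on UNIV \<phi>" and nonneg: "\<And>t. \<phi> t \<ge> 0" and "R \<ge> 0"
  obtains \<eta> where "\<eta> > 0"
    "\<And>x. x \<in> {0..R} \<Longrightarrow> pi * (\<phi> x - 1) \<le> integral {-(R+1)..R+1} (\<lambda>t. \<phi> t * (\<eta> / ((x - t)\<^sup>2 + \<eta>\<^sup>2)))"
proof -
  have "uniformly_continuous_on {-(R+1)..R+1} \<phi>"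
    by (intro compact_uniformly_continuous continuous_on_subset[OF cont]) auto
  then obtain d where d: "d > 0"
    "\<And>x y. x \<in> {-(R+1)..R+1} \<Longrightarrow> y \<in> {-(R+1)..R+1} \<Longrightarrow> dist y x < d \<Longrightarrow> dist (\<phi> y) (\<phi> x) < 1/2"
    unfolding uniformly_continuous_on_def by (metis half_gt_zero zero_less_one)
  \<comment> \<open>The cap at 1 keeps the window \<open>{x-\<delta>..x+\<delta>}\<close> inside
    \<open>{-(R+1)..R+1}\<close>.\<close>
  define \<delta> where "\<delta> = min 1 (d / 2)"
  have \<delta>: "\<delta> > 0" "\<delta> \<le> 1" "\<delta> < d" using d(1) by (auto simp: \<delta>_def)
  have "bounded (\<phi> ` {-(R+1)..R+1})"
    by (intro compact_imp_bounded compact_continuous_image continuous_on_subset[OF cont]) auto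
  then obtain M where M: "\<And>x. x \<in> {-(R+1)..R+1} \<Longrightarrow> \<phi> x \<le> M" "M > 0"
    unfolding bounded_pos by (metis abs_le_D1 image_eqI real_norm_def)
  have "((\<lambda>\<eta>. 2 * arctan (\<delta> / \<eta>)) \<longlongrightarrow> 2 * (pi / 2)) (at_right 0)"
  proof (intro tendsto_intros filterlim_compose[OF tendsto_arctan_at_top])
    show "LIM \<eta> at_right 0. \<delta> / \<eta> :> at_top"
      unfolding divide_inverse
      by (rule filterlim_tendsto_pos_mult_at_top[OF tendsto_const \<delta>(1) filterlim_inverse_at_top_right])
  qed
  \<comment> \<open>The kernel mass of the window is \<open>2 * arctan (\<delta> / \<eta>)\<close>.
    A deficit below \<open>pi / (2 * M)\<close>, multiplied by a value at most \<open>M\<close>,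
    costs at most \<open>pi / 2\<close>.\<close>
  then have "\<forall>\<^sub>F \<eta> in at_right 0. 2 * arctan (\<delta> / \<eta>) > pi - pi / (2 * M)"
    by (rule order_tendstoD) (use M in auto)
  then have "\<forall>\<^sub>F \<eta> in at_right 0. 2 * arctan (\<delta> / \<eta>) > pi - pi / (2 * M) \<and> \<eta> > 0"
    by (intro eventually_conj) (auto simp: eventually_at_right_less)
  then obtain \<eta> where \<eta>: "2 * arctan (\<delta> / \<eta>) > pi - pi / (2 * M)" "\<eta> > 0"
    using eventually_happens' trivial_limit_at_right_real by blast
  show thesis
  proof (rule that[OF \<eta>(2)])
    fix x assume x: "x \<in> {0..R}"
    let ?k = "\<lambda>t. \<eta> / ((x - t)\<^sup>2 + \<eta>\<^sup>2)"
    have k0: "?k t \<ge> 0" for t using \<eta> by simp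
    have pos: "(x - t)\<^sup>2 + \<eta>\<^sup>2 > 0" for t using \<eta> by (simp add: sum_power2_gt_zero_iff)
    have int: "(\<lambda>t. \<phi> t * ?k t) integrable_on {a..b}" for a b
      using \<eta>(2) by (intro integrable_continuous_real continuous_intros continuous_on_subset[OF cont])
        (auto simp: sum_power2_eq_zero_iff)
    show "pi * (\<phi> x - 1) \<le> integral {-(R+1)..R+1} (\<lambda>t. \<phi> t * ?k t)"
    proof (cases "\<phi> x \<ge> 1")
      case False
      then have "pi * (\<phi> x - 1) \<le> 0" by (simp add: mult_nonneg_nonpos)
      also have "0 \<le> integral {-(R+1)..R+1} (\<lambda>t. \<phi> t * ?k t)"
        by (intro integral_nonneg int mult_nonneg_nonneg k0 nonneg)
      finally show ?thesis .
    next
      case True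
      have hk: "(?k has_integral arctan ((x + \<delta> - x) / \<eta>) - arctan ((x - \<delta> - x) / \<eta>)) {x-\<delta>..x+\<delta>}"
      proof (rule fundamental_theorem_of_calculus)
        fix t
        have "((\<lambda>t. arctan ((t - x) / \<eta>)) has_field_derivative ?k t) (at t within {x-\<delta>..x+\<delta>})"
          using \<eta> pos[of t] by (auto intro!: derivative_eq_intros simp: field_simps power2_eq_square)
        then show "((\<lambda>t. arctan ((t - x) / \<eta>)) has_vector_derivative ?k t) (at t within {x-\<delta>..x+\<delta>})"
          by (simp add: has_real_derivative_iff_has_vector_derivative)
      qed (use \<delta> in auto)
      have "arctan ((x + \<delta> - x) / \<eta>) - arctan ((x - \<delta> - x) / \<eta>) = 2 * arctan (\<delta> / \<eta>)"
        by (simp add: arctan_minus)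
      with hk have hk': "((\<lambda>t. (\<phi> x - 1/2) * ?k t) has_integral (\<phi> x - 1/2) * (2 * arctan (\<delta> / \<eta>))) {x-\<delta>..x+\<delta>}"
        by (metis has_integral_mult_right)
      have xM: "\<phi> x \<le> M" using M x \<open>R \<ge> 0\<close> by auto
      have "pi * (\<phi> x - 1) \<le> (\<phi> x - 1/2) * (pi - pi / (2 * M))"
      proof -
        have "(\<phi> x - 1/2) * (pi / (2 * M)) \<le> M * (pi / (2 * M))"
          using xM M by (intro mult_right_mono) auto
        also have "\<dots> = pi / 2" using M by simp
        finally show ?thesis by (simp add: algebra_simps)
      qed
      also have "\<dots> \<le> (\<phi> x - 1/2) * (2 * arctan (\<delta> / \<eta>))"
        using True \<eta> by (intro mult_left_mono) auto
      also have "\<dots> = integral {x-\<delta>..x+\<delta>} (\<lambda>t. (\<phi> x - 1/2) * ?k t)"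
        using hk' by (rule integral_unique[symmetric])
      also have "\<dots> \<le> integral {x-\<delta>..x+\<delta>} (\<lambda>t. \<phi> t * ?k t)"
      proof (rule integral_le)
        fix t assume t: "t \<in> {x-\<delta>..x+\<delta>}"
        then have "dist (\<phi> t) (\<phi> x) < 1/2"
          using x \<delta> by (intro d(2)) (auto simp: dist_real_def)
        then have "\<phi> x - 1/2 \<le> \<phi> t" unfolding dist_real_def by arith
        then show "(\<phi> x - 1/2) * ?k t \<le> \<phi> t * ?k t" by (intro mult_right_mono k0)
      qed (use hk' int in auto)
      also have "\<dots> \<le> integral {-(R+1)..R+1} (\<lambda>t. \<phi> t * ?k t)"
        by (intro integral_subset_le int) (use x \<delta> \<eta> nonneg in auto)
      finally show ?thesis .
    qed
  qed
qed

text \<open>\<open>V\<close> is \<open>- \<i>\<close> times the Cauchy transform of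
  \<open>\<phi>\<close> over a real segment, because \<open>Im (1 / (t - w))\<close> is the kernel
  in question. A holomorphic function, and not only its real part, is wanted so that
  \<open>exp (- V / pi)\<close> can be a factor in a maximum modulus argument.\<close>

lemma poisson_integral_holomorphic:
  fixes \<phi> :: "real \<Rightarrow> real"
  assumes cont: "continuous_on UNIV \<phi>" and "T > 0"
  obtains V where "V holomorphic_on {w. Im w > 0}"
    "\<And>w. Im w > 0 \<Longrightarrow> Re (V w) = integral {-T..T} (\<lambda>t. \<phi> t * (Im w / ((Re w - t)\<^sup>2 + (Im w)\<^sup>2)))"
proof -
  define \<gamma> where "\<gamma> = linepath (of_real (-T)) (of_real T :: complex)"
  define f where "f = (\<lambda>u. complex_of_real (\<phi> (Re u)))"
  define V where "V = (\<lambda>w. contour_integral \<gamma> (\<lambda>u. f u / (u - w)))"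
  have cf: "continuous_on X f" for X
    unfolding f_def by (intro continuous_intros continuous_on_compose2[OF cont]) auto
  have img: "Im u = 0" if "u \<in> path_image \<gamma>" for u
    using that by (auto simp: \<gamma>_def closed_segment_def)
  have ne: "u \<noteq> w" if "u \<in> path_image \<gamma>" "Im w > 0" for u w using img[OF that(1)] that by auto
  have int: "(\<lambda>u. f u / (u - w)) contour_integrable_on \<gamma>" if "Im w > 0" for w
    unfolding \<gamma>_def using ne that unfolding \<gamma>_def
    by (intro contour_integrable_continuous_linepath continuous_intros cf) auto
  have "V holomorphic_on {w. Im w > 0}"
  proof (rule holomorphic_onI)
    fix w assume w: "w \<in> {w. Im w > 0}"
    have "(V has_field_derivative (of_nat 1 * contour_integral \<gamma> (\<lambda>u. f u / (u - w) ^ Suc 1))) (at w)"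
    proof (rule Cauchy_next_derivative(2)[where S = "{w. Im w > 0}" and B = "2 * T"])
      show "continuous_on (path_image \<gamma>) f" by (rule cf)
      show "norm (vector_derivative \<gamma> (at t)) \<le> 2 * T" for t
        using \<open>T > 0\<close> unfolding \<gamma>_def vector_derivative_linepath_at
        by (metis (no_types) abs_of_pos add_pos_pos diff_minus_eq_add mult_2 norm_of_real of_real_diff order_refl)
      show "((\<lambda>u. f u / (u - w) ^ 1) has_contour_integral V w) \<gamma>" if "w \<in> {w. Im w > 0} - path_image \<gamma>" for w
        using int[of w] that by (simp add: V_def has_contour_integral_integral)
      show "open {w. Im w > 0}" by (rule open_halfspace_Im_gt)
      show "w \<in> {w. Im w > 0} - path_image \<gamma>" using w ne by auto
    qed (auto simp: \<gamma>_def)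
    then show "V field_differentiable at w within {w. Im w > 0}"
      using field_differentiable_at_within field_differentiable_def by blast
  qed
  moreover have "Re (- \<i> * V w) = integral {-T..T} (\<lambda>t. \<phi> t * (Im w / ((Re w - t)\<^sup>2 + (Im w)\<^sup>2)))"
    if w: "Im w > 0" for w
  proof -
    let ?h = "\<lambda>t. f (of_real t) / (of_real t - w)"
    have V: "V w = integral {-T..T} ?h"
      unfolding V_def \<gamma>_def using \<open>T > 0\<close> by (subst contour_integral_linepath_Reals_eq) auto
    have "?h integrable_on {-T..T}"
    proof (intro integrable_continuous_real continuous_intros continuous_on_compose2[OF cf])
      show "\<forall>t\<in>{-T..T}. of_real t - w \<noteq> 0" using w by (auto simp: complex_eq_iff)
    qed auto
    then have "((\<lambda>t. Im (?h t)) has_integral Im (V w)) {-T..T}"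
      unfolding V by (intro has_integral_Im integrable_integral)
    moreover have "Re (- \<i> * V w) = Im (V w)" by simp
    moreover have "Im (?h t) = \<phi> t * (Im w / ((Re w - t)\<^sup>2 + (Im w)\<^sup>2))" for t
      by (simp add: f_def Im_divide power2_commute)
    ultimately show ?thesis by (simp add: integral_unique)
  qed
  ultimately show thesis
    by (intro that[of "\<lambda>w. - \<i> * V w"] holomorphic_intros) auto
qed

text \<open>
  On the sector \<open>0 \<le> Im z \<le> m Re z\<close> the factor \<open>exp (i B z\<^sup>2 / (2 m))\<close> cancels the growth on the upper
  ray, and \<open>exp (- V / \<pi>)\<close>, with \<open>Re V / \<pi>\<close> the Poisson integral of \<open>\<phi>\<close> shifted by \<open>\<eta>\<close>, bounds the
  function on the real axis. Then \<open>m\<close> tends to infinity.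
\<close>

lemma quadrant_bound:
  fixes g :: "complex \<Rightarrow> complex" and \<phi> :: "real \<Rightarrow> real" and A B :: real
  assumes g: "g holomorphic_on {z. Re z > -1}"
    and bd: "\<And>z. Re z \<ge> 0 \<Longrightarrow> norm (g z) \<le> A * exp (B * (Re z)\<^sup>2)"
    and A: "A \<ge> exp 1" and B: "B \<ge> 0"
    and cont: "continuous_on UNIV \<phi>" and nonneg: "\<And>t. \<phi> t \<ge> 0" and int: "\<phi> integrable_on UNIV"
    and g\<phi>: "\<And>x. x \<ge> 0 \<Longrightarrow> norm (g (of_real x)) \<le> exp (\<phi> x)"
    and z: "Re z > 0" "Im z > 0"
  shows "norm (g z) \<le> A * exp (integral UNIV \<phi> / Im z)"
proof -
  define K where "K = integral UNIV \<phi>"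
  have A0: "A > 0" using A by (smt (verit) exp_gt_zero)
  have step: "norm (g z) \<le> A * exp (\<epsilon> * Re ((1 - \<i> * of_real m) * z\<^sup>2 *
                  Ln (z + of_real (exp (pi * norm (1 - \<i> * of_real m))))))
                * exp (B / m * (Re z * Im z)) * exp (K / Im z)"
    if m: "m > 0" "Im z \<le> m * Re z" and \<epsilon>: "\<epsilon> > 0" for m \<epsilon> :: real
  proof -
    define S where "S = {w. 0 \<le> Im w \<and> Im w \<le> m * Re w}"
    have "closed S"
      unfolding S_def Collect_conj_eq by (intro closed_Int closed_Collect_le continuous_intros)
    have SRe: "Re w \<ge> 0" if "w \<in> S" for w
      using that m unfolding S_def by (smt (verit) mem_Collect_eq mult_pos_neg)
    have S\<kappa>: "Re ((1 - \<i> * of_real m) * w\<^sup>2) \<ge> (norm w)\<^sup>2" if w: "w \<in> S" for w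
    proof -
      have "Im w * Im w \<le> m * Re w * Im w" using w by (intro mult_right_mono) (auto simp: S_def)
      then show ?thesis unfolding cmod_power2 by (simp add: power2_eq_square algebra_simps)
    qed
    have frS: "Im w = 0 \<or> Im w = m * Re w" if w: "w \<in> frontier S" for w
    proof (rule ccontr)
      assume *: "\<not> ?thesis"
      have "w \<in> S" using w \<open>closed S\<close> by (auto simp: frontier_def)
      with * have "w \<in> {w. 0 < Im w} \<inter> {w. Im w < m * Re w}" by (auto simp: S_def)
      moreover have "open ({w. 0 < Im w} \<inter> {w. Im w < m * Re w})"
        by (intro open_Int open_Collect_less continuous_intros)
      moreover have "{w. 0 < Im w} \<inter> {w. Im w < m * Re w} \<subseteq> S" by (auto simp: S_def)
      ultimately have "w \<in> interior S" by (metis interiorI)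
      with w show False by (simp add: frontier_def)
    qed
    obtain R0 where R0: "\<And>R g z. \<lbrakk>R \<ge> R0; g holomorphic_on S;
       \<And>z. z \<in> frontier S \<Longrightarrow> norm z \<le> R \<Longrightarrow> norm (g z) \<le> A;
       \<And>z. z \<in> S \<Longrightarrow> norm z = R \<Longrightarrow> norm (g z) \<le> A * exp (B * R\<^sup>2);
       z \<in> S; norm z \<le> R\<rbrakk> \<Longrightarrow> norm (g z) \<le> A * exp (\<epsilon> * Re ((1 - \<i> * of_real m) * z\<^sup>2 *
                  Ln (z + of_real (exp (pi * norm (1 - \<i> * of_real m))))))"
      by (rule phragmen_lindelof_truncated[OF \<open>closed S\<close> SRe S\<kappa> A0 \<epsilon>, of B]) blast+
    \<comment> \<open>\<open>R\<close> is fixed before the Poisson majorant, since both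
      \<open>\<eta>\<close> and the truncation \<open>R + 1\<close> depend on it. The estimate
      obtained at \<open>z\<close> contains none of the three.\<close>
    define R where "R = max R0 (norm z)"
    have R: "R \<ge> R0" "R \<ge> norm z" "R \<ge> 0" by (auto simp: R_def max.coboundedI2)
    obtain \<eta> where \<eta>: "\<eta> > 0" "\<And>x. x \<in> {0..R} \<Longrightarrow>
        pi * (\<phi> x - 1) \<le> integral {-(R+1)..R+1} (\<lambda>t. \<phi> t * (\<eta> / ((x - t)\<^sup>2 + \<eta>\<^sup>2)))"
      using poisson_integral_lower_bound[OF cont nonneg \<open>R \<ge> 0\<close>] by blast
    obtain V where V: "V holomorphic_on {w. Im w > 0}" "\<And>w. Im w > 0 \<Longrightarrow> Re (V w) =
        integral {-(R+1)..R+1} (\<lambda>t. \<phi> t * (Im w / ((Re w - t)\<^sup>2 + (Im w)\<^sup>2)))"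
      using poisson_integral_holomorphic[OF cont, of "R + 1"] R by auto
    define P where "P = (\<lambda>w. Re (V (w + \<i> * of_real \<eta>)))"
    have integ: "(\<lambda>t. \<phi> t * (y / ((x - t)\<^sup>2 + y\<^sup>2))) integrable_on {-(R+1)..R+1}" if "y > 0" for x y
      using that by (intro integrable_continuous_real continuous_intros continuous_on_subset[OF cont])
        (auto simp: sum_power2_eq_zero_iff)
    have P0: "P w \<ge> 0" if "Im w \<ge> 0" for w
    proof -
      have "Im (w + \<i> * of_real \<eta>) > 0" using that \<eta>(1) by simp
      from V(2)[OF this] this show ?thesis unfolding P_def
        using integ[of "Im (w + \<i> * of_real \<eta>)" "Re (w + \<i> * of_real \<eta>)"] by (auto intro!: integral_nonneg mult_nonneg_nonneg divide_nonneg_nonneg nonneg)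
    qed
    \<comment> \<open>Bounding the kernel by \<open>1 / y\<close> gives an estimate free of
      \<open>R\<close> and \<open>\<eta>\<close>; this is all that remains of the majorant at
      interior points.\<close>
    have PK: "P w \<le> K / Im w" if w: "Im w > 0" for w
    proof -
      define y where "y = Im w + \<eta>"
      have y: "y > 0" "y \<ge> Im w" using w \<eta>(1) by (auto simp: y_def)
      have i1: "\<phi> integrable_on {-(R+1)..R+1}"
        by (intro integrable_continuous_real continuous_on_subset[OF cont]) auto
      have "P w = integral {-(R+1)..R+1} (\<lambda>t. \<phi> t * (y / ((Re w - t)\<^sup>2 + y\<^sup>2)))"
        unfolding P_def using y by (subst V(2)) (auto simp: y_def)
      also have "\<dots> \<le> integral {-(R+1)..R+1} (\<lambda>t. \<phi> t * (1 / y))"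
      proof (rule integral_le)
        fix t
        have "y / ((Re w - t)\<^sup>2 + y\<^sup>2) \<le> y / y\<^sup>2" using y by (intro divide_left_mono) (auto intro!: mult_pos_pos add_nonneg_pos)
        also have "\<dots> = 1 / y" using y by (simp add: power2_eq_square)
        finally show "\<phi> t * (y / ((Re w - t)\<^sup>2 + y\<^sup>2)) \<le> \<phi> t * (1 / y)"
          by (intro mult_left_mono nonneg)
      qed (use integ y i1 in \<open>auto intro!: integrable_on_divide\<close>)
      also have "\<dots> = integral {-(R+1)..R+1} \<phi> / y" by simp
      also have "\<dots> \<le> K / y"
        unfolding K_def using y nonneg by (intro divide_right_mono integral_subset_le i1 int) auto
      also have "\<dots> \<le> K / Im w"
      proof -
        have "K \<ge> 0" unfolding K_def by (intro integral_nonneg int nonneg)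
        then show ?thesis using y w by (intro divide_left_mono) auto
      qed
      finally show ?thesis .
    qed
    define G where "G = (\<lambda>w. g w * exp (\<i> * of_real (B / (2 * m)) * w\<^sup>2)
                         * exp (- of_real (1 / pi) * V (w + \<i> * of_real \<eta>)))"
    have nG: "norm (G w) = norm (g w) * exp (- (B / m) * (Re w * Im w)) * exp (- (P w / pi))" for w
      by (simp add: G_def norm_mult P_def power2_eq_square)
    have "norm (G z) \<le> A * exp (\<epsilon> * Re ((1 - \<i> * of_real m) * z\<^sup>2 *
                  Ln (z + of_real (exp (pi * norm (1 - \<i> * of_real m))))))"
    proof (rule R0[OF R(1)])
      have "(\<lambda>w. V (w + \<i> * of_real \<eta>)) holomorphic_on S"
        by (rule holomorphic_on_compose_gen[OF _ V(1), unfolded o_def])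
           (use \<eta>(1) in \<open>auto intro!: holomorphic_intros simp: S_def\<close>)
      moreover have "g holomorphic_on S"
        by (rule holomorphic_on_subset[OF g]) (use SRe in force)
      ultimately show "G holomorphic_on S"
        unfolding G_def by (intro holomorphic_intros)
      show "z \<in> S" using z m by (auto simp: S_def)
      show "norm z \<le> R" by (rule R)
    next
      fix w assume w: "w \<in> S" "norm w = R"
      then have xy: "Re w \<ge> 0" "Im w \<ge> 0" using SRe by (auto simp: S_def)
      have "norm (G w) \<le> norm (g w) * 1 * 1"
        unfolding nG using P0 xy B m by (intro mult_mono) auto
      also have "\<dots> \<le> A * exp (B * (Re w)\<^sup>2)" using bd xy by simp
      also have "\<dots> \<le> A * exp (B * R\<^sup>2)"
        using A0 B w(2) xy complex_Re_le_cmod[of w] by (intro mult_left_mono) (auto intro!: mult_left_mono power_mono)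
      finally show "norm (G w) \<le> A * exp (B * R\<^sup>2)" .
    next
      fix w assume w: "w \<in> frontier S" "norm w \<le> R"
      then have wS: "w \<in> S" using \<open>closed S\<close> by (auto simp: frontier_def)
      then have xy: "Re w \<ge> 0" "Im w \<ge> 0" using SRe by (auto simp: S_def)
      show "norm (G w) \<le> A"
      proof (cases "Im w = 0")
        case True
        then have wR: "w = of_real (Re w)" by (simp add: complex_eq_iff)
        have "Re w \<in> {0..R}" using xy w(2) complex_Re_le_cmod[of w] by simp
        then have "pi * (\<phi> (Re w) - 1) \<le> P w"
          unfolding P_def using \<eta> True by (subst V(2)) auto
        then have "\<phi> (Re w) - P w / pi \<le> 1" by (simp add: field_simps)
        have "norm (G w) \<le> exp (\<phi> (Re w)) * 1 * exp (- (P w / pi))"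
          unfolding nG using True g\<phi>[OF xy(1)] wR by (intro mult_mono) auto
        also have "\<dots> = exp (\<phi> (Re w) - P w / pi)" by (simp flip: exp_add)
        also have "\<dots> \<le> exp 1" using \<open>\<phi> (Re w) - P w / pi \<le> 1\<close> by simp
        finally show ?thesis using A by simp
      next
        case False
        then have *: "Im w = m * Re w" using frS w by blast
        have "norm (G w) \<le> A * exp (B * (Re w)\<^sup>2) * exp (- (B / m) * (Re w * Im w)) * 1"
          unfolding nG using bd xy P0 A0 by (intro mult_mono) auto
        also have "\<dots> = A * (exp (B * (Re w)\<^sup>2) * exp (- (B * (Re w)\<^sup>2)))"
          using m by (simp add: * power2_eq_square)
        also have "\<dots> = A" by (simp flip: exp_add)
        finally show ?thesis .
      qed
    qed
    then have "norm (g z) \<le> A * exp (\<epsilon> * Re ((1 - \<i> * of_real m) * z\<^sup>2 *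
                  Ln (z + of_real (exp (pi * norm (1 - \<i> * of_real m))))))
                * exp (B / m * (Re z * Im z)) * exp (P z / pi)"
      unfolding nG by (simp add: exp_minus field_simps)
    also have "\<dots> \<le> A * exp (\<epsilon> * Re ((1 - \<i> * of_real m) * z\<^sup>2 *
                  Ln (z + of_real (exp (pi * norm (1 - \<i> * of_real m))))))
                * exp (B / m * (Re z * Im z)) * exp (K / Im z)"
    proof -
      have "P z \<le> P z * pi" using P0[of z] z pi_ge_two by (simp add: mult_le_cancel_left1)
      then have "P z / pi \<le> P z" by (simp add: field_simps)
      with PK[of z] z have "P z / pi \<le> K / Im z" by linarith
      then show ?thesis using A0 by (intro mult_left_mono) auto
    qed
    finally show ?thesis .
  qed
  \<comment> \<open>The exponent \<open>c\<close> depends on \<open>m\<close> and need not stay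
    bounded as \<open>m\<close> grows, so \<open>\<epsilon>\<close> has to tend to 0 first, with
    \<open>m\<close> fixed.\<close>
  have step2: "norm (g z) \<le> A * exp (B / m * (Re z * Im z)) * exp (K / Im z)"
    if m: "m > 0" "Im z \<le> m * Re z" for m :: real
  proof (rule tendsto_lowerbound)
    define c where "c = Re ((1 - \<i> * of_real m) * z\<^sup>2 *
                  Ln (z + of_real (exp (pi * norm (1 - \<i> * of_real m)))))"
    have "((\<lambda>\<epsilon>. A * exp (\<epsilon> * c) * exp (B / m * (Re z * Im z)) * exp (K / Im z)) \<longlongrightarrow>
       A * exp (0 * c) * exp (B / m * (Re z * Im z)) * exp (K / Im z)) (at_right 0)"
      by (intro tendsto_intros)
    then show "((\<lambda>\<epsilon>. A * exp (\<epsilon> * c) * exp (B / m * (Re z * Im z)) * exp (K / Im z)) \<longlongrightarrow>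
       A * exp (B / m * (Re z * Im z)) * exp (K / Im z)) (at_right 0)" by simp
    show "\<forall>\<^sub>F \<epsilon> in at_right 0. norm (g z) \<le> A * exp (\<epsilon> * c) * exp (B / m * (Re z * Im z)) * exp (K / Im z)"
      unfolding c_def using step[OF m] by (auto simp: eventually_at_filter)
  qed auto
  have "norm (g z) \<le> A * exp (0 * (Re z * Im z)) * exp (K / Im z)"
  proof (rule tendsto_lowerbound)
    show "((\<lambda>m. A * exp (B / m * (Re z * Im z)) * exp (K / Im z)) \<longlongrightarrow>
       A * exp (0 * (Re z * Im z)) * exp (K / Im z)) at_top"
      by (intro tendsto_intros tendsto_divide_0[OF tendsto_const] filterlim_at_top_imp_at_infinity filterlim_ident)
    show "\<forall>\<^sub>F m in at_top. norm (g z) \<le> A * exp (B / m * (Re z * Im z)) * exp (K / Im z)"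
      using eventually_gt_at_top[of 0] eventually_ge_at_top[of "Im z / Re z"]
      by eventually_elim (rule step2; use z in \<open>simp add: field_simps\<close>)
  qed auto
  then show ?thesis by (simp add: K_def)
qed

text \<open>The factor \<open>exp (K / Im z)\<close> of the quadrant bound is useless near the real
  axis. Where \<open>Re w \<le> 2 * |Im w|\<close>, either \<open>|Im w| \<ge> 1\<close> and the
  exponent is at most \<open>K\<close>, or \<open>Re w \<le> 2\<close> and the growth hypothesis
  gives \<open>exp (4 * B)\<close>. The remaining sector around the positive axis has both edges in
  that region, so Phragmen-Lindelof carries the constant inside.\<close>

lemma right_half_plane_bound:
  fixes g :: "complex \<Rightarrow> complex" and \<phi> :: "real \<Rightarrow> real" and A B :: real
  assumes g: "g holomorphic_on {z. Re z > -1}"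
    and bd: "\<And>z. Re z \<ge> 0 \<Longrightarrow> norm (g z) \<le> A * exp (B * (Re z)\<^sup>2)"
    and A: "A \<ge> exp 1" and B: "B \<ge> 0"
    and cont: "continuous_on UNIV \<phi>" and nonneg: "\<And>t. \<phi> t \<ge> 0" and int: "\<phi> integrable_on UNIV"
    and g\<phi>: "\<And>x. x \<ge> 0 \<Longrightarrow> norm (g (of_real x)) \<le> exp (\<phi> x)"
    and z: "Re z \<ge> 0"
  shows "norm (g z) \<le> A * exp (integral UNIV \<phi> + 4 * B)"
proof -
  define K where "K = integral UNIV \<phi>"
  have K0: "K \<ge> 0" unfolding K_def by (intro integral_nonneg int nonneg)
  have A0: "A > 0" using A by (smt (verit) exp_gt_zero)
  have q: "norm (g w) \<le> A * exp (K / \<bar>Im w\<bar>)" if w: "Re w > 0" "Im w \<noteq> 0" for w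
  proof (cases "Im w > 0")
    case True
    then show ?thesis
      using quadrant_bound[OF g bd A B cont nonneg int g\<phi> w(1)] by (simp add: K_def)
  next
    case False
    \<comment> \<open>Reflection in the real axis reduces the lower quadrant to the upper one; the
      same \<open>\<phi>\<close> works, since the moduli on the real axis do not change.\<close>
    have img: "cnj ` {z. Re z > -1} = {z. Re z > -1}"
      by (auto intro!: image_eqI[where x = "cnj z" for z])
    have "(cnj \<circ> g \<circ> cnj) holomorphic_on {z. Re z > -1}"
      by (rule holomorphic_on_compose_cnj_cnj) (use g img in \<open>auto simp: open_halfspace_Re_gt\<close>)
    moreover have "norm ((cnj \<circ> g \<circ> cnj) u) \<le> A * exp (B * (Re u)\<^sup>2)" if "Re u \<ge> 0" for u
      using bd[of "cnj u"] that by simp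
    ultimately show ?thesis
      using quadrant_bound[of "cnj \<circ> g \<circ> cnj" A B, OF _ _ A B cont nonneg int, of "cnj w"] g\<phi> w False
      by (simp add: K_def)
  qed
  have wide: "norm (g w) \<le> A * exp (K + 4 * B)" if w: "Re w \<ge> 0" "Re w \<le> 2 * \<bar>Im w\<bar>" for w
  proof (cases "Re w = 0 \<or> \<bar>Im w\<bar> < 1")
    case True
    then have "(Re w)\<^sup>2 \<le> 2\<^sup>2" using w by (intro power_mono) auto
    then have "B * (Re w)\<^sup>2 \<le> K + 4 * B" using mult_left_mono[OF _ B, of "(Re w)\<^sup>2" 4] K0 by simp
    then have "A * exp (B * (Re w)\<^sup>2) \<le> A * exp (K + 4 * B)" using A0 by simp
    then show ?thesis using bd[OF w(1)] by linarith
  next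
    case False
    then have "K / \<bar>Im w\<bar> \<le> K / 1" using K0 by (intro divide_left_mono) auto
    then have "A * exp (K / \<bar>Im w\<bar>) \<le> A * exp (K + 4 * B)" using A0 B by simp
    then show ?thesis using q[of w] w False by force
  qed
  show ?thesis
  proof (cases "Re z \<le> 2 * \<bar>Im z\<bar>")
    case True
    then show ?thesis using wide z by (simp add: K_def)
  next
    case False
    define S where "S = {w. \<bar>Im w\<bar> \<le> Re w / 2}"
    have "closed S" unfolding S_def by (intro closed_Collect_le continuous_intros) auto
    have SRe: "Re w \<ge> 0" if "w \<in> S" for w using that by (auto simp: S_def)
    \<comment> \<open>In this sector \<open>(Re w)^2 \<ge> 4 * (Im w)^2\<close>, while the choice
      \<open>\<kappa> = 2\<close> needs only the factor 3.\<close>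
    have S\<kappa>: "Re (2 * w\<^sup>2) \<ge> (norm w)\<^sup>2" if w: "w \<in> S" for w
    proof -
      have "\<bar>Im w\<bar>\<^sup>2 \<le> (Re w / 2)\<^sup>2" using w by (intro power_mono) (auto simp: S_def)
      then have "4 * (Im w)\<^sup>2 \<le> (Re w)\<^sup>2" by (simp add: power_divide)
      then have "(Re w)\<^sup>2 + (Im w)\<^sup>2 \<le> 2 * ((Re w)\<^sup>2 - (Im w)\<^sup>2)"
      proof -
        have aux: "x + y \<le> 2 * (x - y)" if "4 * y \<le> x" "0 \<le> y" for x y :: real
          using that by (simp add: algebra_simps)
        show ?thesis by (rule aux[OF \<open>4 * (Im w)\<^sup>2 \<le> (Re w)\<^sup>2\<close>]) simp
      qed
      then show ?thesis unfolding cmod_power2 by (simp add: power2_eq_square)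
    qed
    have frS: "\<bar>Im w\<bar> = Re w / 2" if w: "w \<in> frontier S" for w
    proof (rule ccontr)
      assume *: "\<not> ?thesis"
      have "w \<in> S" using w \<open>closed S\<close> by (auto simp: frontier_def)
      with * have "w \<in> {w. \<bar>Im w\<bar> < Re w / 2}" by (auto simp: S_def)
      moreover have "open {w. \<bar>Im w\<bar> < Re w / 2}"
        by (intro open_Collect_less continuous_intros) auto
      moreover have "{w. \<bar>Im w\<bar> < Re w / 2} \<subseteq> S" by (auto simp: S_def)
      ultimately have "w \<in> interior S" by (metis interiorI)
      with w show False by (simp add: frontier_def)
    qed
    define A' where "A' = A * exp (K + 4 * B)"
    have A': "A' > 0" "A \<le> A'" using A0 K0 B by (auto simp: A'_def)
    define c where "c = Re (2 * z\<^sup>2 * Ln (z + of_real (exp (pi * norm (2::complex)))))"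
    have "norm (g z) \<le> A' * exp (\<epsilon> * c)" if \<epsilon>: "\<epsilon> > 0" for \<epsilon>
    proof -
      obtain R0 where R0: "\<And>R g z. \<lbrakk>R \<ge> R0; g holomorphic_on S;
       \<And>z. z \<in> frontier S \<Longrightarrow> norm z \<le> R \<Longrightarrow> norm (g z) \<le> A';
       \<And>z. z \<in> S \<Longrightarrow> norm z = R \<Longrightarrow> norm (g z) \<le> A' * exp (B * R\<^sup>2);
       z \<in> S; norm z \<le> R\<rbrakk> \<Longrightarrow> norm (g z) \<le> A' * exp (\<epsilon> * Re (2 * z\<^sup>2 *
                  Ln (z + of_real (exp (pi * norm (2::complex))))))"
        by (rule phragmen_lindelof_truncated[OF \<open>closed S\<close> SRe S\<kappa> A'(1) \<epsilon>, of B]) blast+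
      show ?thesis unfolding c_def
      proof (rule R0)
        show "R0 \<le> max R0 (norm z)" by simp
        show "norm z \<le> max R0 (norm z)" by simp
        show "z \<in> S" using False by (auto simp: S_def)
        show "g holomorphic_on S" by (rule holomorphic_on_subset[OF g]) (use SRe in force)
        show "norm (g w) \<le> A'" if "w \<in> frontier S" for w
          using frS[OF that] wide[of w] by (auto simp: A'_def)
        show "norm (g w) \<le> A' * exp (B * (max R0 (norm z))\<^sup>2)" if w: "w \<in> S" "norm w = max R0 (norm z)" for w
        proof -
          have "norm (g w) \<le> A * exp (B * (Re w)\<^sup>2)" using bd SRe w by auto
          also have "\<dots> \<le> A' * exp (B * (norm w)\<^sup>2)"
            using A' B SRe[OF w(1)] complex_Re_le_cmod[of w]
            by (intro mult_mono) (auto intro!: mult_left_mono power_mono)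
          finally show ?thesis using w by simp
        qed
      qed
    qed
    moreover have "((\<lambda>\<epsilon>. A' * exp (\<epsilon> * c)) \<longlongrightarrow> A' * exp (0 * c)) (at_right 0)"
      by (intro tendsto_intros)
    ultimately have "norm (g z) \<le> A' * exp (0 * c)"
      by (intro tendsto_lowerbound[where F = "at_right (0::real)"]) (auto simp: eventually_at_filter)
    then show ?thesis by (simp add: A'_def K_def)
  qed
qed

section \<open>The positive logarithm and the Liouville step\<close>

lemma log_plus_eq_ln_max: "log_plus r = ln (max 1 r)"
  by (auto simp: log_plus_def max_def)

lemma log_plus_nonneg [simp]: "log_plus r \<ge> 0"
  by (simp add: log_plus_eq_ln_max)

lemma le_exp_log_plus: "r \<le> exp (log_plus r)"
  by (simp add: log_plus_eq_ln_max)

lemma log_plus_mono: "r \<le> s \<Longrightarrow> log_plus r \<le> log_plus s"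
  unfolding log_plus_eq_ln_max by (intro ln_mono) auto

lemma not_integrable_on_halfline:
  fixes \<phi> :: "real \<Rightarrow> real"
  assumes int: "\<phi> integrable_on UNIV" and nonneg: "\<And>t. \<phi> t \<ge> 0" and "\<epsilon> > 0"
    and ge: "\<And>t. t \<ge> T \<Longrightarrow> \<phi> t \<ge> \<epsilon>"
  shows False
proof -
  define K where "K = integral UNIV \<phi>"
  have "K \<ge> 0" unfolding K_def by (intro integral_nonneg int nonneg)
  \<comment> \<open>The interval is long enough for the lower bound \<open>\<epsilon>\<close> to
    contribute \<open>K + 1\<close>, more than the whole integral.\<close>
  define S where "S = T + (K + 1) / \<epsilon>"
  have ST: "S \<ge> T" using \<open>\<epsilon> > 0\<close> \<open>K \<ge> 0\<close> by (simp add: S_def)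
  have i: "\<phi> integrable_on {T..S}" by (rule integrable_on_subinterval[OF int]) auto
  have "K + 1 = integral {T..S} (\<lambda>t. \<epsilon>)" using ST \<open>\<epsilon> > 0\<close> by (simp add: S_def)
  also have "\<dots> \<le> integral {T..S} \<phi>" using ge i by (intro integral_le) auto
  also have "\<dots> \<le> K" unfolding K_def using i int nonneg by (intro integral_subset_le) auto
  finally show False by simp
qed

text \<open>Division by \<open>(z + 2) ^ M\<close> removes the polynomial factor on the right half
  plane, and the symmetry of the modulus supplies the left one. This leaves polynomial growth, so
  Liouville makes \<open>h\<close> a polynomial. A nonconstant one eventually has modulus at least
  e, and a constant of modulus above 1 has a positive constant \<open>log_plus\<close>; neither is
  integrable.\<close>

lemma miyachi_lemma:
  fixes h :: "complex \<Rightarrow> complex" and A B :: real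
  assumes h: "h holomorphic_on UNIV" and sym: "\<And>z. norm (h (-z)) = norm (h z)"
    and bd: "\<And>z. norm (h z) \<le> A * (1 + norm z) ^ M * exp (B * (Re z)\<^sup>2)" and "B \<ge> 0"
    and int: "integrable lborel (\<lambda>t. indicator {0..} t * log_plus (norm (h (of_real t))))"
  shows "h z = h 0" and "norm (h 0) \<le> 1"
proof -
  define \<phi> where "\<phi> = (\<lambda>t. log_plus (norm (h (of_real t))))"
  have conth: "continuous_on X h" for X
    using h holomorphic_on_imp_continuous_on continuous_on_subset by blast
  have cont: "continuous_on UNIV \<phi>"
    unfolding \<phi>_def log_plus_eq_ln_max
    by (intro continuous_intros continuous_on_compose2[OF conth[of UNIV]]) (auto simp: max_def)
  have nonneg: "\<phi> t \<ge> 0" for t by (simp add: \<phi>_def)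
  have even: "\<phi> (-t) = \<phi> t" for t using sym[of "of_real t"] by (simp add: \<phi>_def)
  have "integrable lborel \<phi>"
  proof (rule Bochner_Integration.integrable_bound)
    have "integrable lborel (\<lambda>t. indicator {0..} (0 + (-1) * t) * \<phi> (0 + (-1) * t))"
      using int unfolding \<phi>_def by (rule lborel_integrable_real_affine) auto
    then show "integrable lborel (\<lambda>t. indicator {0..} t * \<phi> t + indicator {0..} (-t) * \<phi> (-t))"
      using int unfolding \<phi>_def by (intro Bochner_Integration.integrable_add) auto
    show "\<phi> \<in> borel_measurable lborel"
      using cont by (simp add: borel_measurable_continuous_onI)
    show "AE t in lborel. norm (\<phi> t) \<le> norm (indicator {0..} t * \<phi> t + indicator {0..} (-t) * \<phi> (-t))"
      using nonneg by (auto simp: even indicator_def)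
  qed
  then have int\<phi>: "\<phi> integrable_on UNIV"
    by (simp add: integrable_on_lborel)
  \<comment> \<open>\<open>exp 1\<close> is required by the half-plane bound; \<open>2 ^ M\<close>
    comes from \<open>1 + norm z \<le> 2 * norm (z + 2)\<close> for
    \<open>Re z \<ge> 0\<close>.\<close>
  define A' where "A' = max (exp 1) (A * 2 ^ M)"
  have "norm (h 0) \<le> A" using bd[of 0] by simp
  then have A0: "A \<ge> 0" using norm_ge_zero order_trans by blast
  define C where "C = A' * exp (integral UNIV \<phi> + 4 * B)"
  have right: "norm (h w) \<le> C * norm (w + 2) ^ M" if w: "Re w \<ge> 0" for w
  proof -
    define g where "g = (\<lambda>z. h z / (z + 2) ^ M)"
    have n2: "norm (z + 2) \<ge> 2" if "Re z \<ge> 0" for z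
      using complex_Re_le_cmod[of "z + 2"] that by simp
    have "norm (g w) \<le> C"
      unfolding C_def
    proof (rule right_half_plane_bound[where g = g and z = w and A = A' and B = B and \<phi> = \<phi>])
      show "g holomorphic_on {z. - 1 < Re z}"
        unfolding g_def using holomorphic_on_subset[OF h]
        by (intro holomorphic_intros) (auto simp: complex_eq_iff[of "_ + 2"] simp flip: eq_neg_iff_add_eq_0)
      show "A' \<ge> exp 1" by (simp add: A'_def)
      show "norm (g z) \<le> A' * exp (B * (Re z)\<^sup>2)" if z: "Re z \<ge> 0" for z
      proof -
        have "norm z \<le> norm (z + 2)"
        proof -
          have "(Re z)\<^sup>2 \<le> (Re z + 2)\<^sup>2" using z by (intro power_mono) auto
          then show ?thesis by (simp add: cmod_def)
        qed
        then have "(1 + norm z) ^ M \<le> (2 * norm (z + 2)) ^ M"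
          using n2[OF z] by (intro power_mono) auto
        then have "A * (1 + norm z) ^ M * exp (B * (Re z)\<^sup>2) \<le> A * (2 * norm (z + 2)) ^ M * exp (B * (Re z)\<^sup>2)"
          using A0 by (intro mult_right_mono mult_left_mono) auto
        then have "norm (h z) \<le> A * (2 * norm (z + 2)) ^ M * exp (B * (Re z)\<^sup>2)"
          using bd[of z] by linarith
        then have "norm (h z) / norm (z + 2) ^ M \<le> A * 2 ^ M * exp (B * (Re z)\<^sup>2)"
          using n2[OF z] by (subst pos_divide_le_eq) (auto intro!: zero_less_power simp: power_mult_distrib algebra_simps)
        also have "\<dots> \<le> A' * exp (B * (Re z)\<^sup>2)" by (simp add: A'_def)
        finally show ?thesis by (simp add: g_def norm_divide norm_power)
      qed
      show "norm (g (of_real x)) \<le> exp (\<phi> x)" if "x \<ge> 0" for x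
      proof -
        have "norm (complex_of_real x + 2) ^ M \<ge> 1"
          using n2[of "of_real x"] that by (intro one_le_power) auto
        then have "norm (g (of_real x)) \<le> norm (h (of_real x)) / 1"
          unfolding g_def norm_divide norm_power
          using n2[of "of_real x"] that by (intro divide_left_mono) auto
        also have "\<dots> \<le> exp (\<phi> x)" unfolding \<phi>_def using le_exp_log_plus by simp
        finally show ?thesis .
      qed
    qed (use cont nonneg int\<phi> \<open>B \<ge> 0\<close> w in auto)
    moreover have "norm (w + 2) ^ M > 0" using n2[OF w] by (intro zero_less_power) linarith
    ultimately show ?thesis by (simp add: g_def norm_divide norm_power divide_le_eq)
  qed
  have C0: "C \<ge> 0" unfolding C_def A'_def by (intro mult_nonneg_nonneg) (auto simp: le_max_iff_disj)
  have growth: "norm (h w) \<le> C * 3 ^ M * norm w ^ M" if w: "1 \<le> norm w" for w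
  proof -
    define v where "v = (if Re w \<ge> 0 then w else -w)"
    have v: "Re v \<ge> 0" "norm v = norm w" "norm (h v) = norm (h w)" using sym by (auto simp: v_def)
    have "norm (v + 2) \<le> 3 * norm v" using norm_triangle_ineq[of v 2] w v by simp
    then have "norm (v + 2) ^ M \<le> (3 * norm v) ^ M" by (intro power_mono) auto
    then have "C * norm (v + 2) ^ M \<le> C * (3 * norm v) ^ M" using C0 by (intro mult_left_mono)
    then show ?thesis using right[OF v(1)] v by (simp add: power_mult_distrib mult.assoc)
  qed
  define c where "c = (\<lambda>k. (deriv ^^ k) h 0 / fact k)"
  have poly: "h w = (\<Sum>k\<le>M. c k * w ^ k)" for w
    unfolding c_def by (rule Liouville_polynomial[OF h growth])
  have c0: "c k = 0" if k: "1 \<le> k" "k \<le> M" for k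
  proof (rule ccontr)
    assume "c k \<noteq> 0"
    then have "\<forall>\<^sub>F w in at_infinity. norm (h w) \<ge> exp 1"
      unfolding poly using Limits.polyfun_extremal[of c k, OF \<open>c k \<noteq> 0\<close> k] by simp
    then obtain T where T: "\<And>w. norm w \<ge> T \<Longrightarrow> norm (h w) \<ge> exp 1"
      by (auto simp: eventually_at_infinity)
    show False
    proof (rule not_integrable_on_halfline[OF int\<phi> nonneg zero_less_one])
      fix t assume "t \<ge> max T 0"
      then have "norm (h (of_real t)) \<ge> exp 1" by (intro T) auto
      then have "log_plus (exp 1) \<le> \<phi> t" unfolding \<phi>_def by (rule log_plus_mono)
      then show "1 \<le> \<phi> t" by (simp add: log_plus_def)
    qed
  qed
  have const: "h w = c 0" for w
  proof -
    have "(\<Sum>k\<le>M. c k * w ^ k) = (\<Sum>k\<in>{0}. c k * w ^ k)"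
      by (rule sum.mono_neutral_right) (use c0 in auto)
    then show ?thesis by (simp add: poly)
  qed
  then show "h z = h 0" by simp
  show "norm (h 0) \<le> 1"
  proof (rule ccontr)
    assume "\<not> ?thesis"
    then have "log_plus (norm (c 0)) > 0" using ln_gt_zero[of "norm (c 0)"] by (simp add: const log_plus_def)
    then show False
      by (rule not_integrable_on_halfline[OF int\<phi> nonneg]) (auto simp: \<phi>_def const)
  qed
qed

section \<open>The normalized Bessel function on the complex plane\<close>

text \<open>The signs are kept outside and the powers of 1/2 are absorbed; for orders at least -1/2
  the coefficients are then positive and can be compared with
  \<open>1 / fact (2 * m)\<close>.\<close>

definition bessel_coeff :: "real \<Rightarrow> nat \<Rightarrow> real" where
  "bessel_coeff \<beta> m = Gamma (\<beta> + 1) / (fact m * Gamma (\<beta> + real m + 1) * 4 ^ m)"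

definition bessel_jc :: "real \<Rightarrow> complex \<Rightarrow> complex" where
  "bessel_jc \<beta> w = (\<Sum>m. (-1) ^ m * of_real (bessel_coeff \<beta> m) * w ^ (2 * m))"

lemma even_power_series_cosh:
  fixes x :: "'a :: {banach, real_normed_field}"
  shows "(\<lambda>m. x ^ (2 * m) /\<^sub>R fact (2 * m)) sums cosh x"
proof -
  have sm: "strict_mono (\<lambda>m::nat. 2 * m)" by (auto simp: strict_mono_def)
  have "(\<lambda>m. (\<lambda>n. if even n then x ^ n /\<^sub>R fact n else 0) (2 * m)) sums cosh x"
    by (subst sums_mono_reindex[OF sm]) (use cosh_converges[of x] in \<open>auto elim!: evenE\<close>)
  then show ?thesis by simp
qed

lemma even_power_series_cos:
  fixes x :: complex
  shows "(\<lambda>m. (-1) ^ m / fact (2 * m) * x ^ (2 * m)) sums cos x"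
proof -
  have sm: "strict_mono (\<lambda>m::nat. 2 * m)" by (auto simp: strict_mono_def)
  have "(\<lambda>m. (\<lambda>n. cos_coeff n *\<^sub>R x ^ n) (2 * m)) sums cos x"
    by (subst sums_mono_reindex[OF sm]) (use cos_converges[of x] in \<open>auto simp: cos_coeff_def elim!: evenE\<close>)
  then show ?thesis by (simp add: cos_coeff_def scaleR_conv_of_real)
qed

lemma fact_double_Suc: "fact (2 * Suc m) = (4 * (real m + 1) * (real m + 1/2)) * fact (2 * m)"
  by (simp add: algebra_simps)

lemma Gamma_plus1_pos: "\<beta> \<ge> -1/2 \<Longrightarrow> Gamma (\<beta> + 1 :: real) > 0"
  by (rule Gamma_real_pos) linarith

lemma bessel_coeff_0: "\<beta> \<ge> -1/2 \<Longrightarrow> bessel_coeff \<beta> 0 = 1"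
  unfolding bessel_coeff_def by (metis Gamma_plus1_pos add.right_neutral divide_self fact_0 less_irrefl mult_1 mult.right_neutral of_nat_0 power_0)

lemma bessel_coeff_pos: "\<beta> \<ge> -1/2 \<Longrightarrow> bessel_coeff \<beta> m > 0"
  unfolding bessel_coeff_def
  by (intro divide_pos_pos mult_pos_pos Gamma_real_pos zero_less_power) auto

lemma bessel_coeff_Suc:
  assumes "\<beta> \<ge> -1/2"
  shows "bessel_coeff \<beta> (Suc m) = bessel_coeff \<beta> m / (4 * (real m + 1) * (\<beta> + real m + 1))"
proof -
  have "\<beta> + real m + 1 \<notin> \<int>\<^sub>\<le>\<^sub>0" using assms by (auto elim!: nonpos_Ints_cases)
  then have "Gamma (\<beta> + real (Suc m) + 1) = (\<beta> + real m + 1) * Gamma (\<beta> + real m + 1)"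
    using Gamma_plus1[of "\<beta> + real m + 1"] by (simp add: add_ac)
  then show ?thesis by (simp add: bessel_coeff_def field_simps)
qed

text \<open>The recursion divides by \<open>4 * (m + 1) * (\<beta> + m + 1)\<close>, which is
  smallest at \<open>\<beta> = -1/2\<close>, and there the coefficients are those of the cosine.
  Every such Bessel series is thus dominated by that of \<open>cosh (norm w)\<close>.\<close>

lemma bessel_coeff_le:
  assumes "\<beta> \<ge> -1/2"
  shows "bessel_coeff \<beta> m \<le> 1 / fact (2 * m)"
proof (induction m)
  case 0
  then show ?case using bessel_coeff_0[OF assms] by simp
next
  case (Suc m)
  have "bessel_coeff \<beta> (Suc m) \<le> (1 / fact (2 * m)) / (4 * (real m + 1) * (real m + 1/2))"
    unfolding bessel_coeff_Suc[OF assms] using Suc assms bessel_coeff_pos[OF assms, of m]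
    by (intro frac_le mult_left_mono) auto
  also have "\<dots> = 1 / fact (2 * Suc m)" unfolding fact_double_Suc by simp
  finally show ?case .
qed

lemma bessel_terms_norm_le:
  assumes "\<beta> \<ge> -1/2"
  shows "norm ((-1) ^ m * complex_of_real (bessel_coeff \<beta> m) * w ^ (2 * m)) \<le> norm w ^ (2 * m) /\<^sub>R fact (2 * m)"
proof -
  have "\<bar>bessel_coeff \<beta> m\<bar> * norm w ^ (2 * m) \<le> 1 / fact (2 * m) * norm w ^ (2 * m)"
    using bessel_coeff_le[OF assms, of m] bessel_coeff_pos[OF assms, of m] by (intro mult_right_mono) auto
  then show ?thesis by (simp add: norm_mult norm_power divide_inverse)
qed

lemma summable_norm_bessel:
  assumes "\<beta> \<ge> -1/2"
  shows "summable (\<lambda>m. norm ((-1) ^ m * complex_of_real (bessel_coeff \<beta> m) * w ^ (2 * m)))"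
  using bessel_terms_norm_le[OF assms]
  by (intro summable_comparison_test'[OF sums_summable[OF even_power_series_cosh[of "norm w"]]]) simp

lemma bessel_j_eq_bessel_jc:
  assumes "\<beta> \<ge> -1/2"
  shows "complex_of_real (bessel_j \<beta> x) = bessel_jc \<beta> (of_real x)"
proof -
  define F where "F = (\<lambda>m. (-1) ^ m * bessel_coeff \<beta> m * x ^ (2 * m))"
  have F: "(-1) ^ m * complex_of_real (bessel_coeff \<beta> m) * of_real x ^ (2 * m) = of_real (F m)" for m
    by (simp add: F_def)
  have "summable (\<lambda>m. complex_of_real (F m))"
    using summable_norm_cancel[OF summable_norm_bessel[OF assms, of "of_real x"]] unfolding F .
  then have sF: "summable F" by (simp add: summable_of_real_iff)
  have g: "Gamma (\<beta> + 1) \<noteq> 0" using Gamma_plus1_pos[OF assms] by simp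
  have "(-1) ^ m / (fact m * Gamma (\<beta> + real m + 1)) * (x / 2) ^ (2 * m) = F m / Gamma (\<beta> + 1)" for m
    using g by (simp add: F_def bessel_coeff_def power_divide power_mult)
  then have "bessel_j \<beta> x = Gamma (\<beta> + 1) * (\<Sum>m. F m / Gamma (\<beta> + 1))"
    unfolding bessel_j_def by simp
  also have "\<dots> = (\<Sum>m. F m)" using g by (subst suminf_divide[OF sF]) simp
  finally show ?thesis unfolding bessel_jc_def F using sF by (simp add: suminf_of_real)
qed

text \<open>
  The Bessel coefficients are those of the cosine times moments of a Beta distribution, so that
  \<open>j\<^sub>\<beta> w\<close> is an average of \<open>cos (\<surd>u w)\<close> over \<open>u \<in> [0, 1]\<close>.
\<close>

lemma bessel_coeff_eq_Beta:
  assumes "\<beta> > -1/2"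
  shows "bessel_coeff \<beta> m * fact (2 * m) * Beta (1/2) (\<beta> + 1/2) = Beta (real m + 1/2) (\<beta> + 1/2)"
proof (induction m)
  case 0
  then show ?case using bessel_coeff_0[of \<beta>] assms by simp
next
  case (Suc m)
  have "real m + 1/2 \<notin> \<int>\<^sub>\<le>\<^sub>0" by (auto elim!: nonpos_Ints_cases)
  then have "(real m + \<beta> + 1) * Beta (real m + 1/2 + 1) (\<beta> + 1/2) = (real m + 1/2) * Beta (real m + 1/2) (\<beta> + 1/2)"
    using Beta_plus1_left[of "real m + 1/2" "\<beta> + 1/2"] by (simp add: add_ac)
  then have "Beta (real (Suc m) + 1/2) (\<beta> + 1/2)
      = (real m + 1/2) / (real m + \<beta> + 1) * (bessel_coeff \<beta> m * fact (2 * m) * Beta (1/2) (\<beta> + 1/2))"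
    using assms unfolding Suc by (simp add: field_simps)
  also have "\<dots> = bessel_coeff \<beta> (Suc m) * fact (2 * Suc m) * Beta (1/2) (\<beta> + 1/2)"
  proof -
    have "real m + \<beta> + 1 > 0" using assms by linarith
    then show ?thesis unfolding fact_double_Suc using assms
      by (simp add: bessel_coeff_Suc) (simp add: divide_simps add_ac)
  qed
  finally show ?case by simp
qed

lemma bessel_jc_minus_half: "bessel_jc (-1/2) w = cos w"
proof -
  have "bessel_coeff (-1/2) m = 1 / fact (2 * m)" for m
  proof (induction m)
    case 0
    then show ?case using bessel_coeff_0[of "-1/2"] by simp
  next
    case (Suc m)
    then show ?case unfolding bessel_coeff_Suc[OF order_refl] fact_double_Suc by (simp add: mult_ac)
  qed
  then show ?thesis
    using even_power_series_cos[of w] by (simp add: bessel_jc_def sums_iff)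
qed

text \<open>Termwise estimates see only \<open>norm w\<close>. The bound by the imaginary part comes
  from writing the function as an average, with positive weight, of
  \<open>cos (sqrt u *\<^sub>R w)\<close> for \<open>u\<close> in \<open>{0..1}\<close>, each of
  modulus at most \<open>exp |Im w|\<close>. At \<open>\<beta> = -1/2\<close> the weight is no
  longer integrable, but the function is the cosine itself. The constant 1 in front of
  \<open>|Im w|\<close> decides the critical value of \<open>a * b\<close>.\<close>

lemma norm_bessel_jc_le:
  assumes "\<beta> \<ge> -1/2"
  shows "norm (bessel_jc \<beta> w) \<le> exp \<bar>Im w\<bar>"
proof (cases "\<beta> = -1/2")
  case True
  then show ?thesis unfolding True bessel_jc_minus_half using cmod_cos_le_exp[of 1 w] by simp
next
  case False
  define b where "b = \<beta> + 1/2"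
  have b: "b > 0" using False assms by (simp add: b_def)
  define wt where "wt = (\<lambda>u::real. indicator {0..1} u * (u powr (1/2 - 1) * (1 - u) powr (b - 1)))"
  have wt0: "wt u \<ge> 0" for u by (simp add: wt_def)
  have eq: "u ^ m * wt u = indicator {0..1} u *\<^sub>R (u powr (real m + 1/2 - 1) * (1 - u) powr (b - 1))" for u m
  proof (cases "u > 0")
    case True
    then have "u powr (real m + 1/2 - 1) = u ^ m * u powr (1/2 - 1)"
      using powr_add[of u "real m" "1/2 - 1"] by (simp add: powr_realpow add_diff_eq)
    then show ?thesis by (simp add: wt_def)
  qed (auto simp: wt_def indicator_def)
  have int: "integrable lborel (\<lambda>u. u ^ m * wt u)"
    and val: "(LINT u|lborel. u ^ m * wt u) = Beta (real m + 1/2) b" for m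
  proof -
    have "set_integrable lborel {0..1} (\<lambda>u. u powr (real m + 1/2 - 1) * (1 - u) powr (b - 1))"
      by (rule integrable_Beta) (use b in auto)
    then show i: "integrable lborel (\<lambda>u. u ^ m * wt u)"
      unfolding set_integrable_def eq .
    have "((\<lambda>u. u powr (real m + 1/2 - 1) * (1 - u) powr (b - 1)) has_integral Beta (real m + 1/2) b) {0..1}"
      by (rule has_integral_Beta_real) (use b in auto)
    then have "((\<lambda>u. u ^ m * wt u) has_integral Beta (real m + 1/2) b) UNIV"
      unfolding eq by (subst (asm) has_integral_restrict_UNIV[symmetric], elim has_integral_eq[rotated]) auto
    with has_integral_integral_lborel[OF i] show "(LINT u|lborel. u ^ m * wt u) = Beta (real m + 1/2) b"
      by (rule has_integral_unique)
  qed
  define B0 where "B0 = Beta (1/2) b"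
  have B0: "B0 > 0" unfolding B0_def Beta_def using b by (intro divide_pos_pos mult_pos_pos Gamma_real_pos) auto
  define f where "f = (\<lambda>m u. (-1) ^ m / fact (2 * m) * w ^ (2 * m) * of_real (u ^ m * wt u))"
  have fi: "integrable lborel (f m)" for m
    unfolding f_def using int by (intro integrable_mult_right integrable_of_real) auto
  have fnorm: "norm (f m u) = norm w ^ (2 * m) / fact (2 * m) * (u ^ m * wt u)" for m u
  proof -
    have "\<bar>u ^ m * wt u\<bar> = u ^ m * wt u" using wt0[of u] by (auto simp: wt_def indicator_def)
    then show ?thesis by (simp add: f_def norm_mult norm_divide norm_power del: of_real_mult of_real_power)
  qed
  have fval: "(LINT u|lborel. f m u) = of_real B0 * ((-1) ^ m * of_real (bessel_coeff \<beta> m) * w ^ (2 * m))" for m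
  proof -
    have "(LINT u|lborel. f m u) = (-1) ^ m / fact (2 * m) * w ^ (2 * m) * of_real (Beta (real m + 1/2) b)"
      unfolding f_def integral_mult_right_zero integral_complex_of_real val ..
    also have "Beta (real m + 1/2) b = bessel_coeff \<beta> m * fact (2 * m) * B0"
      using bessel_coeff_eq_Beta[of \<beta> m] False assms by (simp add: B0_def b_def)
    finally show ?thesis by simp
  qed
  have fnval: "(LINT u|lborel. norm (f m u)) = B0 * norm ((-1) ^ m * complex_of_real (bessel_coeff \<beta> m) * w ^ (2 * m))" for m
  proof -
    have "(LINT u|lborel. norm (f m u)) = norm w ^ (2 * m) / fact (2 * m) * Beta (real m + 1/2) b"
      unfolding fnorm integral_mult_right_zero val ..
    also have "Beta (real m + 1/2) b = bessel_coeff \<beta> m * fact (2 * m) * B0"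
      using bessel_coeff_eq_Beta[of \<beta> m] False assms by (simp add: B0_def b_def)
    finally show ?thesis using bessel_coeff_pos[OF assms, of m] by (simp add: norm_mult norm_power)
  qed
  have sn: "summable (\<lambda>m. norm (f m u))" for u
  proof (cases "u \<in> {0..1}")
    case True
    have su: "(\<lambda>m. norm w ^ (2 * m) /\<^sub>R fact (2 * m) * wt u) sums (cosh (norm w) * wt u)"
      by (intro sums_mult2 even_power_series_cosh)
    have "norm (norm (f m u)) \<le> norm w ^ (2 * m) /\<^sub>R fact (2 * m) * wt u" for m
    proof -
      have "u ^ m * wt u \<le> 1 * wt u" using True wt0[of u] by (intro mult_right_mono power_le_one) auto
      then have "norm w ^ (2 * m) / fact (2 * m) * (u ^ m * wt u) \<le> norm w ^ (2 * m) / fact (2 * m) * wt u"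
        by (intro mult_left_mono) auto
      then show ?thesis unfolding fnorm[symmetric] by (simp add: divide_inverse mult_ac)
    qed
    then show ?thesis by (rule summable_comparison_test'[OF sums_summable[OF su], of 0])
  qed (simp add: f_def wt_def)
  have sum: "(\<Sum>m. f m u) = cos (sqrt u *\<^sub>R w) * of_real (wt u)" for u
  proof (cases "u \<in> {0..1}")
    case True
    have su: "(\<lambda>m. (-1) ^ m / fact (2 * m) * (sqrt u *\<^sub>R w) ^ (2 * m) * of_real (wt u)) sums (cos (sqrt u *\<^sub>R w) * of_real (wt u))"
      by (intro sums_mult2 even_power_series_cos)
    have e: "(sqrt u *\<^sub>R w) ^ (2 * m) = of_real (u ^ m) * w ^ (2 * m)" for m
      using True by (simp add: scaleR_conv_of_real power_mult_distrib power_mult flip: of_real_power)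
    show ?thesis using su unfolding e f_def by (simp add: sums_iff mult_ac)
  qed (simp add: f_def wt_def)
  \<comment> \<open>Sum and integral may be exchanged because the integrals of the norms are
    \<open>B0\<close> times the terms of the absolutely convergent Bessel series.\<close>
  have sums: "(\<lambda>m. LINT u|lborel. f m u) sums (LINT u|lborel. (\<Sum>m. f m u))"
    and sint: "integrable lborel (\<lambda>u. \<Sum>m. f m u)"
    using fi sn summable_norm_bessel[OF assms, of w]
    by (auto intro!: sums_integral integrable_suminf simp: fnval summable_mult)
  have "of_real B0 * bessel_jc \<beta> w = (LINT u|lborel. (\<Sum>m. f m u))"
    using sums unfolding fval bessel_jc_def
    by (subst suminf_mult[symmetric]) (auto simp: sums_iff summable_norm_cancel[OF summable_norm_bessel[OF assms]])
  then have "B0 * norm (bessel_jc \<beta> w) = norm (LINT u|lborel. (\<Sum>m. f m u))"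
    using B0 by (metis abs_of_pos norm_mult norm_of_real)
  also have "\<dots> \<le> (LINT u|lborel. norm (\<Sum>m. f m u))" by (rule integral_norm_bound)
  also have "\<dots> \<le> (LINT u|lborel. exp \<bar>Im w\<bar> * (u ^ 0 * wt u))"
  proof (rule integral_mono)
    show "integrable lborel (\<lambda>u. exp \<bar>Im w\<bar> * (u ^ 0 * wt u))" by (intro integrable_mult_right int)
    fix u :: real
    show "norm (\<Sum>m. f m u) \<le> exp \<bar>Im w\<bar> * (u ^ 0 * wt u)"
    proof (cases "u \<in> {0..1}")
      case True
      then show ?thesis unfolding sum using wt0[of u] cmod_cos_le_exp[of "sqrt u" w]
        by (auto simp: norm_mult intro!: mult_right_mono)
    qed (simp add: sum wt_def)
  qed (use sint in auto)
  also have "\<dots> = B0 * exp \<bar>Im w\<bar>" unfolding integral_mult_right_zero val by (simp add: B0_def)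
  finally show ?thesis using B0 by simp
qed

section \<open>Integrability and uniqueness\<close>

text \<open>This is the integral for \<open>Gamma (p / q)\<close> under the substitution
  \<open>u = c * x powr q\<close>, taken on the open half line, where the substitution is
  differentiable.\<close>

lemma has_bochner_integral_exp_powr_halfline:
  fixes p q c :: real
  assumes "p > 0" "q > 0" "c > 0"
  shows "has_bochner_integral lborel (\<lambda>x. indicator {0<..} x * (x powr (p - 1) * exp (- (c * x powr q))))
           (Gamma (p / q) * c powr (- (p / q)) / q)"
proof -
  define s where "s = p / q"
  have s: "s > 0" using assms by (simp add: s_def)
  define f where "f = (\<lambda>u::real. u powr (s - 1) * exp (- u))"
  have f0: "f u \<ge> 0" for u by (simp add: f_def)
  define g where "g = (\<lambda>x. c * x powr q)"
  define g' where "g' = (\<lambda>x. c * (q * x powr (q - 1)))"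
  define h where "h = (\<lambda>x. x powr (p - 1) * exp (- (c * x powr q)))"
  have img: "g ` {0<..} = {0<..}"
  proof (intro equalityI subsetI)
    fix y :: real assume y: "y \<in> {0<..}"
    have "g ((y / c) powr (1 / q)) = y" using y assms by (simp add: g_def powr_powr)
    moreover have "(y / c) powr (1 / q) \<in> {0<..}" using y assms by simp
    ultimately show "y \<in> g ` {0<..}" by (metis image_eqI)
  qed (use assms in \<open>auto simp: g_def\<close>)
  have "(f has_integral Gamma s) {0..}"
    using Gamma_integral_real[OF s] by (simp add: f_def exp_minus divide_inverse)
  then have "(f has_integral Gamma s) {0<..}"
    by (subst has_integral_spike_set_eq[where T = "{0..}"]) (auto intro: negligible_subset[of "{0}"])
  then have f: "f absolutely_integrable_on {0<..}" "integral {0<..} f = Gamma s"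
    using f0 by (auto intro: nonnegative_absolutely_integrable_1)
  have "(\<lambda>x. \<bar>g' x\<bar> * f (g x)) absolutely_integrable_on {0<..} \<and>
           integral {0<..} (\<lambda>x. \<bar>g' x\<bar> * f (g x)) = Gamma s"
  proof (rule has_absolute_integral_change_of_variables_1'[where f = f and g = g and g' = g' and S = "{0<..}" and b = "Gamma s", THEN iffD2])
    show "f absolutely_integrable_on g ` {0<..} \<and> integral (g ` {0<..}) f = Gamma s"
      using f unfolding img by simp
    show "inj_on g {0<..}"
    proof (rule inj_on_inverseI[where g = "\<lambda>y. (y / c) powr (1 / q)"])
      fix x :: real assume "x \<in> {0<..}"
      then have "(x powr q) powr (1/q) = x" using assms by (simp add: powr_powr)
      then show "(g x / c) powr (1 / q) = x" using assms by (simp add: g_def)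
    qed
    show "(g has_field_derivative g' x) (at x within {0<..})" if "x \<in> {0<..}" for x
      unfolding g_def g'_def using that
      by (intro DERIV_cmult has_field_derivative_at_within[OF has_real_derivative_powr]) simp
    show "{0::real<..} \<in> sets lebesgue" by simp
  qed
  moreover have gh: "\<bar>g' x\<bar> * f (g x) = q * c powr s * h x" if "x \<in> {0<..}" for x
  proof -
    have "c * (q * x powr (q - 1)) * ((c * x powr q) powr (s - 1)) =
       q * (c powr 1 * c powr (s - 1)) * (x powr (q - 1) * x powr (q * (s - 1)))"
      using that assms by (simp add: powr_mult powr_powr)
    also have "\<dots> = q * c powr s * x powr (p - 1)"
    proof -
      have e: "q - 1 + q * (s - 1) = p - 1" using assms by (simp add: s_def field_simps)
      show ?thesis unfolding powr_add[symmetric] e by simp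
    qed
    finally show ?thesis using that assms by (simp add: g'_def f_def g_def h_def)
  qed
  moreover have "(\<lambda>x. \<bar>g' x\<bar> * f (g x)) absolutely_integrable_on {0<..} \<longleftrightarrow>
      (\<lambda>x. q * c powr s * h x) absolutely_integrable_on {0<..}"
    by (intro set_integrable_cong refl gh)
  moreover have "integral {0<..} (\<lambda>x. \<bar>g' x\<bar> * f (g x)) = integral {0<..} (\<lambda>x. q * c powr s * h x)"
    by (intro integral_cong gh)
  ultimately have "(\<lambda>x. q * c powr s * h x) absolutely_integrable_on {0<..} \<and>
           integral {0<..} (\<lambda>x. q * c powr s * h x) = Gamma s"
    by simp
  then have h: "h absolutely_integrable_on {0<..}" "integral {0<..} h = Gamma s / (q * c powr s)"
  proof -
    assume *: "(\<lambda>x. q * c powr s * h x) absolutely_integrable_on {0<..} \<and>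
           integral {0<..} (\<lambda>x. q * c powr s * h x) = Gamma s"
    have "(\<lambda>x. (1 / (q * c powr s)) * (q * c powr s * h x)) absolutely_integrable_on {0<..}"
      using * by (intro set_integrable_mult_right) auto
    then show "h absolutely_integrable_on {0<..}" using assms by simp
    show "integral {0<..} h = Gamma s / (q * c powr s)" using * assms by (simp add: field_simps)
  qed
  \<comment> \<open>The substitution rule speaks of \<open>lebesgue\<close>; Borel measurability of
    the integrand brings the result back to \<open>lborel\<close>.\<close>
  have meas: "(\<lambda>x. indicator {0<..} x * h x) \<in> borel_measurable lborel"
    unfolding h_def by measurable
  have "integrable lebesgue (\<lambda>x. indicator {0<..} x * h x)"
    using h(1) by (simp add: set_integrable_def)
  then have int: "integrable lborel (\<lambda>x. indicator {0<..} x * h x)"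
    using integrable_completion[OF meas] by simp
  have "((\<lambda>x. indicator {0<..} x * h x) has_integral (LINT x|lborel. indicator {0<..} x * h x)) UNIV"
    by (rule has_integral_integral_lborel[OF int])
  moreover have "(h has_integral integral {0<..} h) {0<..}"
    using h(1) by (intro integrable_integral) (simp add: absolutely_integrable_on_def)
  then have "((\<lambda>x. indicator {0<..} x * h x) has_integral integral {0<..} h) UNIV"
    by (subst (asm) has_integral_restrict_UNIV[symmetric], elim has_integral_eq[rotated]) auto
  ultimately have "(LINT x|lborel. indicator {0<..} x * h x) = Gamma s / (q * c powr s)"
    using h(2) has_integral_unique by metis
  also have "\<dots> = Gamma s * c powr (- s) / q" by (simp add: powr_minus field_simps)
  finally show ?thesis
    using int by (simp add: has_bochner_integral_iff h_def s_def)
qed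

lemma has_bochner_integral_exp_powr:
  fixes p q c :: real
  assumes "p > 0" "q > 0" "c > 0"
  shows "has_bochner_integral lborel (\<lambda>x. \<bar>x\<bar> powr (p - 1) * exp (- (c * \<bar>x\<bar> powr q)))
           (2 * (Gamma (p / q) * c powr (- (p / q)) / q))"
proof -
  define h where "h = (\<lambda>x. indicator {0<..} x * (x powr (p - 1) * exp (- (c * x powr q))))"
  note H = has_bochner_integral_exp_powr_halfline[OF assms, folded h_def]
  have "has_bochner_integral lborel (\<lambda>x. h (0 + (-1) * x)) (Gamma (p / q) * c powr (- (p / q)) / q)"
    using lborel_has_bochner_integral_real_affine_iff[of "-1" h _ 0] H by simp
  from has_bochner_integral_add[OF H this]
  have "has_bochner_integral lborel (\<lambda>x. h x + h (- x)) (2 * (Gamma (p / q) * c powr (- (p / q)) / q))"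
    by simp
  moreover have "h x + h (- x) = \<bar>x\<bar> powr (p - 1) * exp (- (c * \<bar>x\<bar> powr q))" for x
    by (cases x "0::real" rule: linorder_cases) (auto simp: h_def)
  ultimately show ?thesis by simp
qed

section \<open>Lebesgue classes, elementary bounds and Fourier uniqueness\<close>

text \<open>For a finite exponent \<open>r \<ge> 1\<close> one has
  \<open>norm (g x) \<le> 1 + norm (g x) powr r\<close>, so every class lies in bounded plus
  integrable. In this form finite and infinite exponents are treated alike.\<close>

lemma Lp_mem_bound:
  assumes "1 \<le> p" "Lp_mem M p g"
  obtains D H where "D \<ge> 0" "integrable M H" "\<And>x. H x \<ge> (0::real)" "AE x in M. norm (g x) \<le> D + H x"
proof (cases "p = \<infinity>")
  case True
  then obtain B where "AE x in M. norm (g x) \<le> B" using assms by (auto simp: Lp_mem_def)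
  then have "AE x in M. norm (g x) \<le> \<bar>B\<bar> + 0" by eventually_elim auto
  then show thesis by (intro that[of "\<bar>B\<bar>" "\<lambda>_. 0"]) auto
next
  case False
  define r where "r = enn2real p"
  have "enn2real 1 \<le> enn2real p"
    using False assms(1) by (intro enn2real_mono) (auto simp: less_top)
  then have r: "r \<ge> 1" by (simp add: r_def)
  have [measurable]: "g \<in> borel_measurable M" and fin: "(\<integral>\<^sup>+ x. ennreal (norm (g x) powr r) \<partial>M) < \<infinity>"
    using assms False by (auto simp: Lp_mem_def r_def)
  have "integrable M (\<lambda>x. norm (g x) powr r)"
    using fin by (intro integrableI_bounded) auto
  moreover have "norm (g x) \<le> 1 + norm (g x) powr r" for x
  proof (cases "norm (g x) \<le> 1")
    case True
    then show ?thesis by (simp add: add_increasing2)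
  next
    case False
    then have "norm (g x) powr 1 \<le> norm (g x) powr r" using r by (intro powr_mono) auto
    then show ?thesis using False by simp
  qed
  ultimately show thesis by (intro that[of 1 "\<lambda>x. norm (g x) powr r"]) auto
qed

lemma Lp_plus_Lq_bound:
  assumes "1 \<le> p" "1 \<le> q" "Lp_plus_Lq M p q g"
  obtains D H where "D \<ge> 0" "integrable M H" "\<And>x. H x \<ge> (0::real)" "AE x in M. norm (g x) \<le> D + H x"
proof -
  obtain g1 g2 where g: "Lp_mem M p g1" "Lp_mem M q g2" "\<And>x. g x = g1 x + g2 x"
    using assms(3) by (auto simp: Lp_plus_Lq_def)
  obtain D1 H1 where 1: "D1 \<ge> 0" "integrable M H1" "\<And>x. H1 x \<ge> (0::real)" "AE x in M. norm (g1 x) \<le> D1 + H1 x"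
    using Lp_mem_bound[OF assms(1) g(1)] by blast
  obtain D2 H2 where 2: "D2 \<ge> 0" "integrable M H2" "\<And>x. H2 x \<ge> (0::real)" "AE x in M. norm (g2 x) \<le> D2 + H2 x"
    using Lp_mem_bound[OF assms(2) g(2)] by blast
  have "AE x in M. norm (g x) \<le> (D1 + D2) + (H1 x + H2 x)"
    using 1(4) 2(4)
  proof eventually_elim
    case (elim x)
    then show ?case using norm_triangle_ineq[of "g1 x" "g2 x"] by (simp add: g(3))
  qed
  then show thesis using 1 2 by (intro that[of "D1 + D2" "\<lambda>x. H1 x + H2 x"]) auto
qed

text \<open>This follows from \<open>(1 + x / N) ^ N \<le> exp x\<close> at
  \<open>x = \<kappa> * t^2\<close>; replacing \<open>t ^ N\<close> by \<open>1 + (t^2) ^ N\<close>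
  avoids half-integral powers.\<close>

lemma power_le_exp_square:
  fixes \<kappa> :: real
  assumes "\<kappa> > 0"
  obtains C where "C \<ge> 0" "\<And>t. t \<ge> 0 \<Longrightarrow> t ^ N \<le> C * exp (\<kappa> * t\<^sup>2)"
proof (rule that[of "1 + (real N / \<kappa>) ^ N"])
  fix t :: real assume t: "t \<ge> 0"
  have "(t\<^sup>2) ^ N \<le> (real N / \<kappa>) ^ N * exp (\<kappa> * t\<^sup>2)"
  proof (cases "N = 0")
    case False
    have "(\<kappa> * t\<^sup>2 / real N) ^ N \<le> (1 + \<kappa> * t\<^sup>2 / real N) ^ N"
      using assms by (intro power_mono) auto
    also have "\<dots> \<le> exp (\<kappa> * t\<^sup>2)"
      using assms False by (intro exp_ge_one_plus_x_over_n_power_n) (auto intro: order_trans[of _ 0])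
    finally have "(real N / \<kappa>) ^ N * (\<kappa> * t\<^sup>2 / real N) ^ N \<le> (real N / \<kappa>) ^ N * exp (\<kappa> * t\<^sup>2)"
      using assms by (intro mult_left_mono) auto
    then show ?thesis using assms False by (simp flip: power_mult_distrib)
  qed (use assms in auto)
  moreover have "t ^ N \<le> 1 + (t\<^sup>2) ^ N"
  proof (cases "t \<le> 1")
    case True
    then have "t ^ N \<le> 1" using t by (simp add: power_le_one)
    then show ?thesis by (simp add: add_increasing2)
  next
    case False
    then have "t ^ N \<le> t ^ (2 * N)" by (intro power_increasing) auto
    then show ?thesis by (simp add: power_mult)
  qed
  moreover have "1 \<le> exp (\<kappa> * t\<^sup>2)" using assms by simp
  ultimately show "t ^ N \<le> (1 + (real N / \<kappa>) ^ N) * exp (\<kappa> * t\<^sup>2)" unfolding distrib_right by linarith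
qed (use assms in auto)

text \<open>Levy's uniqueness theorem concerns probability measures on the line. The positive and
  the negative part of \<open>g\<close> are therefore normalized and pushed forward along
  \<open>T\<close>; equal characteristic functions make the images equal, and the left inverse
  \<open>S\<close> carries this equality back to \<open>M\<close>.\<close>

lemma fourier_uniqueness_density:
  fixes g T :: "'a \<Rightarrow> real"
  assumes g: "integrable M g" and T [measurable]: "T \<in> borel_measurable M"
    and zero: "\<And>s. (CLINT x|M. of_real (g x) * iexp (s * T x)) = 0"
    and S [measurable]: "S \<in> measurable borel M" and ST: "\<And>x. x \<in> space M \<Longrightarrow> S (T x) = x"
  shows "AE x in M. g x = 0"
proof -
  have [measurable]: "g \<in> borel_measurable M" using g by auto
  define gp where "gp = (\<lambda>x. max 0 (g x))"
  define gm where "gm = (\<lambda>x. max 0 (- g x))"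
  have gpm: "g x = gp x - gm x" "gp x \<ge> 0" "gm x \<ge> 0" for x by (auto simp: gp_def gm_def max_def)
  have [measurable]: "gp \<in> borel_measurable M" "gm \<in> borel_measurable M" by (auto simp: gp_def gm_def)
  have gpi: "integrable M gp" "integrable M gm"
    using g unfolding gp_def gm_def by (auto intro!: integrable_max)
  \<comment> \<open>At frequency 0 the hypothesis says that both parts have the same mass, so one
    constant normalizes both.\<close>
  have "complex_of_real (LINT x|M. g x) = 0"
    using zero[of 0] by simp
  then have eq: "(LINT x|M. gp x) = (LINT x|M. gm x)"
    using gpi unfolding gpm(1) by simp
  define c where "c = (LINT x|M. gp x)"
  have c0: "c \<ge> 0" unfolding c_def by (intro integral_nonneg_AE) (auto simp: gpm)
  show ?thesis
  proof (cases "c = 0")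
    case True
    then have "AE x in M. gp x = 0" "AE x in M. gm x = 0"
      using integral_nonneg_eq_0_iff_AE[OF gpi(1)] integral_nonneg_eq_0_iff_AE[OF gpi(2)] eq gpm
      by (auto simp: c_def)
    then show ?thesis by eventually_elim (simp add: gpm(1))
  next
    case False
    with c0 have c: "c > 0" by simp
    define N where "N = (\<lambda>h. density M (\<lambda>x. ennreal (h x / c)))"
    define K where "K = (\<lambda>h. distr (N h) borel T)"
    have dist: "real_distribution (K h)" and char: "char (K h) s = (CLINT x|M. of_real (h x) * iexp (s * T x)) / c"
      and inv: "N h = distr (K h) M S"
      if h: "integrable M h" "(LINT x|M. h x) = c" "\<And>x. h x \<ge> 0" for h s
    proof -
      have [measurable]: "h \<in> borel_measurable M" using h by auto
      have "emeasure (N h) (space (N h)) = (\<integral>\<^sup>+x. ennreal (h x / c) \<partial>M)"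
        unfolding N_def by (subst emeasure_density) (auto intro!: nn_integral_cong)
      also have "\<dots> = ennreal (LINT x|M. h x / c)"
        using h c by (intro nn_integral_eq_integral) auto
      also have "\<dots> = 1" using h c by simp
      finally interpret prob_space "N h" by (rule prob_spaceI)
      have [measurable]: "T \<in> borel_measurable (N h)" by (simp add: N_def)
      show "real_distribution (K h)"
        unfolding K_def by (intro real_distribution_distr) auto
      have "char (K h) s = (CLINT x|N h. iexp (s * T x))"
        unfolding char_def K_def by (subst integral_distr) auto
      also have "\<dots> = (CLINT x|M. (h x / c) *\<^sub>R iexp (s * T x))"
        unfolding N_def using h c by (subst integral_density) auto
      also have "\<dots> = (CLINT x|M. of_real (h x) * iexp (s * T x) / c)"
        by (intro Bochner_Integration.integral_cong) (auto simp: scaleR_conv_of_real)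
      finally show "char (K h) s = (CLINT x|M. of_real (h x) * iexp (s * T x)) / c" by simp
      have "distr (K h) M S = distr (N h) M (S \<circ> T)"
        unfolding K_def by (subst distr_distr) auto
      also have "\<dots> = distr (N h) M (\<lambda>x. x)"
        by (rule distr_cong) (auto simp: N_def ST)
      also have "\<dots> = N h" by (rule distr_id2) (simp add: N_def)
      finally show "N h = distr (K h) M S" by simp
    qed
    have ie: "integrable M (\<lambda>x. of_real (h x) * iexp (s * T x))" if "integrable M h" for h s
    proof (rule Bochner_Integration.integrable_bound[OF that])
      have [measurable]: "h \<in> borel_measurable M" using that by auto
      show "(\<lambda>x. of_real (h x) * iexp (s * T x)) \<in> borel_measurable M" by measurable
    qed (auto simp: norm_mult)
    have "char (K gp) = char (K gm)"
    proof
      fix s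
      have "(CLINT x|M. of_real (gp x) * iexp (s * T x)) - (CLINT x|M. of_real (gm x) * iexp (s * T x))
         = (CLINT x|M. of_real (gp x) * iexp (s * T x) - of_real (gm x) * iexp (s * T x))"
        by (intro Bochner_Integration.integral_diff[symmetric] ie gpi)
      also have "\<dots> = 0" using zero[of s] unfolding gpm(1) by (simp add: left_diff_distrib)
      finally show "char (K gp) s = char (K gm) s"
        using gpi gpm eq by (simp add: char c_def)
    qed
    then have "K gp = K gm"
      using gpi gpm eq by (intro Levy_uniqueness dist) (auto simp: c_def)
    then have NN: "N gp = N gm" using inv[of gp] inv[of gm] gpi gpm eq by (simp add: c_def)
    \<comment> \<open>\<open>gp\<close> has all its mass on \<open>A\<close> and \<open>gm\<close>
      has none there, so equality of the two normalized measures would give 1 = 0.\<close>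
    define A where "A = {x \<in> space M. g x > 0}"
    have [measurable]: "A \<in> sets M" unfolding A_def by measurable
    have "emeasure (N gp) A = (\<integral>\<^sup>+x. ennreal (gp x / c) * indicator A x \<partial>M)"
      unfolding N_def by (subst emeasure_density) auto
    also have "\<dots> = (\<integral>\<^sup>+x. ennreal (gp x / c) \<partial>M)"
      by (intro nn_integral_cong) (auto simp: A_def gp_def indicator_def max_def)
    also have "\<dots> = ennreal (LINT x|M. gp x / c)"
      using gpi gpm c by (intro nn_integral_eq_integral) auto
    also have "\<dots> = 1" using c by (simp add: c_def)
    finally have "emeasure (N gp) A = 1" .
    moreover have "emeasure (N gm) A = (\<integral>\<^sup>+x. ennreal (gm x / c) * indicator A x \<partial>M)"
      unfolding N_def by (subst emeasure_density) auto
    moreover have "\<dots> = (\<integral>\<^sup>+x. 0 \<partial>M)"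
      by (intro nn_integral_cong) (auto simp: A_def gm_def indicator_def max_def)
    ultimately show ?thesis using NN by simp
  qed
qed

section \<open>The measure and its Hankel transforms\<close>

locale generalized_fourier =
  fixes k :: real and n :: nat
  assumes n1: "n \<ge> 1" and k_ge: "k \<ge> (real n - 1) / (2 * real n)"
begin

abbreviation \<alpha> where "\<alpha> \<equiv> alpha_kn k n"
abbreviation \<mu> where "\<mu> \<equiv> mu_kn k n"

definition rad :: "real \<Rightarrow> real" where "rad x = \<bar>x\<bar> powr (1 / real n)"

definition dens :: "real \<Rightarrow> real" where
  "dens x = 1 / (2 * Gamma (\<alpha> + 1)) * (real n / 2) powr \<alpha> * \<bar>x\<bar> powr (2 * k + 2 / real n - 2)"

text \<open>The lower bound on \<open>k\<close>, rewritten. The value -1/2 is the order at which the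
  Bessel kernel is the cosine.\<close>

lemma alpha_ge: "\<alpha> \<ge> -1/2"
proof -
  have "real n > 0" using n1 by simp
  with k_ge have "k * (2 * real n) \<ge> real n - 1" by (simp add: pos_divide_le_eq)
  then show ?thesis by (simp add: alpha_kn_def)
qed

lemma Gamma_alpha_pos: "Gamma (\<alpha> + 1) > 0"
  using alpha_ge by (intro Gamma_real_pos) linarith

lemma rad_nonneg [simp]: "rad x \<ge> 0" and rad_minus [simp]: "rad (- x) = rad x" and rad_0 [simp]: "rad 0 = 0"
  by (auto simp: rad_def)

lemma rad_measurable [measurable]: "rad \<in> borel_measurable borel"
  unfolding rad_def by measurable

lemma rad_power_n: "rad x ^ n = \<bar>x\<bar>"
  using n1 by (cases "x = 0") (auto simp: rad_def powr_powr simp flip: powr_realpow)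

lemma rad_mult: "\<bar>y * x\<bar> powr (1 / real n) = rad y * rad x"
  by (simp add: rad_def abs_mult powr_mult)

lemma rad_of_power: "\<tau> \<ge> 0 \<Longrightarrow> rad (\<tau> ^ n) = \<tau>"
  using n1 by (cases "\<tau> = 0") (auto simp: rad_def powr_powr simp flip: powr_realpow)

lemma rad_square: "\<bar>x\<bar> powr (2 / real n) = (rad x)\<^sup>2"
  by (cases "x = 0") (auto simp: rad_def powr_powr simp flip: powr_realpow)

lemma dens_measurable [measurable]: "dens \<in> borel_measurable borel"
  unfolding dens_def by measurable

lemma dens_nonneg: "dens x \<ge> 0" and dens_minus [simp]: "dens (- x) = dens x"
  using Gamma_alpha_pos by (auto simp: dens_def)

lemma dens_pos: "x \<noteq> 0 \<Longrightarrow> dens x > 0"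
  using Gamma_alpha_pos n1 by (auto simp: dens_def intro!: divide_pos_pos mult_pos_pos)

lemma mu_eq: "\<mu> = density lborel (\<lambda>x. ennreal (dens x))"
  by (simp add: mu_kn_def dens_def)

lemma sets_mu [simp, measurable_cong]: "sets \<mu> = sets borel"
  and space_mu [simp]: "space \<mu> = UNIV"
  by (auto simp: mu_eq)

lemma AE_mu_iff: "(AE x in \<mu>. P x) \<longleftrightarrow> (AE x in lborel. P x)"
proof -
  have "(AE x in \<mu>. P x) \<longleftrightarrow> (AE x in lborel. 0 < ennreal (dens x) \<longrightarrow> P x)"
    unfolding mu_eq by (subst AE_density) auto
  also have "\<dots> \<longleftrightarrow> (AE x in lborel. P x)"
  proof
    assume *: "AE x in lborel. 0 < ennreal (dens x) \<longrightarrow> P x"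
    \<comment> \<open>\<open>0 powr r\<close> is 0 for every \<open>r\<close>, so the density
      vanishes at the origin whatever its exponent; that point is null.\<close>
    have "AE x in lborel. x \<noteq> (0::real)" by (rule AE_lborel_singleton)
    with * show "AE x in lborel. P x" by eventually_elim (auto simp: dens_pos)
  qed auto
  finally show ?thesis .
qed

lemma nn_integral_mu_reflect:
  assumes [measurable]: "f \<in> borel_measurable borel"
  shows "(\<integral>\<^sup>+x. f (- x) \<partial>\<mu>) = (\<integral>\<^sup>+x. f x \<partial>\<mu>)"
proof -
  have "(\<integral>\<^sup>+x. f x \<partial>\<mu>) = (\<integral>\<^sup>+x. ennreal (dens x) * f x \<partial>lborel)"
    unfolding mu_eq by (subst nn_integral_density) auto
  also have "\<dots> = (\<integral>\<^sup>+x. ennreal (dens (0 + (-1) * x)) * f (0 + (-1) * x) \<partial>lborel)"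
    by (subst nn_integral_real_affine[where c = "-1" and t = 0]) auto
  also have "\<dots> = (\<integral>\<^sup>+x. f (- x) \<partial>\<mu>)"
    unfolding mu_eq by (subst nn_integral_density) auto
  finally show ?thesis by simp
qed

lemma distr_mu_uminus: "distr \<mu> borel uminus = \<mu>"
proof (rule measure_eqI)
  fix A assume "A \<in> sets (distr \<mu> borel uminus)"
  then have A [measurable]: "A \<in> sets borel" by simp
  have "emeasure (distr \<mu> borel uminus) A = (\<integral>\<^sup>+x. indicator A x \<partial>distr \<mu> borel uminus)" by simp
  also have "\<dots> = (\<integral>\<^sup>+x. indicator A (- x) \<partial>\<mu>)" by (subst nn_integral_distr) auto
  also have "\<dots> = emeasure \<mu> A" by (subst nn_integral_mu_reflect) auto
  finally show "emeasure (distr \<mu> borel uminus) A = emeasure \<mu> A" .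
qed auto

lemma integral_mu_reflect:
  fixes f :: "real \<Rightarrow> 'a :: {banach, second_countable_topology}"
  assumes [measurable]: "f \<in> borel_measurable borel"
  shows "(LINT x|\<mu>. f (- x)) = (LINT x|\<mu>. f x)"
    and "integrable \<mu> (\<lambda>x. f (- x)) \<longleftrightarrow> integrable \<mu> f"
proof -
  show "(LINT x|\<mu>. f (- x)) = (LINT x|\<mu>. f x)"
    using integral_distr[of uminus \<mu> borel f] by (simp add: distr_mu_uminus)
  show "integrable \<mu> (\<lambda>x. f (- x)) \<longleftrightarrow> integrable \<mu> f"
    using integrable_distr_eq[of uminus \<mu> borel f] by (simp add: distr_mu_uminus)
qed

section \<open>Gaussian moments and Gaussian growth\<close>

text \<open>In the variable \<open>rad x\<close> this is a Gamma integral with parameter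
  \<open>\<alpha> + 1 + m\<close>. The normalization of the measure leaves the pure power
  \<open>(2 * c) powr (- (\<alpha> + 1))\<close> as total mass, the source of the constant in the
  critical case.\<close>

lemma gaussian_moment:
  assumes c: "c > 0"
  shows "has_bochner_integral \<mu> (\<lambda>x. exp (- (real n * c * (rad x)\<^sup>2)) * rad x ^ (2 * m))
    ((2 * c) powr (- (\<alpha> + 1)) * (Gamma (\<alpha> + 1 + real m) / Gamma (\<alpha> + 1) / (real n * c) ^ m))"
proof -
  have np: "real n > 0" using n1 by simp
  \<comment> \<open>\<open>p - 1\<close> is the total exponent of \<open>|x|\<close>: that of the
    density plus \<open>2 * m / n\<close> from \<open>rad x ^ (2 * m)\<close>.\<close>
  define p where "p = 2 * k + 2 / real n - 2 + 2 * real m / real n + 1"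
  have pq: "p / (2 / real n) = \<alpha> + 1 + real m"
    using np by (simp add: p_def alpha_kn_def field_simps)
  have "\<alpha> + 1 + real m > 0" using alpha_ge by linarith
  then have "p / (2 / real n) > 0" unfolding pq .
  then have p: "p > 0" using np by (simp add: zero_less_divide_iff zero_less_mult_iff)
  define cst where "cst = 1 / (2 * Gamma (\<alpha> + 1)) * (real n / 2) powr \<alpha>"
  have eq: "dens x *\<^sub>R (exp (- (real n * c * (rad x)\<^sup>2)) * rad x ^ (2 * m))
     = cst * (\<bar>x\<bar> powr (p - 1) * exp (- (real n * c * \<bar>x\<bar> powr (2 / real n))))" for x
  proof (cases "x = 0")
    case False
    have "rad x ^ (2 * m) = \<bar>x\<bar> powr (2 * real m / real n)"
      using False by (simp add: rad_def powr_powr flip: powr_realpow)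
    moreover have "\<bar>x\<bar> powr (p - 1) = \<bar>x\<bar> powr (2 * k + 2 / real n - 2) * \<bar>x\<bar> powr (2 * real m / real n)"
      unfolding powr_add[symmetric] by (rule arg_cong[where f = "(powr) \<bar>x\<bar>"]) (simp add: p_def)
    ultimately show ?thesis by (simp add: dens_def cst_def rad_square)
  qed (simp add: dens_def)
  have "has_bochner_integral lborel (\<lambda>x. dens x *\<^sub>R (exp (- (real n * c * (rad x)\<^sup>2)) * rad x ^ (2 * m)))
     (cst * (2 * (Gamma (p / (2 / real n)) * (real n * c) powr (- (p / (2 / real n))) / (2 / real n))))"
    unfolding eq using p np c by (intro has_bochner_integral_mult_right has_bochner_integral_exp_powr) auto
  moreover have "cst * (2 * (Gamma (p / (2 / real n)) * (real n * c) powr (- (p / (2 / real n))) / (2 / real n)))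
    = (2 * c) powr (- (\<alpha> + 1)) * (Gamma (\<alpha> + 1 + real m) / Gamma (\<alpha> + 1) / (real n * c) ^ m)"
  proof -
    have e1: "(real n * c) powr (- (\<alpha> + 1 + real m)) = (real n * c) powr (- (\<alpha> + 1)) / (real n * c) ^ m"
      using np c by (simp add: powr_diff powr_realpow minus_add_distrib[symmetric] flip: diff_conv_add_uminus)
    have e2: "(real n / 2) powr \<alpha> * (real n * c) powr (- (\<alpha> + 1)) * (real n / 2) = (2 * c) powr (- (\<alpha> + 1))"
    proof -
      have "(real n / 2) powr \<alpha> * (real n / 2) = (real n / 2) powr (\<alpha> + 1)"
        using np by (simp add: powr_add)
      moreover have "(real n * c) powr (- (\<alpha> + 1)) = (real n / 2) powr (- (\<alpha> + 1)) * (2 * c) powr (- (\<alpha> + 1))"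
        using np c by (simp flip: powr_mult)
      moreover have "(real n / 2) powr (\<alpha> + 1) * (real n / 2) powr (- (\<alpha> + 1)) = 1"
        using np by (simp flip: powr_add)
      ultimately show ?thesis by (simp add: mult_ac) (metis mult.assoc mult.commute mult_1)
    qed
    show ?thesis unfolding pq cst_def e1 e2[symmetric] by (simp add: field_simps)
  qed
  ultimately have *: "has_bochner_integral lborel (\<lambda>x. dens x *\<^sub>R (exp (- (real n * c * (rad x)\<^sup>2)) * rad x ^ (2 * m)))
     ((2 * c) powr (- (\<alpha> + 1)) * (Gamma (\<alpha> + 1 + real m) / Gamma (\<alpha> + 1) / (real n * c) ^ m))" by simp
  show ?thesis
    unfolding mu_eq by (rule has_bochner_integral_density[OF _ _ _ *]) (auto simp: dens_nonneg)
qed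

lemma gaussian_integral:
  assumes "c > 0"
  shows "has_bochner_integral \<mu> (\<lambda>x. exp (- (real n * c * (rad x)\<^sup>2))) ((2 * c) powr (- (\<alpha> + 1)))"
  using gaussian_moment[OF assms, of 0] Gamma_alpha_pos by simp

text \<open>With \<open>t = rad x\<close> and \<open>s = y / (2 * a)\<close>,
  \<open>- a t^2 + t y = y^2 / (4 a) - a (t - s)^2\<close>. The sharp exponential comes out, and the
  rest must cost only a power of \<open>1 + y\<close>, in two senses at once: as an integral, to
  meet the bounded part \<open>D\<close>, and as a supremum, to meet the integrable part
  \<open>H\<close>. The majorant \<open>W\<close> serves both.\<close>

lemma gaussian_bound_growth:
  fixes G :: "real \<Rightarrow> complex" and H :: "real \<Rightarrow> real"
  assumes [measurable]: "G \<in> borel_measurable borel"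
    and a: "a > 0" and D: "D \<ge> 0" and H: "integrable \<mu> H" "\<And>x. H x \<ge> 0"
    and bd: "AE x in \<mu>. norm (G x) \<le> rad x ^ N * exp (- (real n * a * (rad x)\<^sup>2)) * (D + H x)"
  obtains A M where
    "\<And>y. y \<ge> 0 \<Longrightarrow> integrable \<mu> (\<lambda>x. norm (G x) * exp (real n * rad x * y))"
    "\<And>y. y \<ge> 0 \<Longrightarrow> (LINT x|\<mu>. norm (G x) * exp (real n * rad x * y)) \<le> A * (1 + y) ^ M * exp (real n * y\<^sup>2 / (4 * a))"
proof -
  have np: "real n > 0" using n1 by simp
  have [measurable]: "H \<in> borel_measurable borel" using H(1) by auto
  obtain C where C: "C \<ge> 0" "\<And>t. t \<ge> 0 \<Longrightarrow> t ^ N \<le> C * exp (real n * a / 8 * t\<^sup>2)"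
    using power_le_exp_square[of "real n * a / 8" N] np a by auto
  define L where "L = (\<lambda>y. 1 + y / a)"
  \<comment> \<open>For \<open>t \<le> 2 * s\<close> one has \<open>t \<le> L y\<close>, so
    \<open>exp 1\<close> times the Gaussian of width \<open>L y\<close> is at least 1. For
    \<open>t > 2 * s\<close> the shifted Gaussian is at most \<open>exp (- n a t^2 / 4)\<close>;
    half of that exponent absorbs \<open>t ^ N\<close>, which leaves \<open>a / 8\<close>. Both
    summands are centred Gaussians with known integrals.\<close>
  define W where "W = (\<lambda>y x. exp 1 * L y ^ N * exp (- (real n * (1 / (real n * (L y)\<^sup>2)) * (rad x)\<^sup>2))
      + C * exp (- (real n * (a / 8) * (rad x)\<^sup>2)))"
  define Q where "Q = (real n / 2) powr (\<alpha> + 1)"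
  define c1 where "c1 = (2 * (a / 8)) powr (- (\<alpha> + 1))"
  \<comment> \<open>The wide Gaussian has integral \<open>Q * L y powr (2 * (\<alpha> + 1))\<close>;
    the exponent is rounded up to a natural number.\<close>
  define M' where "M' = nat \<lceil>2 * (\<alpha> + 1)\<rceil>"
  define KH where "KH = (LINT x|\<mu>. H x)"
  have KH: "KH \<ge> 0" unfolding KH_def using H by (intro integral_nonneg_AE) auto
  have L1: "L y \<ge> 1" if "y \<ge> 0" for y using that a by (simp add: L_def)
  have W0: "W y x \<ge> 0" if "y \<ge> 0" for y x using L1[OF that] C by (auto simp: W_def)
  have Wint: "has_bochner_integral \<mu> (W y) (exp 1 * L y ^ N * (2 * (1 / (real n * (L y)\<^sup>2))) powr (- (\<alpha> + 1)) + C * c1)"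
    if y: "y \<ge> 0" for y
    unfolding W_def c1_def using L1[OF y] np a
    by (intro has_bochner_integral_add has_bochner_integral_mult_right gaussian_integral) auto
  have Wint_le: "(LINT x|\<mu>. W y x) \<le> (exp 1 * Q + C * c1) * L y ^ (N + M')" if y: "y \<ge> 0" for y
  proof -
    have Lp: "L y > 0" using L1[OF y] by simp
    have "(2 * (1 / (real n * (L y)\<^sup>2))) powr (- (\<alpha> + 1)) = (real n / 2 * (L y)\<^sup>2) powr (\<alpha> + 1)"
    proof -
      define u where "u = real n / 2 * (L y)\<^sup>2"
      have u: "u > 0" using np Lp by (simp add: u_def)
      then have e: "2 * (1 / (real n * (L y)\<^sup>2)) = u powr (-1)" by (simp add: u_def powr_minus_divide)
      show ?thesis unfolding e powr_powr by (simp add: u_def add.commute)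
    qed
    also have "\<dots> = Q * L y powr (2 * (\<alpha> + 1))"
    proof -
      have "(L y)\<^sup>2 = L y powr 2" using Lp by simp
      then show ?thesis using np Lp by (simp only: powr_mult Q_def powr_powr)
    qed
    also have "\<dots> \<le> Q * L y powr real M'"
      using L1[OF y] real_nat_ceiling_ge[of "2 * (\<alpha> + 1)", folded M'_def]
      by (intro mult_left_mono powr_mono) (auto simp: Q_def)
    also have "\<dots> = Q * L y ^ M'" using Lp by (simp add: powr_realpow)
    finally have *: "(2 * (1 / (real n * (L y)\<^sup>2))) powr (- (\<alpha> + 1)) \<le> Q * L y ^ M'" .
    have "(LINT x|\<mu>. W y x) = exp 1 * L y ^ N * (2 * (1 / (real n * (L y)\<^sup>2))) powr (- (\<alpha> + 1)) + C * c1"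
      using Wint[OF y] by (rule has_bochner_integral_integral_eq)
    also have "\<dots> \<le> exp 1 * L y ^ N * (Q * L y ^ M') + C * c1 * L y ^ (N + M')"
    proof (rule add_mono)
      have "C * c1 * 1 \<le> C * c1 * L y ^ (N + M')"
        using L1[OF y] C(1) by (intro mult_left_mono one_le_power) (auto simp: c1_def)
      then show "C * c1 \<le> C * c1 * L y ^ (N + M')" by simp
    qed (use * L1[OF y] in \<open>auto intro!: mult_left_mono\<close>)
    also have "\<dots> = (exp 1 * Q + C * c1) * L y ^ (N + M')" by (simp add: power_add algebra_simps)
    finally show ?thesis .
  qed
  have Wsup: "W y x \<le> (exp 1 + C) * L y ^ (N + M')" if y: "y \<ge> 0" for y x
  proof -
    have "exp (- (real n * (1 / (real n * (L y)\<^sup>2)) * (rad x)\<^sup>2)) \<le> 1" "exp (- (real n * (a / 8) * (rad x)\<^sup>2)) \<le> 1"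
      using np a by auto
    then have "W y x \<le> exp 1 * L y ^ N * 1 + C * 1"
      unfolding W_def using L1[OF y] C by (intro add_mono mult_left_mono) auto
    also have "\<dots> = exp 1 * L y ^ N + C * 1" by simp
    also have "\<dots> \<le> exp 1 * L y ^ (N + M') + C * L y ^ (N + M')"
    proof (intro add_mono mult_left_mono)
      show "L y ^ N \<le> L y ^ (N + M')" using L1[OF y] by (intro power_increasing) auto
      show "1 \<le> L y ^ (N + M')" using L1[OF y] by (intro one_le_power) auto
    qed (use C L1[OF y] in auto)
    finally show ?thesis by (simp add: algebra_simps)
  qed
  have ptw: "rad x ^ N * exp (- (real n * a * (rad x)\<^sup>2)) * exp (real n * rad x * y)
      \<le> exp (real n * y\<^sup>2 / (4 * a)) * W y x" if y: "y \<ge> 0" for x y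
  proof -
    define t where "t = rad x"
    define s where "s = y / (2 * a)"
    have t: "t \<ge> 0" by (simp add: t_def)
    have s: "s \<ge> 0" "L y = 1 + 2 * s" using y a by (auto simp: s_def L_def)
    have "- (real n * a * t\<^sup>2) + real n * t * y = real n * y\<^sup>2 / (4 * a) - real n * a * (t - s)\<^sup>2"
      using a by (simp add: s_def power2_eq_square field_simps)
    then have e: "exp (- (real n * a * t\<^sup>2)) * exp (real n * t * y) = exp (real n * y\<^sup>2 / (4 * a)) * exp (- (real n * a * (t - s)\<^sup>2))"
      by (simp flip: exp_add)
    have "t ^ N * exp (- (real n * a * (t - s)\<^sup>2)) \<le> W y x"
    proof (cases "t \<le> 2 * s")
      case True
      then have tL: "t \<le> L y" using s by simp
      have "t ^ N \<le> L y ^ N" using tL t by (intro power_mono) auto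
      moreover have "exp (- (real n * a * (t - s)\<^sup>2)) \<le> exp 1 * exp (- (real n * (1 / (real n * (L y)\<^sup>2)) * t\<^sup>2))"
      proof -
        have "t\<^sup>2 \<le> (L y)\<^sup>2" using tL t by (intro power_mono) auto
        then have "t\<^sup>2 / (L y)\<^sup>2 \<le> 1" using L1[OF y] by (simp add: divide_le_eq_1)
        then have "real n * (1 / (real n * (L y)\<^sup>2)) * t\<^sup>2 \<le> 1" using np by simp
        moreover have "real n * a * (t - s)\<^sup>2 \<ge> 0" using np a by simp
        ultimately show ?thesis unfolding exp_add[symmetric] exp_le_cancel_iff by linarith
      qed
      ultimately have "t ^ N * exp (- (real n * a * (t - s)\<^sup>2))
          \<le> L y ^ N * (exp 1 * exp (- (real n * (1 / (real n * (L y)\<^sup>2)) * t\<^sup>2)))"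
        using t L1[OF y] by (intro mult_mono) auto
      also have "\<dots> \<le> W y x" using C by (simp add: W_def t_def mult_ac)
      finally show ?thesis .
    next
      case False
      have "(t / 2)\<^sup>2 \<le> (t - s)\<^sup>2" using False t s by (intro power_mono) auto
      then have "real n * a * (t\<^sup>2 / 4) \<le> real n * a * (t - s)\<^sup>2"
        using np a by (intro mult_left_mono) (auto simp: power_divide)
      then have "exp (- (real n * a * (t - s)\<^sup>2)) \<le> exp (- (real n * a / 4 * t\<^sup>2))" by simp
      then have "t ^ N * exp (- (real n * a * (t - s)\<^sup>2)) \<le> C * exp (real n * a / 8 * t\<^sup>2) * exp (- (real n * a / 4 * t\<^sup>2))"
        using C t by (intro mult_mono) auto
      also have "\<dots> = C * exp (- (real n * (a / 8) * t\<^sup>2))"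
      proof -
        have "real n * a / 8 * t\<^sup>2 + - (real n * a / 4 * t\<^sup>2) = - (real n * (a / 8) * t\<^sup>2)" by (simp add: field_simps)
        then show ?thesis by (metis exp_add mult.assoc)
      qed
      also have "\<dots> \<le> W y x" using L1[OF y] by (simp add: W_def t_def)
      finally show ?thesis .
    qed
    then have "exp (real n * y\<^sup>2 / (4 * a)) * (t ^ N * exp (- (real n * a * (t - s)\<^sup>2))) \<le> exp (real n * y\<^sup>2 / (4 * a)) * W y x"
      by (intro mult_left_mono) auto
    moreover have "t ^ N * exp (- (real n * a * t\<^sup>2)) * exp (real n * t * y)
       = exp (real n * y\<^sup>2 / (4 * a)) * (t ^ N * exp (- (real n * a * (t - s)\<^sup>2)))"
      using e by (simp add: mult_ac)
    ultimately show ?thesis unfolding t_def by (simp only:)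
  qed
  define B where "B = (\<lambda>y x. exp (real n * y\<^sup>2 / (4 * a)) * (D * W y x + (exp 1 + C) * L y ^ (N + M') * H x))"
  have AEB: "AE x in \<mu>. norm (G x) * exp (real n * rad x * y) \<le> B y x" if y: "y \<ge> 0" for y
    using bd
  proof eventually_elim
    case (elim x)
    have "norm (G x) * exp (real n * rad x * y) \<le> rad x ^ N * exp (- (real n * a * (rad x)\<^sup>2)) * (D + H x) * exp (real n * rad x * y)"
      using elim by (intro mult_right_mono) auto
    also have "\<dots> = (rad x ^ N * exp (- (real n * a * (rad x)\<^sup>2)) * exp (real n * rad x * y)) * (D + H x)" by simp
    also have "\<dots> \<le> (exp (real n * y\<^sup>2 / (4 * a)) * W y x) * (D + H x)"
      using ptw[OF y] D H(2) by (intro mult_right_mono) auto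
    also have "\<dots> = exp (real n * y\<^sup>2 / (4 * a)) * (D * W y x + W y x * H x)" by (simp add: algebra_simps)
    also have "\<dots> \<le> B y x"
      unfolding B_def using Wsup[OF y] H(2) by (intro mult_left_mono add_left_mono mult_right_mono) auto
    finally show ?case .
  qed
  have Bint: "integrable \<mu> (B y)" and Bval: "(LINT x|\<mu>. B y x) =
      exp (real n * y\<^sup>2 / (4 * a)) * (D * (LINT x|\<mu>. W y x) + (exp 1 + C) * L y ^ (N + M') * KH)" if y: "y \<ge> 0" for y
    using Wint[OF y] H unfolding B_def KH_def by (auto simp: has_bochner_integral_iff)
  have int: "integrable \<mu> (\<lambda>x. norm (G x) * exp (real n * rad x * y))" if y: "y \<ge> 0" for y
  proof (rule Bochner_Integration.integrable_bound[OF Bint[OF y]])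
    show "AE x in \<mu>. norm (norm (G x) * exp (real n * rad x * y)) \<le> norm (B y x)"
      using AEB[OF y] by eventually_elim (auto simp: abs_mult)
  qed measurable
  define A0 where "A0 = D * (exp 1 * Q + C * c1) + (exp 1 + C) * KH"
  have A0: "A0 \<ge> 0" unfolding A0_def using D C KH by (auto simp: Q_def c1_def)
  show thesis
  proof (rule that[of "A0 * (max 1 (1 / a)) ^ (N + M')" "N + M'"])
    fix y :: real assume y: "y \<ge> 0"
    show "integrable \<mu> (\<lambda>x. norm (G x) * exp (real n * rad x * y))" by (rule int[OF y])
    have "(LINT x|\<mu>. norm (G x) * exp (real n * rad x * y)) \<le> (LINT x|\<mu>. B y x)"
      using int[OF y] Bint[OF y] AEB[OF y] by (rule integral_mono_AE)
    also have "\<dots> \<le> exp (real n * y\<^sup>2 / (4 * a)) *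
        (D * ((exp 1 * Q + C * c1) * L y ^ (N + M')) + (exp 1 + C) * L y ^ (N + M') * KH)"
      unfolding Bval[OF y] using Wint_le[OF y] D by (intro mult_left_mono add_right_mono) auto
    also have "\<dots> = A0 * L y ^ (N + M') * exp (real n * y\<^sup>2 / (4 * a))"
      by (simp add: A0_def algebra_simps)
    also have "\<dots> \<le> A0 * (max 1 (1 / a) * (1 + y)) ^ (N + M') * exp (real n * y\<^sup>2 / (4 * a))"
    proof (intro mult_right_mono mult_left_mono power_mono)
      have "y * (1 / a) \<le> y * max 1 (1 / a)" using y by (intro mult_left_mono) auto
      then have "1 + y * (1 / a) \<le> max 1 (1 / a) + y * max 1 (1 / a)" by (intro add_mono) auto
      also have "\<dots> = max 1 (1 / a) * (1 + y)" by (simp add: algebra_simps)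
      finally show "L y \<le> max 1 (1 / a) * (1 + y)" by (simp add: L_def)
    qed (use A0 L1[OF y] in auto)
    finally show "(LINT x|\<mu>. norm (G x) * exp (real n * rad x * y))
        \<le> A0 * (max 1 (1 / a)) ^ (N + M') * (1 + y) ^ (N + M') * exp (real n * y\<^sup>2 / (4 * a))"
      by (simp add: power_mult_distrib mult_ac)
  qed
qed

section \<open>Hankel transforms as entire functions\<close>

text \<open>Integrability against these exponentials for every \<open>y\<close> dominates the whole
  power series of the kernel at every complex point, for all orders at least -1/2 at once.\<close>

definition exp_integrable :: "(real \<Rightarrow> complex) \<Rightarrow> bool" where
  "exp_integrable G \<longleftrightarrow> G \<in> borel_measurable borel \<and>
     (\<forall>y\<ge>0. integrable \<mu> (\<lambda>x. norm (G x) * exp (real n * rad x * y)))"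

text \<open>At \<open>z = of_real (rad y)\<close> the kernel has the argument
  \<open>n * |x y| powr (1 / n)\<close> of \<open>B_kn\<close>; complex \<open>z\<close> continue
  the transform analytically in \<open>rad y\<close>. The kernel depends on \<open>x\<close> only
  through \<open>rad x\<close>, so the odd part of \<open>G\<close> is invisible.\<close>

definition htrans :: "real \<Rightarrow> (real \<Rightarrow> complex) \<Rightarrow> complex \<Rightarrow> complex" where
  "htrans \<beta> G z = (LINT x|\<mu>. G x * bessel_jc \<beta> (of_real (real n * rad x) * z))"

text \<open>Taylor coefficients in the variable \<open>z^2\<close>. The order enters only through
  the factor in front of the moment.\<close>

definition hcoeff :: "real \<Rightarrow> (real \<Rightarrow> complex) \<Rightarrow> nat \<Rightarrow> complex" where
  "hcoeff \<beta> G m = (-1) ^ m * of_real (bessel_coeff \<beta> m * real n ^ (2 * m)) * (LINT x|\<mu>. G x * of_real (rad x ^ (2 * m)))"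

text \<open>Partial sums of the kernel series are dominated by \<open>cosh t \<le> exp t\<close>
  with \<open>t = n * rad x * norm z\<close>, which justifies integrating term by term.\<close>

lemma htrans_power_series:
  assumes G: "exp_integrable G" and \<beta>: "\<beta> \<ge> -1/2"
  shows "(\<lambda>m. hcoeff \<beta> G m * (z\<^sup>2) ^ m) sums htrans \<beta> G z"
    and "integrable \<mu> (\<lambda>x. G x * bessel_jc \<beta> (of_real (real n * rad x) * z))"
    and "integrable \<mu> (\<lambda>x. G x * of_real (rad x ^ (2 * m)))"
proof -
  have np: "real n > 0" using n1 by simp
  have [measurable]: "G \<in> borel_measurable borel" and int: "\<And>y. y \<ge> 0 \<Longrightarrow> integrable \<mu> (\<lambda>x. norm (G x) * exp (real n * rad x * y))"
    using G by (auto simp: exp_integrable_def)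
  define f where "f = (\<lambda>m x. G x * ((-1) ^ m * of_real (bessel_coeff \<beta> m) * (of_real (real n * rad x) * z) ^ (2 * m)))"
  have [measurable]: "f m \<in> borel_measurable borel" for m unfolding f_def by measurable
  define y where "y = norm z"
  have y: "y \<ge> 0" by (simp add: y_def)
  have part: "(\<Sum>i<m. norm (f i x)) \<le> norm (G x) * exp (real n * rad x * y)" for m x
  proof -
    define t where "t = real n * rad x * y"
    have t: "t \<ge> 0" using y by (simp add: t_def)
    have "(\<Sum>i<m. norm (f i x)) \<le> (\<Sum>i<m. norm (G x) * (t ^ (2 * i) /\<^sub>R fact (2 * i)))"
    proof (rule sum_mono)
      fix i
      have "norm (of_real (real n * rad x) * z) = t" by (simp add: norm_mult t_def y_def)
      then have "norm ((-1) ^ i * complex_of_real (bessel_coeff \<beta> i) * (of_real (real n * rad x) * z) ^ (2 * i)) \<le> t ^ (2 * i) /\<^sub>R fact (2 * i)"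
        using bessel_terms_norm_le[OF \<beta>, of i "of_real (real n * rad x) * z"] by simp
      then show "norm (f i x) \<le> norm (G x) * (t ^ (2 * i) /\<^sub>R fact (2 * i))"
        unfolding f_def norm_mult[of "G x"] by (intro mult_left_mono) auto
    qed
    also have "\<dots> = norm (G x) * (\<Sum>i<m. t ^ (2 * i) /\<^sub>R fact (2 * i))" by (simp add: sum_distrib_left)
    also have "(\<Sum>i<m. t ^ (2 * i) /\<^sub>R fact (2 * i)) \<le> cosh t"
      using even_power_series_cosh[of t] t by (subst sums_unique[OF even_power_series_cosh]) (auto intro!: sum_le_suminf sums_summable)
    also have "cosh t \<le> exp t" using t by (simp add: cosh_def)
    finally show ?thesis by (simp add: t_def mult_left_mono)
  qed
  have fle: "norm (f m x) \<le> norm (G x) * exp (real n * rad x * y)" for m x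
    using part[of x "Suc m"] sum_nonneg[of "{..<m}" "\<lambda>i. norm (f i x)"] by simp
  have fi: "integrable \<mu> (f m)" for m
    by (rule Bochner_Integration.integrable_bound[OF int[OF y]]) (use fle in \<open>auto simp: abs_mult\<close>)
  have sm: "summable (\<lambda>m. LINT x|\<mu>. norm (f m x))"
  proof (rule summableI_nonneg_bounded)
    fix m
    have "(\<Sum>i<m. LINT x|\<mu>. norm (f i x)) = (LINT x|\<mu>. (\<Sum>i<m. norm (f i x)))"
      using fi by (intro Bochner_Integration.integral_sum[symmetric]) auto
    also have "\<dots> \<le> (LINT x|\<mu>. norm (G x) * exp (real n * rad x * y))"
      using fi part int[OF y] by (intro integral_mono) auto
    finally show "(\<Sum>i<m. LINT x|\<mu>. norm (f i x)) \<le> (LINT x|\<mu>. norm (G x) * exp (real n * rad x * y))" .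
  qed auto
  have sn: "summable (\<lambda>m. norm (f m x))" for x
    by (rule summableI_nonneg_bounded[OF _ part]) auto
  have suminf: "(\<Sum>m. f m x) = G x * bessel_jc \<beta> (of_real (real n * rad x) * z)" for x
    unfolding f_def bessel_jc_def
    by (intro suminf_mult summable_norm_cancel[OF summable_norm_bessel[OF \<beta>]])
  have "(\<lambda>m. LINT x|\<mu>. f m x) sums (LINT x|\<mu>. (\<Sum>m. f m x))"
    using fi sn sm by (intro sums_integral) auto
  moreover have "(LINT x|\<mu>. f m x) = hcoeff \<beta> G m * (z\<^sup>2) ^ m" for m
  proof -
    have fx: "f m x = ((-1) ^ m * of_real (bessel_coeff \<beta> m * real n ^ (2 * m)) * (z\<^sup>2) ^ m) * (G x * of_real (rad x ^ (2 * m)))" for x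
    proof -
      have "(complex_of_real (real n * rad x) * z) ^ (2 * m) = of_real (real n ^ (2 * m)) * of_real (rad x ^ (2 * m)) * (z\<^sup>2) ^ m"
        by (simp only: power_mult_distrib power_mult[of z] of_real_mult of_real_power)
      then show ?thesis unfolding f_def by (simp add: mult_ac)
    qed
    have "(LINT x|\<mu>. f m x) = ((-1) ^ m * of_real (bessel_coeff \<beta> m * real n ^ (2 * m)) * (z\<^sup>2) ^ m) * (LINT x|\<mu>. G x * of_real (rad x ^ (2 * m)))"
      by (simp only: fx integral_mult_right_zero)
    then show ?thesis by (simp only: hcoeff_def mult_ac)
  qed
  ultimately show "(\<lambda>m. hcoeff \<beta> G m * (z\<^sup>2) ^ m) sums htrans \<beta> G z"
    unfolding suminf htrans_def by simp
  show "integrable \<mu> (\<lambda>x. G x * bessel_jc \<beta> (of_real (real n * rad x) * z))"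
    unfolding suminf[symmetric] using fi sn sm by (intro integrable_suminf) auto
  obtain C where C: "C \<ge> 0" "\<And>t. t \<ge> 0 \<Longrightarrow> t ^ (2 * m) \<le> C * exp (real n * t)"
  proof (rule that[of "fact (2 * m)"])
    fix t :: real assume t: "t \<ge> 0"
    have "t ^ (2 * m) /\<^sub>R fact (2 * m) \<le> (\<Sum>i<Suc m. t ^ (2 * i) /\<^sub>R fact (2 * i))"
      by (rule member_le_sum) (use t in auto)
    also have "\<dots> \<le> cosh t"
      using even_power_series_cosh[of t] t by (subst sums_unique[OF even_power_series_cosh]) (auto intro!: sum_le_suminf sums_summable simp del: sum.lessThan_Suc)
    also have "cosh t \<le> exp t" using t by (simp add: cosh_def)
    also have "\<dots> \<le> exp (real n * t)" using t n1 by (simp add: mult_le_cancel_right1)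
    finally show "t ^ (2 * m) \<le> fact (2 * m) * exp (real n * t)" by (simp add: field_simps)
  qed auto
  have "integrable \<mu> (\<lambda>x. C * (norm (G x) * exp (real n * rad x * 1)))"
    using int[of 1] by (intro integrable_mult_right) auto
  then show "integrable \<mu> (\<lambda>x. G x * of_real (rad x ^ (2 * m)))"
  proof (rule Bochner_Integration.integrable_bound)
    show "AE x in \<mu>. norm (G x * of_real (rad x ^ (2 * m))) \<le> norm (C * (norm (G x) * exp (real n * rad x * 1)))"
    proof (rule AE_I2)
      fix x
      have "norm (G x) * rad x ^ (2 * m) \<le> norm (G x) * (C * exp (real n * rad x))"
        using C(2)[of "rad x"] by (intro mult_left_mono) auto
      then show "norm (G x * of_real (rad x ^ (2 * m))) \<le> norm (C * (norm (G x) * exp (real n * rad x * 1)))"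
        using C(1) by (simp add: norm_mult norm_power mult_ac)
    qed
  qed measurable
qed

lemma norm_htrans_le:
  assumes G: "exp_integrable G" and \<beta>: "\<beta> \<ge> -1/2"
  shows "norm (htrans \<beta> G z) \<le> (LINT x|\<mu>. norm (G x) * exp (real n * rad x * \<bar>Im z\<bar>))"
proof -
  have "norm (htrans \<beta> G z) \<le> (LINT x|\<mu>. norm (G x * bessel_jc \<beta> (of_real (real n * rad x) * z)))"
    unfolding htrans_def by (rule integral_norm_bound)
  also have "\<dots> \<le> (LINT x|\<mu>. norm (G x) * exp (real n * rad x * \<bar>Im z\<bar>))"
  proof (rule integral_mono)
    show "integrable \<mu> (\<lambda>x. norm (G x * bessel_jc \<beta> (of_real (real n * rad x) * z)))"
      using htrans_power_series(2)[OF G \<beta>] by (rule integrable_norm)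
    show "integrable \<mu> (\<lambda>x. norm (G x) * exp (real n * rad x * \<bar>Im z\<bar>))"
      using G by (auto simp: exp_integrable_def)
    fix x
    have "norm (bessel_jc \<beta> (of_real (real n * rad x) * z)) \<le> exp \<bar>Im (of_real (real n * rad x) * z)\<bar>"
      by (rule norm_bessel_jc_le[OF \<beta>])
    also have "Im (of_real (real n * rad x) * z) = real n * rad x * Im z" by simp
    finally show "norm (G x * bessel_jc \<beta> (of_real (real n * rad x) * z)) \<le> norm (G x) * exp (real n * rad x * \<bar>Im z\<bar>)"
      unfolding norm_mult by (intro mult_left_mono) (auto simp: abs_mult)
  qed
  finally show ?thesis .
qed

text \<open>The series runs over powers of \<open>z^2\<close>, so it is first read as an entire
  function of \<open>w = z^2\<close>. The discontinuity of \<open>csqrt\<close> does no harm,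
  because only its square enters the series.\<close>

lemma htrans_holomorphic:
  assumes G: "exp_integrable G" and \<beta>: "\<beta> \<ge> -1/2"
  shows "htrans \<beta> G holomorphic_on UNIV"
proof -
  define f where "f = (\<lambda>w. htrans \<beta> G (csqrt w))"
  have "f holomorphic_on ball 0 r" for r
    using htrans_power_series(1)[OF G \<beta>, of "csqrt w" for w]
    by (intro power_series_holomorphic[of 0 r "hcoeff \<beta> G"]) (auto simp: f_def)
  then have "f holomorphic_on UNIV"
    by (metis (no_types, opaque_lifting) UNIV_I dist_0_norm holomorphic_on_def holomorphic_on_imp_differentiable_at field_differentiable_at_within mem_ball open_ball gt_ex)
  then have "(f \<circ> (\<lambda>z. z\<^sup>2)) holomorphic_on UNIV"
    by (intro holomorphic_on_compose_gen[where t = UNIV] holomorphic_intros) auto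
  moreover have "f \<circ> (\<lambda>z. z\<^sup>2) = htrans \<beta> G"
  proof
    fix z
    have "(\<lambda>m. hcoeff \<beta> G m * (z\<^sup>2) ^ m) sums f (z\<^sup>2)"
      using htrans_power_series(1)[OF G \<beta>, of "csqrt (z\<^sup>2)"] by (simp add: f_def del: csqrt_square)
    then show "(f \<circ> (\<lambda>z. z\<^sup>2)) z = htrans \<beta> G z"
      using htrans_power_series(1)[OF G \<beta>, of z] by (auto dest: sums_unique2)
  qed
  ultimately show ?thesis by simp
qed

lemma htrans_even:
  assumes G: "exp_integrable G" and \<beta>: "\<beta> \<ge> -1/2"
  shows "htrans \<beta> G (- z) = htrans \<beta> G z"
  using htrans_power_series(1)[OF G \<beta>, of z] htrans_power_series(1)[OF G \<beta>, of "- z"]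
  by (auto dest: sums_unique2)

lemma htrans_zero_imp_moments_zero:
  assumes G: "exp_integrable G" and \<beta>: "\<beta> \<ge> -1/2" and z: "\<And>z. htrans \<beta> G z = 0"
  shows "(LINT x|\<mu>. G x * of_real (rad x ^ (2 * m))) = 0"
proof -
  have s: "(\<lambda>m. hcoeff \<beta> G m * w ^ m) sums 0" for w
    using htrans_power_series(1)[OF G \<beta>, of "csqrt w"] z by simp
  have "hcoeff \<beta> G m = 0"
  proof (cases "m = 0")
    case True
    have "hcoeff \<beta> G 0 = 0"
      using s[of 0] powser_sums_zero[of "hcoeff \<beta> G"] sums_unique2 by blast
    then show ?thesis by (simp add: True)
  next
    case False
    show ?thesis
    proof (rule ccontr)
      assume "hcoeff \<beta> G m \<noteq> 0"
      then show False
      proof (rule powser_0_nonzero[of 1 0 "hcoeff \<beta> G" "\<lambda>_. 0" m, rotated 3])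
        fix r :: real assume "0 < r" "\<And>z. z \<in> cball 0 r - {0} \<Longrightarrow> (\<lambda>_::complex. 0::complex) z \<noteq> 0"
        from this(2)[of "of_real r"] \<open>0 < r\<close> show False by simp
      qed (use s False in auto)
    qed
  qed
  then show ?thesis using bessel_coeff_pos[OF \<beta>, of m] n1 by (simp add: hcoeff_def)
qed

text \<open>The moments carry no trace of the order of the transform they came from, so they can be
  reused at order -1/2, where the kernel is the cosine: all cosine integrals vanish. The sine
  integrals vanish by parity, and Fourier uniqueness applies to the real and the imaginary
  part.\<close>

lemma even_moments_zero_imp_zero:
  assumes G: "exp_integrable G" and even: "\<And>x. G (- x) = G x"
    and mom: "\<And>m. (LINT x|\<mu>. G x * of_real (rad x ^ (2 * m))) = 0"
  shows "AE x in \<mu>. G x = 0"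
proof -
  have [measurable]: "G \<in> borel_measurable borel" using G by (auto simp: exp_integrable_def)
  have Gi: "integrable \<mu> G" using htrans_power_series(3)[OF G order_refl, of 0] by simp
  \<comment> \<open>\<open>T\<close> is injective, so it suffices that the image of \<open>G \<mu>\<close> under \<open>T\<close> has zero Fourier transform.\<close>
  define T where "T = (\<lambda>x. sgn x * rad x)"
  define S where "S = (\<lambda>y::real. sgn y * \<bar>y\<bar> ^ n)"
  have [measurable]: "T \<in> borel_measurable borel" "S \<in> borel_measurable borel"
    unfolding T_def S_def by measurable
  have ST: "S (T x) = x" for x
  proof -
    have "sgn (T x) = sgn x" using n1 by (auto simp: T_def rad_def sgn_if)
    moreover have "\<bar>T x\<bar> = rad x" by (auto simp: T_def sgn_if)
    ultimately show ?thesis by (simp add: S_def rad_power_n sgn_mult_abs)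
  qed
  have cos: "(LINT x|\<mu>. G x * of_real (cos (s * T x))) = 0" for s
  proof -
    have "hcoeff (-1/2) G m = 0" for m by (simp only: hcoeff_def mom mult_zero_right)
    then have "(\<lambda>m. 0) sums htrans (-1/2) G (of_real (s / real n))"
      using htrans_power_series(1)[OF G order_refl, of "of_real (s / real n)"] by simp
    then have "htrans (-1/2) G (of_real (s / real n)) = 0"
      using sums_unique2 sums_zero by blast
    moreover have "bessel_jc (-1/2) (of_real (real n * rad x) * of_real (s / real n)) = of_real (cos (s * T x))" for x
    proof -
      have "complex_of_real (real n * rad x) * of_real (s / real n) = of_real (s * rad x)" using n1 by (simp add: mult_ac)
      moreover have "cos (s * T x) = cos (s * rad x)" by (auto simp: T_def sgn_if)
      ultimately show ?thesis unfolding bessel_jc_minus_half by (simp only: cos_of_real)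
    qed
    ultimately show ?thesis by (simp only: htrans_def)
  qed
  have sin: "(LINT x|\<mu>. G x * of_real (sin (s * T x))) = 0" for s
  proof -
    have "T (- x) = - T x" for x by (simp add: T_def)
    then have "(LINT x|\<mu>. G x * of_real (sin (s * T x))) = - (LINT x|\<mu>. G x * of_real (sin (s * T x)))"
      using integral_mu_reflect(1)[of "\<lambda>x. G x * of_real (sin (s * T x))"] by (simp add: even)
    then show ?thesis by simp
  qed
  have int: "integrable \<mu> (\<lambda>x. G x * of_real (\<phi> x))" if "\<And>x. \<bar>\<phi> x\<bar> \<le> 1" and [measurable]: "\<phi> \<in> borel_measurable borel" for \<phi> :: "real \<Rightarrow> real"
    by (rule Bochner_Integration.integrable_bound[OF Gi])
       (use that(1) in \<open>auto simp: norm_mult intro!: mult_left_le\<close>)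
  have ie: "(CLINT x|\<mu>. of_real (g x) * iexp (s * T x)) = 0"
    if g: "integrable \<mu> g" and gc: "(LINT x|\<mu>. g x * cos (s * T x)) = 0" and gs: "(LINT x|\<mu>. g x * sin (s * T x)) = 0" for g :: "real \<Rightarrow> real" and s
  proof -
    have [measurable]: "g \<in> borel_measurable borel" using g by auto
    have i: "integrable \<mu> (\<lambda>x. g x * \<phi> x)" if "\<And>x. \<bar>\<phi> x\<bar> \<le> 1" and [measurable]: "\<phi> \<in> borel_measurable borel" for \<phi> :: "real \<Rightarrow> real"
      by (rule Bochner_Integration.integrable_bound[OF g])
         (use that(1) in \<open>auto simp: abs_mult intro!: mult_left_le\<close>)
    have i1: "integrable \<mu> (\<lambda>x. g x * cos (s * T x))" and i2: "integrable \<mu> (\<lambda>x. g x * sin (s * T x))"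
      by (intro i; simp)+
    have "of_real (g x) * iexp (s * T x) = of_real (g x * cos (s * T x)) + \<i> * of_real (g x * sin (s * T x))" for x
      unfolding cis_conv_exp[symmetric] by (simp add: complex_eq_iff)
    then have "(CLINT x|\<mu>. of_real (g x) * iexp (s * T x))
       = of_real (LINT x|\<mu>. g x * cos (s * T x)) + \<i> * of_real (LINT x|\<mu>. g x * sin (s * T x))"
      using i1 i2 by (simp del: of_real_mult)
    then show ?thesis using gc gs by simp
  qed
  have ReI: "(LINT x|\<mu>. Re (G x) * \<phi> x) = 0" and ImI: "(LINT x|\<mu>. Im (G x) * \<phi> x) = 0"
    if z: "(LINT x|\<mu>. G x * of_real (\<phi> x)) = 0" "\<And>x. \<bar>\<phi> x\<bar> \<le> 1" "\<phi> \<in> borel_measurable borel" for \<phi> :: "real \<Rightarrow> real"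
    using integral_Re[OF int[OF z(2,3)]] integral_Im[OF int[OF z(2,3)]] z(1) by auto
  have cs: "(\<lambda>x. cos (s * T x)) \<in> borel_measurable borel" "(\<lambda>x. sin (s * T x)) \<in> borel_measurable borel" for s
    by measurable
  have "AE x in \<mu>. Re (G x) = 0"
  proof (rule fourier_uniqueness_density[where T = T and S = S])
    show "(CLINT x|\<mu>. of_real (Re (G x)) * iexp (s * T x)) = 0" for s
      by (rule ie) (use Gi in \<open>auto intro!: ReI cos sin cs\<close>)
  qed (use Gi ST in auto)
  moreover have "AE x in \<mu>. Im (G x) = 0"
  proof (rule fourier_uniqueness_density[where T = T and S = S])
    show "(CLINT x|\<mu>. of_real (Im (G x)) * iexp (s * T x)) = 0" for s
      by (rule ie) (use Gi in \<open>auto intro!: ImI cos sin cs\<close>)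
  qed (use Gi ST in auto)
  ultimately show ?thesis by eventually_elim (simp add: complex_eq_iff)
qed

text \<open>In \<open>t = rad x\<close> the measure is a multiple of
  \<open>t powr (2 * \<alpha> + 1)\<close> times Lebesgue measure, which dominates a multiple of
  Lebesgue measure for \<open>t > 1\<close>. On \<open>{0..1}\<close> continuity suffices.\<close>

lemma integrable_rad_substitution:
  fixes \<phi> :: "real \<Rightarrow> real"
  assumes cont: "continuous_on UNIV \<phi>" and nonneg: "\<And>t. \<phi> t \<ge> 0"
    and fin: "(\<integral>\<^sup>+x. ennreal (\<phi> (rad x)) \<partial>\<mu>) < \<infinity>"
  shows "integrable lborel (\<lambda>t. indicator {0..} t * \<phi> t)"
proof -
  have np: "real n > 0" using n1 by simp
  have [measurable]: "\<phi> \<in> borel_measurable borel" using cont by (rule borel_measurable_continuous_onI)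
  define \<psi> where "\<psi> = (\<lambda>x. dens x * \<phi> (rad x))"
  have [measurable]: "\<psi> \<in> borel_measurable borel" unfolding \<psi>_def by measurable
  have "integrable \<mu> (\<lambda>x. \<phi> (rad x))"
    using fin nonneg by (intro integrableI_bounded) auto
  then have "integrable lborel \<psi>"
    unfolding mu_eq \<psi>_def by (subst (asm) integrable_density) (auto simp: dens_nonneg)
  then have "\<psi> absolutely_integrable_on UNIV"
    using integrable_completion[of \<psi> lborel] by (simp add: set_integrable_def)
  then have \<psi>1: "\<psi> absolutely_integrable_on {1<..}"
    by (rule set_integrable_subset) auto
  define g where "g = (\<lambda>t::real. t ^ n)"
  define g' where "g' = (\<lambda>t::real. real n * t ^ (n - 1))"
  have img: "g ` {1<..} = {1<..}"
  proof (intro equalityI subsetI)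
    fix y :: real assume y: "y \<in> {1<..}"
    have "g (rad y) = y" using y by (simp add: g_def rad_power_n)
    moreover have "rad y > 1"
      using y np by (simp add: rad_def gr_one_powr)
    ultimately show "y \<in> g ` {1<..}" by (metis greaterThan_iff image_eqI)
  qed (use n1 in \<open>auto simp: g_def one_less_power\<close>)
  have "(\<lambda>t. \<bar>g' t\<bar> * \<psi> (g t)) absolutely_integrable_on {1<..} \<and>
     integral {1<..} (\<lambda>t. \<bar>g' t\<bar> * \<psi> (g t)) = integral {1<..} \<psi>"
  proof (rule has_absolute_integral_change_of_variables_1'[where f = \<psi> and g = g and g' = g' and S = "{1<..}" and b = "integral {1<..} \<psi>", THEN iffD2])
    show "\<psi> absolutely_integrable_on g ` {1<..} \<and> integral (g ` {1<..}) \<psi> = integral {1<..} \<psi>"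
      unfolding img using \<psi>1 by simp
    show "inj_on g {1<..}"
      by (rule inj_on_inverseI[where g = rad]) (auto simp: g_def rad_of_power)
    show "(g has_field_derivative g' x) (at x within {1<..})" for x
      unfolding g_def g'_def by (auto intro!: derivative_eq_intros)
    show "{1::real<..} \<in> sets lebesgue" by simp
  qed
  then have "integrable lebesgue (\<lambda>t. indicator {1<..} t * (\<bar>g' t\<bar> * \<psi> (g t)))"
    by (simp add: set_integrable_def)
  moreover have "(\<lambda>t. indicator {1<..} t * (\<bar>g' t\<bar> * \<psi> (g t))) \<in> borel_measurable lborel"
    unfolding g_def g'_def by measurable
  ultimately have i1: "integrable lborel (\<lambda>t. indicator {1<..} t * (\<bar>g' t\<bar> * \<psi> (g t)))"
    using integrable_completion by blast
  define cst where "cst = real n * (1 / (2 * Gamma (\<alpha> + 1)) * (real n / 2) powr \<alpha>)"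
  have cst: "cst > 0" using np Gamma_alpha_pos by (simp add: cst_def)
  \<comment> \<open>Jacobian and density combine to the exponent
    \<open>(n - 1) + n (2 k + 2 / n - 2) = 2 \<alpha> + 1\<close>, which is nonnegative.\<close>
  have ge: "cst * \<phi> t \<le> \<bar>g' t\<bar> * \<psi> (g t)" if t: "t > 1" for t
  proof -
    define r where "r = 2 * k + 2 / real n - 2"
    have "t ^ (n - 1) * (t ^ n) powr r = t powr (real n - 1) * t powr (real n * r)"
      using t n1 by (simp add: powr_powr of_nat_diff flip: powr_realpow)
    also have "\<dots> = t powr (2 * \<alpha> + 1)"
      unfolding powr_add[symmetric] using np by (intro arg_cong[where f = "(powr) t"]) (simp add: r_def alpha_kn_def field_simps)
    also have "\<dots> \<ge> t powr 0" using t alpha_ge by (intro powr_mono) auto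
    finally have *: "t ^ (n - 1) * (t ^ n) powr r \<ge> 1" using t by simp
    have "\<bar>g' t\<bar> * \<psi> (g t) = cst * (t ^ (n - 1) * (t ^ n) powr r) * \<phi> t"
      using t by (simp add: g'_def g_def \<psi>_def dens_def cst_def r_def rad_of_power)
    also have "\<dots> \<ge> cst * 1 * \<phi> t"
      using * cst nonneg[of t] by (intro mult_right_mono mult_left_mono) auto
    finally show ?thesis by simp
  qed
  have i2: "integrable lborel (\<lambda>t. indicator {1<..} t * \<phi> t)"
  proof (rule Bochner_Integration.integrable_bound)
    show "integrable lborel (\<lambda>t. 1 / cst * (indicator {1<..} t * (\<bar>g' t\<bar> * \<psi> (g t))))"
      using i1 by (intro integrable_mult_right) auto
    show "AE t in lborel. norm (indicator {1<..} t * \<phi> t) \<le> norm (1 / cst * (indicator {1<..} t * (\<bar>g' t\<bar> * \<psi> (g t))))"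
    proof (rule AE_I2)
      fix t :: real
      show "norm (indicator {1<..} t * \<phi> t) \<le> norm (1 / cst * (indicator {1<..} t * (\<bar>g' t\<bar> * \<psi> (g t))))"
      proof (cases "t > 1")
        case True
        have "\<phi> t \<le> (\<bar>g' t\<bar> * \<psi> (g t)) / cst" using ge[OF True] cst by (simp add: field_simps)
        also have "\<dots> \<le> \<bar>(\<bar>g' t\<bar> * \<psi> (g t)) / cst\<bar>" by (rule abs_ge_self)
        finally show ?thesis using True nonneg[of t] by simp
      qed simp
    qed
  qed measurable
  have i3: "integrable lborel (\<lambda>t. indicator {0..1} t * \<phi> t)"
    using borel_integrable_atLeastAtMost'[OF continuous_on_subset[OF cont], of 0 1] by (simp add: set_integrable_def)
  have "indicator {0..} t * \<phi> t = indicator {0..1} t * \<phi> t + indicator {1<..} t * \<phi> t" for t :: real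
    by (auto simp: indicator_def)
  then show ?thesis using i2 i3 by simp
qed

section \<open>From growth and integrability to a Gaussian\<close>

text \<open>\<open>b = 1 / (4 * a)\<close> is the value at which \<open>exp (- n b (Im z)^2)\<close>
  exactly cancels the growth of \<open>u\<close>. Symmetry is asked of the modulus only, since
  \<open>u\<close> will also be \<open>z ^ n\<close> times an even function, whose parity is that of
  \<open>n\<close>.\<close>

lemma hardy_rigidity:
  fixes u :: "complex \<Rightarrow> complex"
  assumes u: "u holomorphic_on UNIV" and sym: "\<And>z. norm (u (- z)) = norm (u z)"
    and a: "a > 0" and b: "b = 1 / (4 * a)"
    and growth: "\<And>z. norm (u z) \<le> A * (1 + norm z) ^ M * exp (real n * (Im z)\<^sup>2 / (4 * a))"
    and fin: "(\<integral>\<^sup>+x. ennreal (log_plus (exp (real n * b * (rad x)\<^sup>2) * norm (u (of_real (rad x))))) \<partial>\<mu>) < \<infinity>"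
  shows "u z = u 0 * exp (- (of_real (real n * b) * z\<^sup>2))" and "norm (u 0) \<le> 1"
proof -
  define h where "h = (\<lambda>z. exp (of_real (real n * b) * z\<^sup>2) * u z)"
  have nh: "norm (h z) = exp (real n * b * ((Re z)\<^sup>2 - (Im z)\<^sup>2)) * norm (u z)" for z
    by (simp add: h_def norm_mult power2_eq_square)
  have h: "h holomorphic_on UNIV" unfolding h_def by (intro holomorphic_intros u)
  have hsym: "norm (h (- z)) = norm (h z)" for z by (simp add: nh sym)
  have hgrowth: "norm (h z) \<le> A * (1 + norm z) ^ M * exp (real n * b * (Re z)\<^sup>2)" for z
  proof -
    have "norm (h z) \<le> exp (real n * b * ((Re z)\<^sup>2 - (Im z)\<^sup>2)) * (A * (1 + norm z) ^ M * exp (real n * (Im z)\<^sup>2 / (4 * a)))"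
      unfolding nh by (intro mult_left_mono growth) auto
    also have "\<dots> = A * (1 + norm z) ^ M * (exp (real n * b * ((Re z)\<^sup>2 - (Im z)\<^sup>2)) * exp (real n * (Im z)\<^sup>2 / (4 * a)))"
      by (simp only: mult_ac)
    also have "exp (real n * b * ((Re z)\<^sup>2 - (Im z)\<^sup>2)) * exp (real n * (Im z)\<^sup>2 / (4 * a)) = exp (real n * b * (Re z)\<^sup>2)"
      by (simp add: b algebra_simps flip: exp_add)
    finally show ?thesis .
  qed
  define \<phi> where "\<phi> = (\<lambda>t. log_plus (norm (h (of_real t))))"
  have contu: "continuous_on UNIV h" using h holomorphic_on_imp_continuous_on by blast
  have cont: "continuous_on UNIV \<phi>"
    unfolding \<phi>_def log_plus_eq_ln_max
    by (intro continuous_intros continuous_on_compose2[OF contu]) (auto simp: max_def)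
  have "integrable lborel (\<lambda>t. indicator {0..} t * \<phi> t)"
    by (rule integrable_rad_substitution[OF cont]) (use fin in \<open>auto simp: \<phi>_def nh\<close>)
  note int = this[unfolded \<phi>_def]
  have B: "real n * b \<ge> 0" using a by (simp add: b)
  have "h z = h 0" for z by (rule miyachi_lemma(1)[OF h hsym hgrowth B int])
  then have "exp (of_real (real n * b) * z\<^sup>2) * u z = u 0" by (simp add: h_def)
  then show "u z = u 0 * exp (- (of_real (real n * b) * z\<^sup>2))"
    by (simp add: exp_minus field_simps)
  have "norm (h 0) \<le> 1" by (rule miyachi_lemma(2)[OF h hsym hgrowth B int])
  then show "norm (u 0) \<le> 1" by (simp add: h_def)
qed

text \<open>The factor \<open>rad x ^ N\<close> accommodates \<open>x * f x\<close>, where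
  \<open>|x| = rad x ^ n\<close>. The constants do not depend on the order, because the Bessel bound
  does not.\<close>

lemma htrans_growth:
  fixes G :: "real \<Rightarrow> complex" and H :: "real \<Rightarrow> real"
  assumes G: "G \<in> borel_measurable borel"
    and a: "a > 0" and D: "D \<ge> 0" and H: "integrable \<mu> H" "\<And>x. H x \<ge> 0"
    and bd: "AE x in \<mu>. norm (G x) \<le> rad x ^ N * exp (- (real n * a * (rad x)\<^sup>2)) * (D + H x)"
  obtains A M where "exp_integrable G" "A \<ge> 0"
    "\<And>\<beta> z. \<beta> \<ge> -1/2 \<Longrightarrow> norm (htrans \<beta> G z) \<le> A * (1 + norm z) ^ M * exp (real n * (Im z)\<^sup>2 / (4 * a))"
proof -
  obtain A M where AM:
    "\<And>y. y \<ge> 0 \<Longrightarrow> integrable \<mu> (\<lambda>x. norm (G x) * exp (real n * rad x * y))"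
    "\<And>y. y \<ge> 0 \<Longrightarrow> (LINT x|\<mu>. norm (G x) * exp (real n * rad x * y)) \<le> A * (1 + y) ^ M * exp (real n * y\<^sup>2 / (4 * a))"
    by (rule gaussian_bound_growth[OF G a D H bd]) blast
  have ei: "exp_integrable G" using G AM(1) by (auto simp: exp_integrable_def)
  show thesis
  proof (rule that[OF ei, of "\<bar>A\<bar>" M])
    fix \<beta> z assume \<beta>: "\<beta> \<ge> (-1/2 :: real)"
    have "norm (htrans \<beta> G z) \<le> A * (1 + \<bar>Im z\<bar>) ^ M * exp (real n * \<bar>Im z\<bar>\<^sup>2 / (4 * a))"
      using norm_htrans_le[OF ei \<beta>] AM(2)[of "\<bar>Im z\<bar>"] by (rule order_trans) auto
    also have "\<dots> \<le> \<bar>A\<bar> * (1 + norm z) ^ M * exp (real n * \<bar>Im z\<bar>\<^sup>2 / (4 * a))"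
      using abs_Im_le_cmod[of z] by (intro mult_right_mono mult_mono power_mono) auto
    finally show "norm (htrans \<beta> G z) \<le> \<bar>A\<bar> * (1 + norm z) ^ M * exp (real n * (Im z)\<^sup>2 / (4 * a))" by simp
  qed auto
qed

lemma exp_integrable_measurable: "exp_integrable G \<Longrightarrow> G \<in> borel_measurable borel"
  by (simp add: exp_integrable_def)

lemma exp_integrable_add:
  assumes F: "exp_integrable F" and G: "exp_integrable G"
  shows "exp_integrable (\<lambda>x. F x + G x)"
  unfolding exp_integrable_def
proof (intro conjI allI impI)
  have [measurable]: "F \<in> borel_measurable borel" "G \<in> borel_measurable borel"
    using F G by (auto simp: exp_integrable_def)
  show "(\<lambda>x. F x + G x) \<in> borel_measurable borel" by measurable
  fix y :: real assume "y \<ge> 0"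
  then have "integrable \<mu> (\<lambda>x. norm (F x) * exp (real n * rad x * y) + norm (G x) * exp (real n * rad x * y))"
    using F G by (auto simp: exp_integrable_def)
  then show "integrable \<mu> (\<lambda>x. norm (F x + G x) * exp (real n * rad x * y))"
  proof (rule Bochner_Integration.integrable_bound)
    show "AE x in \<mu>. norm (norm (F x + G x) * exp (real n * rad x * y))
        \<le> norm (norm (F x) * exp (real n * rad x * y) + norm (G x) * exp (real n * rad x * y))"
      by (intro AE_I2) (simp add: norm_triangle_ineq flip: distrib_right)
  qed measurable
qed

lemma exp_integrable_cmult:
  assumes "exp_integrable G"
  shows "exp_integrable (\<lambda>x. c * G x)"
proof -
  have [measurable]: "G \<in> borel_measurable borel" using assms by (auto simp: exp_integrable_def)
  show ?thesis
    using assms by (auto simp: exp_integrable_def norm_mult mult.assoc)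
qed

lemma exp_integrable_reflect:
  assumes "exp_integrable G"
  shows "exp_integrable (\<lambda>x. G (- x))"
proof -
  have [measurable]: "G \<in> borel_measurable borel" using assms by (auto simp: exp_integrable_def)
  have "integrable \<mu> (\<lambda>x. norm (G (- x)) * exp (real n * rad x * y))" if "y \<ge> 0" for y
    using integral_mu_reflect(2)[of "\<lambda>x. norm (G x) * exp (real n * rad x * y)"] assms that
    by (simp add: exp_integrable_def)
  then show ?thesis by (simp add: exp_integrable_def)
qed

text \<open>\<open>G\<close> and its reflection have the same even moments in \<open>rad x\<close>,
  so these vanish for the even part too; about the odd part the transform says nothing.\<close>

lemma htrans_zero_imp_even_part_zero:
  assumes G: "exp_integrable G" and \<beta>: "\<beta> \<ge> -1/2" and z: "\<And>z. htrans \<beta> G z = 0"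
  shows "AE x in \<mu>. G x + G (- x) = 0"
proof (rule even_moments_zero_imp_zero)
  show ei: "exp_integrable (\<lambda>x. G x + G (- x))"
    by (intro exp_integrable_add exp_integrable_reflect G)
  show "G (- x) + G (- (- x)) = G x + G (- x)" for x by simp
  fix m
  have [measurable]: "G \<in> borel_measurable borel" using G by (rule exp_integrable_measurable)
  note m0 = htrans_zero_imp_moments_zero[OF G \<beta> z, of m]
  note i1 = htrans_power_series(3)[OF G \<beta>, of m]
  note i2 = htrans_power_series(3)[OF exp_integrable_reflect[OF G] \<beta>, of m]
  have "(LINT x|\<mu>. (G x + G (- x)) * of_real (rad x ^ (2 * m)))
     = (LINT x|\<mu>. G x * of_real (rad x ^ (2 * m))) + (LINT x|\<mu>. G (- x) * of_real (rad x ^ (2 * m)))"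
    unfolding distrib_right by (rule Bochner_Integration.integral_add[OF i1 i2])
  also have "(LINT x|\<mu>. G (- x) * of_real (rad x ^ (2 * m))) = (LINT x|\<mu>. G x * of_real (rad x ^ (2 * m)))"
    using integral_mu_reflect(1)[of "\<lambda>x. G x * of_real (rad x ^ (2 * m))"] by simp
  finally show "(LINT x|\<mu>. (G x + G (- x)) * of_real (rad x ^ (2 * m))) = 0" using m0 by simp
qed

section \<open>Gaussians and the two parts of the transform\<close>

definition gauss :: "real \<Rightarrow> real \<Rightarrow> complex" where
  "gauss c x = of_real (exp (- (real n * c * (rad x)\<^sup>2)))"

lemma gauss_measurable [measurable]: "gauss c \<in> borel_measurable borel"
  unfolding gauss_def by measurable

lemma gauss_minus [simp]: "gauss c (- x) = gauss c x"
  by (simp add: gauss_def)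

lemma exp_integrable_gauss:
  assumes c: "c > 0"
  shows "exp_integrable (gauss c)" "exp_integrable (\<lambda>x. of_real x * gauss c x)"
proof -
  show "exp_integrable (gauss c)"
    by (rule htrans_growth[of "gauss c" c 1 "\<lambda>_. 0" 0]) (use c in \<open>auto simp: gauss_def\<close>)
  show "exp_integrable (\<lambda>x. of_real x * gauss c x)"
    by (rule htrans_growth[of "\<lambda>x. of_real x * gauss c x" c 1 "\<lambda>_. 0" n])
       (use c in \<open>auto simp: gauss_def norm_mult rad_power_n\<close>)
qed

text \<open>The factor \<open>Gamma (\<alpha> + 1 + m)\<close> of the Gaussian moment cancels the
  one in the Bessel coefficient, and the exponential series remains.\<close>

lemma htrans_gauss:
  assumes c: "c > 0"
  shows "htrans \<alpha> (gauss c) z = of_real ((2 * c) powr (- (\<alpha> + 1))) * exp (- (of_real (real n / (4 * c)) * z\<^sup>2))"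
proof -
  have np: "real n > 0" using n1 by simp
  define P where "P = (2 * c) powr (- (\<alpha> + 1))"
  have "hcoeff \<alpha> (gauss c) m * (z\<^sup>2) ^ m = of_real P * ((- (of_real (real n / (4 * c)) * z\<^sup>2)) ^ m /\<^sub>R fact m)" for m
  proof -
    have "(LINT x|\<mu>. gauss c x * of_real (rad x ^ (2 * m))) = of_real (LINT x|\<mu>. exp (- (real n * c * (rad x)\<^sup>2)) * rad x ^ (2 * m))"
      unfolding gauss_def of_real_mult[symmetric] by (rule integral_complex_of_real)
    also have "(LINT x|\<mu>. exp (- (real n * c * (rad x)\<^sup>2)) * rad x ^ (2 * m)) = P * (Gamma (\<alpha> + 1 + real m) / Gamma (\<alpha> + 1) / (real n * c) ^ m)"
      unfolding P_def by (rule has_bochner_integral_integral_eq[OF gaussian_moment[OF c]])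
    finally have mom: "(LINT x|\<mu>. gauss c x * of_real (rad x ^ (2 * m))) = of_real (P * (Gamma (\<alpha> + 1 + real m) / Gamma (\<alpha> + 1) / (real n * c) ^ m))" .
    have G1: "Gamma (\<alpha> + 1) \<noteq> 0" using Gamma_alpha_pos by simp
    have G2: "Gamma (\<alpha> + 1 + real m) > 0" using alpha_ge by (intro Gamma_real_pos) linarith
    have "bessel_coeff \<alpha> m * real n ^ (2 * m) * (P * (Gamma (\<alpha> + 1 + real m) / Gamma (\<alpha> + 1) / (real n * c) ^ m))
      = P * ((real n / (4 * c)) ^ m / fact m)"
    proof -
      have "\<alpha> + real m + 1 = \<alpha> + 1 + real m" by simp
      then have "bessel_coeff \<alpha> m = Gamma (\<alpha> + 1) / (fact m * Gamma (\<alpha> + 1 + real m) * 4 ^ m)"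
        by (simp only: bessel_coeff_def)
      then show ?thesis using G1 G2 np c
        by (simp add: power_mult_distrib power_divide mult_2 power_add divide_simps) (simp add: mult_ac)
    qed
    from arg_cong[OF this, of complex_of_real]
    have *: "complex_of_real (bessel_coeff \<alpha> m * real n ^ (2 * m)) * of_real (P * (Gamma (\<alpha> + 1 + real m) / Gamma (\<alpha> + 1) / (real n * c) ^ m))
      = of_real P * (of_real (real n / (4 * c)) ^ m / fact m)"
      by (simp only: of_real_mult of_real_divide of_real_power of_real_fact)
    have "hcoeff \<alpha> (gauss c) m * (z\<^sup>2) ^ m = (-1) ^ m * (of_real P * (of_real (real n / (4 * c)) ^ m / fact m)) * (z\<^sup>2) ^ m"
      unfolding hcoeff_def mom *[symmetric] by (simp only: mult.assoc)
    also have "\<dots> = of_real P * ((- (of_real (real n / (4 * c)) * z\<^sup>2)) ^ m /\<^sub>R fact m)"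
      unfolding power_minus[of "of_real (real n / (4 * c)) * z\<^sup>2"] power_mult_distrib
      by (simp add: scaleR_conv_of_real field_simps)
    finally show ?thesis .
  qed
  then have "(\<lambda>m. of_real P * ((- (of_real (real n / (4 * c)) * z\<^sup>2)) ^ m /\<^sub>R fact m)) sums htrans \<alpha> (gauss c) z"
    using htrans_power_series(1)[OF exp_integrable_gauss(1)[OF c] alpha_ge, of z] by simp
  moreover have "(\<lambda>m. of_real P * ((- (of_real (real n / (4 * c)) * z\<^sup>2)) ^ m /\<^sub>R fact m)) sums (of_real P * exp (- (of_real (real n / (4 * c)) * z\<^sup>2)))"
    by (intro sums_mult exp_converges)
  ultimately show ?thesis unfolding P_def by (rule sums_unique2)
qed

lemma htrans_odd:
  assumes [measurable]: "G \<in> borel_measurable borel" and odd: "\<And>x. G (- x) = - G x"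
    and G: "exp_integrable G" and \<beta>: "\<beta> \<ge> -1/2"
  shows "htrans \<beta> G z = 0"
proof -
  have "(LINT x|\<mu>. G x * of_real (rad x ^ (2 * m))) = 0" for m
  proof -
    have "(LINT x|\<mu>. G x * of_real (rad x ^ (2 * m))) = - (LINT x|\<mu>. G x * of_real (rad x ^ (2 * m)))"
      using integral_mu_reflect(1)[of "\<lambda>x. G x * of_real (rad x ^ (2 * m))"] by (simp add: odd)
    then show ?thesis by simp
  qed
  then have "hcoeff \<beta> G m = 0" for m by (simp only: hcoeff_def mult_zero_right)
  then have "(\<lambda>m. 0) sums htrans \<beta> G z"
    using htrans_power_series(1)[OF G \<beta>, of z] by simp
  then show ?thesis using sums_unique2 sums_zero by blast
qed

definition odd_const :: real where
  "odd_const = (real n / 2) ^ n * Gamma (\<alpha> + 1) / Gamma (\<alpha> + real n + 1)"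

lemma odd_const_pos: "odd_const > 0"
proof -
  have "Gamma (\<alpha> + real n + 1) > 0" using alpha_ge by (intro Gamma_real_pos) linarith
  then show ?thesis using Gamma_alpha_pos n1 by (simp add: odd_const_def)
qed

lemma alpha_n_ge: "\<alpha> + real n \<ge> -1/2"
  using alpha_ge by linarith

text \<open>The second term of the kernel carries the extra factor \<open>y * x\<close>, and
  \<open>x\<close> is moved into the function. The two summands are then the even and the odd part
  of the transform in \<open>y\<close>, with no need to split \<open>f\<close>.\<close>

lemma F_kn_eq_htrans:
  assumes f: "exp_integrable f" and xf: "exp_integrable (\<lambda>x. of_real x * f x)"
  shows "F_kn k n f y = htrans \<alpha> f (of_real (rad y))
     + (- \<i>) ^ n * of_real (odd_const * y) * htrans (\<alpha> + real n) (\<lambda>x. of_real x * f x) (of_real (rad y))"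
proof -
  have arg: "complex_of_real (real n * \<bar>y * x\<bar> powr (1 / real n)) = of_real (real n * rad x) * of_real (rad y)" for x
    unfolding rad_mult by simp
  have "f x * B_kn k n x y = f x * bessel_jc \<alpha> (of_real (real n * rad x) * of_real (rad y))
     + ((- \<i>) ^ n * of_real (odd_const * y)) * ((of_real x * f x) * bessel_jc (\<alpha> + real n) (of_real (real n * rad x) * of_real (rad y)))" for x
    unfolding B_kn_def arg[symmetric] bessel_j_eq_bessel_jc[OF alpha_ge, symmetric] bessel_j_eq_bessel_jc[OF alpha_n_ge, symmetric]
    by (simp add: odd_const_def algebra_simps)
  then have "F_kn k n f y = (LINT x|\<mu>. f x * bessel_jc \<alpha> (of_real (real n * rad x) * of_real (rad y))
     + ((- \<i>) ^ n * of_real (odd_const * y)) * ((of_real x * f x) * bessel_jc (\<alpha> + real n) (of_real (real n * rad x) * of_real (rad y))))"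
    by (simp only: F_kn_def)
  also have "\<dots> = htrans \<alpha> f (of_real (rad y))
     + (LINT x|\<mu>. ((- \<i>) ^ n * of_real (odd_const * y)) * ((of_real x * f x) * bessel_jc (\<alpha> + real n) (of_real (real n * rad x) * of_real (rad y))))"
    unfolding htrans_def
    by (intro Bochner_Integration.integral_add integrable_mult_right htrans_power_series(2) f xf alpha_ge alpha_n_ge)
  finally show ?thesis unfolding htrans_def by (simp only: integral_mult_right_zero)
qed

lemma F_kn_gauss:
  assumes c: "c > 0"
  shows "F_kn k n (\<lambda>x. v * gauss c x) y
      = v * of_real ((2 * c) powr (- (\<alpha> + 1)) * exp (- (real n / (4 * c) * (rad y)\<^sup>2)))"
proof -
  have "F_kn k n (\<lambda>x. v * gauss c x) y = v * F_kn k n (gauss c) y"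
    unfolding F_kn_def mult.assoc by (rule integral_mult_right_zero)
  also have "F_kn k n (gauss c) y = htrans \<alpha> (gauss c) (of_real (rad y))"
    using F_kn_eq_htrans[OF exp_integrable_gauss[OF c], of y]
      htrans_odd[OF _ _ exp_integrable_gauss(2)[OF c] alpha_n_ge, of "of_real (rad y)"] by simp
  also have "\<dots> = of_real ((2 * c) powr (- (\<alpha> + 1)) * exp (- (real n / (4 * c) * (rad y)\<^sup>2)))"
    unfolding htrans_gauss[OF c] by (simp add: exp_of_real[symmetric])
  finally show ?thesis .
qed

section \<open>The uncertainty principle\<close>

lemma F_kn_measurable:
  assumes f: "exp_integrable f" and xf: "exp_integrable (\<lambda>x. of_real x * f x)"
  shows "F_kn k n f \<in> borel_measurable borel"
proof -
  have c: "continuous_on UNIV (htrans \<beta> G)" if "exp_integrable G" "\<beta> \<ge> -1/2" for \<beta> G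
    using htrans_holomorphic[OF that] by (rule holomorphic_on_imp_continuous_on)
  have [measurable]: "htrans \<alpha> f \<in> borel_measurable borel"
    "htrans (\<alpha> + real n) (\<lambda>x. of_real x * f x) \<in> borel_measurable borel"
    by (intro borel_measurable_continuous_onI c f xf alpha_ge alpha_n_ge)+
  have "(\<lambda>y. F_kn k n f y) \<in> borel_measurable borel"
    unfolding F_kn_eq_htrans[OF f xf] by measurable
  then show ?thesis by simp
qed

text \<open>This refers the supercritical case to the critical one by lowering \<open>b\<close> to
  \<open>1 / (4 * a)\<close>.\<close>

lemma GH_cond_antimono:
  assumes GH: "GH_cond n k a b C p q f" and b: "b' \<le> b" and C: "C > 0"
  shows "GH_cond n k a b' C p q f"
proof -
  have "(\<integral>\<^sup>+ x. ennreal (log_plus (norm (complex_of_real (exp (real n * b' * \<bar>x\<bar> powr (2 / real n))) * F_kn k n f x) / C)) \<partial>\<mu>)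
     \<le> (\<integral>\<^sup>+ x. ennreal (log_plus (norm (complex_of_real (exp (real n * b * \<bar>x\<bar> powr (2 / real n))) * F_kn k n f x) / C)) \<partial>\<mu>)"
  proof (intro nn_integral_mono ennreal_leI log_plus_mono divide_right_mono)
    fix x
    have "real n * b' * \<bar>x\<bar> powr (2 / real n) \<le> real n * b * \<bar>x\<bar> powr (2 / real n)"
      using b by (intro mult_right_mono mult_left_mono) auto
    then show "norm (complex_of_real (exp (real n * b' * \<bar>x\<bar> powr (2 / real n))) * F_kn k n f x)
       \<le> norm (complex_of_real (exp (real n * b * \<bar>x\<bar> powr (2 / real n))) * F_kn k n f x)"
      unfolding norm_mult by (intro mult_right_mono) auto
  qed (use C in auto)
  then show ?thesis using GH unfolding GH_cond_def by (auto intro: le_less_trans)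
qed

lemma GH_cond_exp_integrable:
  assumes GH: "GH_cond n k a b C p q f" and a: "a > 0" and p: "1 \<le> p" and q: "1 \<le> q"
  obtains A M where "exp_integrable f" "exp_integrable (\<lambda>x. of_real x * f x)" "A \<ge> 0"
    "\<And>\<beta> z. \<beta> \<ge> -1/2 \<Longrightarrow> norm (htrans \<beta> f z) \<le> A * (1 + norm z) ^ M * exp (real n * (Im z)\<^sup>2 / (4 * a))"
    "\<And>\<beta> z. \<beta> \<ge> -1/2 \<Longrightarrow> norm (htrans \<beta> (\<lambda>x. of_real x * f x) z) \<le> A * (1 + norm z) ^ M * exp (real n * (Im z)\<^sup>2 / (4 * a))"
proof -
  have f [measurable]: "f \<in> borel_measurable borel" using GH by (simp add: GH_cond_def)
  have "Lp_plus_Lq \<mu> p q (\<lambda>x. complex_of_real (exp (real n * a * \<bar>x\<bar> powr (2 / real n))) * f x)"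
    using GH by (simp add: GH_cond_def)
  from Lp_plus_Lq_bound[OF p q this] obtain D H where D: "D \<ge> 0" and H: "integrable \<mu> H" "\<And>x. H x \<ge> (0::real)"
    and bd: "AE x in \<mu>. norm (complex_of_real (exp (real n * a * \<bar>x\<bar> powr (2 / real n))) * f x) \<le> D + H x"
    by blast
  have bd0: "AE x in \<mu>. norm (f x) \<le> exp (- (real n * a * (rad x)\<^sup>2)) * (D + H x)"
    using bd by eventually_elim (simp add: norm_mult rad_square exp_minus field_simps)
  have bd1: "AE x in \<mu>. norm (f x) \<le> rad x ^ 0 * exp (- (real n * a * (rad x)\<^sup>2)) * (D + H x)"
    using bd0 by simp
  have bd2: "AE x in \<mu>. norm (of_real x * f x) \<le> rad x ^ n * exp (- (real n * a * (rad x)\<^sup>2)) * (D + H x)"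
    using bd0 by eventually_elim (simp add: norm_mult rad_power_n mult.assoc mult_left_mono)
  have xf: "(\<lambda>x. of_real x * f x) \<in> borel_measurable borel" by measurable
  obtain A1 M1 where 1: "exp_integrable f" "A1 \<ge> 0"
    "\<And>\<beta> z. \<beta> \<ge> -1/2 \<Longrightarrow> norm (htrans \<beta> f z) \<le> A1 * (1 + norm z) ^ M1 * exp (real n * (Im z)\<^sup>2 / (4 * a))"
    by (rule htrans_growth[OF f a D H bd1]) blast
  obtain A2 M2 where 2: "exp_integrable (\<lambda>x. of_real x * f x)" "A2 \<ge> 0"
    "\<And>\<beta> z. \<beta> \<ge> -1/2 \<Longrightarrow> norm (htrans \<beta> (\<lambda>x. of_real x * f x) z) \<le> A2 * (1 + norm z) ^ M2 * exp (real n * (Im z)\<^sup>2 / (4 * a))"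
    by (rule htrans_growth[OF xf a D H bd2]) blast
  have le: "A1 * (1 + norm z) ^ M1 * e \<le> (A1 + A2) * (1 + norm z) ^ (M1 + M2) * e"
    "A2 * (1 + norm z) ^ M2 * e \<le> (A1 + A2) * (1 + norm z) ^ (M1 + M2) * e" if "e \<ge> 0" for e and z :: complex
    using that 1(2) 2(2) by (intro mult_right_mono mult_mono power_increasing; simp)+
  show thesis
  proof (rule that[OF 1(1) 2(1), of "A1 + A2" "M1 + M2"])
    show "norm (htrans \<beta> f z) \<le> (A1 + A2) * (1 + norm z) ^ (M1 + M2) * exp (real n * (Im z)\<^sup>2 / (4 * a))"
      if "\<beta> \<ge> -1/2" for \<beta> z
      by (rule order_trans[OF 1(3)[OF that] le(1)]) simp
    show "norm (htrans \<beta> (\<lambda>x. of_real x * f x) z) \<le> (A1 + A2) * (1 + norm z) ^ (M1 + M2) * exp (real n * (Im z)\<^sup>2 / (4 * a))"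
      if "\<beta> \<ge> -1/2" for \<beta> z
      by (rule order_trans[OF 2(3)[OF that] le(2)]) simp
  qed (use 1 2 in auto)
qed

text \<open>The even and the odd part of the transform are bounded by the larger of its moduli at
  \<open>y\<close> and \<open>- y\<close>, so invariance of the measure under reflection passes the
  \<open>log_plus\<close> condition on to both. Division by \<open>C\<close> before applying
  rigidity is what yields \<open>norm c \<le> C\<close>.\<close>

lemma GH_cond_critical:
  assumes GH: "GH_cond n k a b C p q f" and a: "a > 0" and b: "b = 1 / (4 * a)" and C: "C > 0"
    and p: "1 \<le> p" and q: "1 \<le> q"
  obtains c where "norm c \<le> C" "AE x in lborel. f x = c * of_real ((2 * a) powr (\<alpha> + 1)) * gauss a x"
proof -
  obtain A M where ei: "exp_integrable f" "exp_integrable (\<lambda>x. of_real x * f x)" and A: "A \<ge> 0" and gr: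
    "\<And>\<beta> z. \<beta> \<ge> -1/2 \<Longrightarrow> norm (htrans \<beta> f z) \<le> A * (1 + norm z) ^ M * exp (real n * (Im z)\<^sup>2 / (4 * a))"
    "\<And>\<beta> z. \<beta> \<ge> -1/2 \<Longrightarrow> norm (htrans \<beta> (\<lambda>x. of_real x * f x) z) \<le> A * (1 + norm z) ^ M * exp (real n * (Im z)\<^sup>2 / (4 * a))"
    by (rule GH_cond_exp_integrable[OF GH a p q]) blast
  define E where "E = htrans \<alpha> f"
  define Od where "Od = htrans (\<alpha> + real n) (\<lambda>x. of_real x * f x)"
  have hE: "E holomorphic_on UNIV" unfolding E_def by (rule htrans_holomorphic[OF ei(1) alpha_ge])
  have hO: "Od holomorphic_on UNIV" unfolding Od_def by (rule htrans_holomorphic[OF ei(2) alpha_n_ge])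
  define Fo where "Fo = (\<lambda>y. (- \<i>) ^ n * of_real (odd_const * y) * Od (of_real (rad y)))"
  have F: "F_kn k n f y = E (of_real (rad y)) + Fo y" for y
    unfolding F_kn_eq_htrans[OF ei] by (simp add: E_def Od_def Fo_def)
  have Fo_minus: "Fo (- y) = - Fo y" for y by (simp add: Fo_def)
  define L where "L = (\<lambda>x. log_plus (exp (real n * b * (rad x)\<^sup>2) * norm (F_kn k n f x) / C))"
  have [measurable]: "L \<in> borel_measurable borel"
    unfolding L_def log_plus_def using F_kn_measurable[OF ei] by measurable
  have Lfin: "(\<integral>\<^sup>+x. ennreal (L x) \<partial>\<mu>) < \<infinity>"
    using GH unfolding GH_cond_def L_def by (simp add: norm_mult rad_square)
  have fin: "(\<integral>\<^sup>+x. ennreal (log_plus (exp (real n * b * (rad x)\<^sup>2) * norm (u (of_real (rad x))))) \<partial>\<mu>) < \<infinity>"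
    if u: "\<And>x. norm (u (of_real (rad x))) \<le> max (norm (F_kn k n f x)) (norm (F_kn k n f (- x))) / C" for u :: "complex \<Rightarrow> complex"
  proof -
    have "(\<integral>\<^sup>+x. ennreal (log_plus (exp (real n * b * (rad x)\<^sup>2) * norm (u (of_real (rad x))))) \<partial>\<mu>)
      \<le> (\<integral>\<^sup>+x. ennreal (L x) + ennreal (L (- x)) \<partial>\<mu>)"
    proof (rule nn_integral_mono)
      fix x
      define e where "e = exp (real n * b * (rad x)\<^sup>2)"
      have "e * norm (u (of_real (rad x))) \<le> e * (max (norm (F_kn k n f x)) (norm (F_kn k n f (- x))) / C)"
        by (intro mult_left_mono u) (simp add: e_def)
      then have "log_plus (e * norm (u (of_real (rad x)))) \<le> log_plus (e * (max (norm (F_kn k n f x)) (norm (F_kn k n f (- x))) / C))"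
        by (rule log_plus_mono)
      also have "\<dots> \<le> L x + L (- x)"
        by (auto simp: L_def e_def max_def)
      finally show "ennreal (log_plus (exp (real n * b * (rad x)\<^sup>2) * norm (u (of_real (rad x))))) \<le> ennreal (L x) + ennreal (L (- x))"
        by (simp add: e_def L_def flip: ennreal_plus)
    qed
    also have "\<dots> = (\<integral>\<^sup>+x. ennreal (L x) \<partial>\<mu>) + (\<integral>\<^sup>+x. ennreal (L (- x)) \<partial>\<mu>)"
      by (intro nn_integral_add) auto
    also have "\<dots> < \<infinity>"
      using Lfin nn_integral_mu_reflect[of "\<lambda>x. ennreal (L x)"] by simp
    finally show ?thesis .
  qed
  have max_half: "norm ((x + y) / 2) \<le> max (norm x) (norm y)" "norm ((x - y) / 2) \<le> max (norm x) (norm y)" for x y :: complex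
    using norm_triangle_ineq[of x y] norm_triangle_ineq4[of x y] by (auto simp: max_def norm_divide)
  define c where "c = E 0"
  have E1: "E z / of_real C = E 0 / of_real C * exp (- (of_real (real n * b) * z\<^sup>2))"
    and E2: "norm (E 0 / of_real C) \<le> 1" for z
  proof -
    have "(\<lambda>z. E z / of_real C) holomorphic_on UNIV" using C by (intro holomorphic_intros hE) auto
    moreover have "norm (E (- z) / of_real C) = norm (E z / of_real C)" for z
      unfolding E_def by (simp add: htrans_even[OF ei(1) alpha_ge])
    moreover have "norm (E z / of_real C) \<le> A / C * (1 + norm z) ^ M * exp (real n * (Im z)\<^sup>2 / (4 * a))" for z
      using divide_right_mono[OF gr(1)[OF alpha_ge, of z], of C] C by (simp add: E_def norm_divide)
    moreover have "norm (E (of_real (rad x)) / of_real C) \<le> max (norm (F_kn k n f x)) (norm (F_kn k n f (- x))) / C" for x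
    proof -
      have "E (of_real (rad x)) = (F_kn k n f x + F_kn k n f (- x)) / 2"
        unfolding F Fo_minus by simp
      then have "norm (E (of_real (rad x))) \<le> max (norm (F_kn k n f x)) (norm (F_kn k n f (- x)))"
        using max_half(1) by metis
      then show ?thesis using C by (simp add: norm_divide divide_right_mono)
    qed
    ultimately show "E z / of_real C = E 0 / of_real C * exp (- (of_real (real n * b) * z\<^sup>2))"
      and "norm (E 0 / of_real C) \<le> 1"
      using hardy_rigidity[OF _ _ a b, of "\<lambda>z. E z / of_real C" "A / C" M] fin[of "\<lambda>z. E z / of_real C"] by blast+
  qed
  have Ez: "E z = c * exp (- (of_real (real n * b) * z\<^sup>2))" for z
    using E1[of z] C by (simp add: c_def)
  have cC: "norm c \<le> C" using E2 C by (simp add: c_def norm_divide)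
  \<comment> \<open>The function treated is \<open>z ^ n * Od z\<close>: at \<open>z = rad y\<close>
    its modulus, with the constant, is that of the odd part over \<open>C\<close>, since
    \<open>rad y ^ n = |y|\<close>. Its zero at the origin excludes a nonzero Gaussian.\<close>
  have O1: "of_real (odd_const / C) * z ^ n * Od z = 0" for z
  proof -
    define u where "u = (\<lambda>z. of_real (odd_const / C) * z ^ n * Od z)"
    have kC: "odd_const / C > 0" using odd_const_pos C by simp
    have "u holomorphic_on UNIV" unfolding u_def by (intro holomorphic_intros hO)
    moreover have "norm (u (- z)) = norm (u z)" for z
      unfolding u_def Od_def by (simp only: htrans_even[OF ei(2) alpha_n_ge] norm_mult norm_power norm_minus_cancel)
    moreover have "norm (u z) \<le> (odd_const / C * A) * (1 + norm z) ^ (n + M) * exp (real n * (Im z)\<^sup>2 / (4 * a))" for z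
    proof -
      have "norm (u z) = odd_const / C * (norm z ^ n * norm (Od z))"
        using kC by (simp add: u_def norm_mult norm_power norm_divide abs_of_pos odd_const_pos C)
      also have "\<dots> \<le> odd_const / C * ((1 + norm z) ^ n * (A * (1 + norm z) ^ M * exp (real n * (Im z)\<^sup>2 / (4 * a))))"
        using kC gr(2)[OF alpha_n_ge, of z, folded Od_def]
        by (intro mult_left_mono mult_mono power_mono) auto
      finally show ?thesis by (simp add: power_add mult_ac)
    qed
    moreover have "norm (u (of_real (rad x))) \<le> max (norm (F_kn k n f x)) (norm (F_kn k n f (- x))) / C" for x
    proof -
      have "Fo x = (F_kn k n f x - F_kn k n f (- x)) / 2"
        unfolding F Fo_minus by simp
      moreover have "norm (u (of_real (rad x))) = norm (Fo x) / C"
        using odd_const_pos C by (simp add: u_def Fo_def norm_mult norm_power norm_divide rad_power_n flip: of_real_power)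
      moreover have "norm (Fo x) \<le> max (norm (F_kn k n f x)) (norm (F_kn k n f (- x)))"
        unfolding \<open>Fo x = _\<close> by (rule max_half(2))
      ultimately show ?thesis using C by (simp add: divide_right_mono)
    qed
    ultimately have "u z = u 0 * exp (- (of_real (real n * b) * z\<^sup>2))"
      using hardy_rigidity(1)[OF _ _ a b, of u "odd_const / C * A" "n + M"] fin[of u] by blast
    moreover have "u 0 = 0" using n1 by (simp add: u_def)
    ultimately show ?thesis by (simp only: u_def mult_zero_left)
  qed
  have Onz: "Od z = 0" if "z \<noteq> 0" for z
    using O1[of z] that odd_const_pos C by simp
  have Oz: "Od z = 0" for z
  proof (cases "z = 0")
    case True
    have "isCont Od 0"
      using holomorphic_on_imp_continuous_on[OF hO] by (simp add: continuous_on_eq_continuous_at)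
    then have "Od \<midarrow>0\<rightarrow> Od 0" by (simp add: isCont_def)
    moreover have "Od \<midarrow>0\<rightarrow> 0"
      by (rule tendsto_eventually) (auto simp: eventually_at_filter Onz)
    ultimately show ?thesis using True by (metis LIM_unique)
  qed (rule Onz)
  \<comment> \<open>The power of \<open>2 * a\<close> undoes the factor in the transform of
    \<open>gauss a\<close>, so that \<open>f1\<close> has zero transform of order
    \<open>\<alpha>\<close>.\<close>
  define c' where "c' = c * of_real ((2 * a) powr (\<alpha> + 1))"
  define f1 where "f1 = (\<lambda>x. f x + (- c') * gauss a x)"
  have ei1: "exp_integrable f1"
    unfolding f1_def by (intro exp_integrable_add exp_integrable_cmult ei(1) exp_integrable_gauss(1)[OF a])
  have "htrans \<alpha> f1 z = 0" for z
  proof -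
    have "htrans \<alpha> f1 z = (LINT x|\<mu>. f x * bessel_jc \<alpha> (of_real (real n * rad x) * z)
       + (- c') * (gauss a x * bessel_jc \<alpha> (of_real (real n * rad x) * z)))"
      unfolding htrans_def f1_def distrib_right mult.assoc ..
    also have "\<dots> = htrans \<alpha> f z + (LINT x|\<mu>. (- c') * (gauss a x * bessel_jc \<alpha> (of_real (real n * rad x) * z)))"
      unfolding htrans_def by (intro Bochner_Integration.integral_add integrable_mult_right htrans_power_series(2) ei(1) exp_integrable_gauss(1)[OF a] alpha_ge)
    also have "\<dots> = E z + (- c') * htrans \<alpha> (gauss a) z"
      unfolding htrans_def[of \<alpha> "gauss a"] integral_mult_right_zero E_def ..
    finally have split: "htrans \<alpha> f1 z = E z + (- c') * htrans \<alpha> (gauss a) z" .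
    have one: "complex_of_real ((2 * a) powr (\<alpha> + 1)) * of_real ((2 * a) powr (- (\<alpha> + 1))) = 1"
      unfolding of_real_mult[symmetric] powr_add[symmetric] using a by simp
    have nb: "real n / (4 * a) = real n * b" by (simp add: b)
    have "c' * htrans \<alpha> (gauss a) z = c * (complex_of_real ((2 * a) powr (\<alpha> + 1)) * of_real ((2 * a) powr (- (\<alpha> + 1))))
        * exp (- (of_real (real n * b) * z\<^sup>2))"
      unfolding c'_def htrans_gauss[OF a] nb by (simp only: mult.assoc)
    also have "\<dots> = E z" unfolding one Ez by simp
    finally show ?thesis using split by simp
  qed
  then have even: "AE x in \<mu>. f1 x + f1 (- x) = 0"
    by (rule htrans_zero_imp_even_part_zero[OF ei1 alpha_ge])
  \<comment> \<open>The even part of \<open>x * f x\<close> is \<open>x\<close> times the odd part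
    of \<open>f\<close>, so this says that \<open>f\<close> is even almost everywhere.\<close>
  have odd: "AE x in \<mu>. of_real x * f x + of_real (- x) * f (- x) = 0"
    by (rule htrans_zero_imp_even_part_zero[OF ei(2) alpha_n_ge]) (use Oz in \<open>simp add: Od_def\<close>)
  have "AE x in lborel. x \<noteq> (0::real)" by (rule AE_lborel_singleton)
  with even[unfolded AE_mu_iff] odd[unfolded AE_mu_iff]
  have "AE x in lborel. f x = c * of_real ((2 * a) powr (\<alpha> + 1)) * gauss a x"
  proof eventually_elim
    case (elim x)
    have "of_real x * (f x - f (- x)) = 0" using elim(2) by (simp add: algebra_simps)
    then have "f (- x) = f x" using elim(3) by simp
    then have "2 * (f x - c' * gauss a x) = 0" using elim(1) by (simp add: f1_def)
    then show ?case by (simp add: c'_def)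
  qed
  with cC show thesis by (rule that)
qed

text \<open>The critical case already makes \<open>f\<close> a Gaussian with explicit transform. For
  the original, larger \<open>b\<close> the weighted transform grows like
  \<open>exp (d * t^2)\<close> with \<open>d > 0\<close>, and its \<open>log_plus\<close> is not
  integrable unless the coefficient is 0.\<close>

lemma GH_cond_supercritical:
  assumes GH: "GH_cond n k a b C p q f" and a: "a > 0" and C: "C > 0" and p: "1 \<le> p" and q: "1 \<le> q"
    and ab: "a * b > 1 / 4"
  shows "AE x in lborel. f x = 0"
proof -
  define b' where "b' = 1 / (4 * a)"
  have bb: "b' < b" using a ab by (simp add: b'_def field_simps)
  have GH': "GH_cond n k a b' C p q f" using GH_cond_antimono[OF GH _ C] bb by simp
  obtain c where c: "AE x in lborel. f x = c * of_real ((2 * a) powr (\<alpha> + 1)) * gauss a x"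
    using GH_cond_critical[OF GH' a b'_def C p q] by metis
  define v where "v = c * of_real ((2 * a) powr (\<alpha> + 1))"
  define w where "w = norm v * (2 * a) powr (- (\<alpha> + 1)) / C"
  have f [measurable]: "f \<in> borel_measurable borel" using GH by (simp add: GH_cond_def)
  have fv: "AE x in \<mu>. f x = v * gauss a x" using c unfolding AE_mu_iff v_def .
  have F: "F_kn k n f y = v * of_real ((2 * a) powr (- (\<alpha> + 1)) * exp (- (real n / (4 * a) * (rad y)\<^sup>2)))" for y
  proof -
    have "F_kn k n f y = F_kn k n (\<lambda>x. v * gauss a x) y"
      unfolding F_kn_def
    proof (rule integral_cong_AE)
      have Bm: "(\<lambda>x. B_kn k n x y) \<in> borel_measurable borel"
        unfolding B_kn_def bessel_j_def by measurable
      then show "(\<lambda>x. f x * B_kn k n x y) \<in> borel_measurable \<mu>" "(\<lambda>x. v * gauss a x * B_kn k n x y) \<in> borel_measurable \<mu>"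
        by measurable
      show "AE x in \<mu>. f x * B_kn k n x y = v * gauss a x * B_kn k n x y"
        using fv by eventually_elim simp
    qed
    then show ?thesis by (simp only: F_kn_gauss[OF a])
  qed
  have "v = 0"
  proof (rule ccontr)
    assume v: "v \<noteq> 0"
    then have w: "w > 0" using a C by (simp add: w_def)
    define d where "d = real n * (b - b')"
    have d: "d > 0" using bb n1 by (simp add: d_def)
    define \<phi> where "\<phi> = (\<lambda>t. log_plus (w * exp (d * t\<^sup>2)))"
    have cont: "continuous_on UNIV \<phi>"
      unfolding \<phi>_def log_plus_eq_ln_max by (intro continuous_intros) (auto simp: max_def)
    have "norm (complex_of_real (exp (real n * b * \<bar>x\<bar> powr (2 / real n))) * F_kn k n f x) / C = w * exp (d * (rad x)\<^sup>2)" for x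
    proof -
      have "norm (complex_of_real (exp (real n * b * \<bar>x\<bar> powr (2 / real n))) * F_kn k n f x) / C
        = w * (exp (real n * b * (rad x)\<^sup>2) * exp (- (real n / (4 * a) * (rad x)\<^sup>2)))"
        unfolding F rad_square by (simp add: norm_mult w_def)
      also have "exp (real n * b * (rad x)\<^sup>2) * exp (- (real n / (4 * a) * (rad x)\<^sup>2)) = exp (d * (rad x)\<^sup>2)"
        by (simp add: d_def b'_def algebra_simps flip: exp_add)
      finally show ?thesis .
    qed
    then have "(\<integral>\<^sup>+x. ennreal (\<phi> (rad x)) \<partial>\<mu>) < \<infinity>"
      using GH unfolding GH_cond_def \<phi>_def by simp
    then have int: "integrable lborel (\<lambda>t. indicator {0..} t * \<phi> t)"
      by (intro integrable_rad_substitution cont) (auto simp: \<phi>_def)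
    have "filterlim (\<lambda>t. w * exp (d * t\<^sup>2)) at_top at_top"
      using w d by real_asymp
    then have "\<forall>\<^sub>F t in at_top. w * exp (d * t\<^sup>2) \<ge> exp 1" by (simp add: filterlim_at_top)
    then obtain T where T: "\<And>t. t \<ge> T \<Longrightarrow> w * exp (d * t\<^sup>2) \<ge> exp 1" by (auto simp: eventually_at_top_linorder)
    show False
    proof (rule not_integrable_on_halfline[where T = "max T 0" and \<epsilon> = 1])
      show "(\<lambda>t. indicator {0..} t * \<phi> t) integrable_on UNIV" using int by (rule integrable_on_lborel)
      show "1 \<le> indicator {0..} t * \<phi> t" if "max T 0 \<le> t" for t
        using log_plus_mono[OF T[of t]] that by (simp add: \<phi>_def log_plus_def[of "exp 1"])
    qed (auto simp: \<phi>_def)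
  qed
  then show ?thesis using c by (simp add: v_def[symmetric])
qed

text \<open>\<open>a < c\<close> leaves a decaying Gaussian after weighting, which lies in every
  class, so the second summand may be 0. The bounds on \<open>b\<close> and \<open>v\<close> keep
  the weighted transform at most \<open>C\<close>, so its \<open>log_plus\<close> vanishes
  identically.\<close>

lemma GH_cond_gauss:
  assumes "a < c" "b \<le> 1 / (4 * c)" and c: "c > 0" and C: "C > 0" and p: "1 \<le> p"
    and v: "norm v * (2 * c) powr (- (\<alpha> + 1)) \<le> C"
  shows "GH_cond n k a b C p q (\<lambda>x. v * gauss c x)"
  unfolding GH_cond_def
proof (intro conjI)
  have np: "real n > 0" using n1 by simp
  show "(\<lambda>x. v * gauss c x) \<in> borel_measurable lborel" by simp
  define g where "g = (\<lambda>x. complex_of_real (exp (real n * a * \<bar>x\<bar> powr (2 / real n))) * (v * gauss c x))"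
  have [measurable]: "g \<in> borel_measurable borel" unfolding g_def by measurable
  have ng: "norm (g x) = norm v * exp (- (real n * (c - a) * (rad x)\<^sup>2))" for x
    unfolding g_def rad_square gauss_def by (simp add: norm_mult algebra_simps flip: exp_add)
  have "Lp_mem \<mu> p g"
  proof (cases "p = \<infinity>")
    case True
    have "norm (g x) \<le> norm v" for x
      unfolding ng using np \<open>a < c\<close> by (intro mult_left_le) auto
    then show ?thesis using True by (auto simp: Lp_mem_def)
  next
    case False
    define r where "r = enn2real p"
    have "enn2real 1 \<le> enn2real p"
      using False p by (intro enn2real_mono) (auto simp: less_top)
    then have r: "r > 0" by (simp add: r_def)
    have "norm (g x) powr r = norm v powr r * exp (- (real n * (r * (c - a)) * (rad x)\<^sup>2))" for x
      unfolding ng by (simp add: powr_mult exp_powr_real mult_ac)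
    moreover have "integrable \<mu> (\<lambda>x. norm v powr r * exp (- (real n * (r * (c - a)) * (rad x)\<^sup>2)))"
      using gaussian_integral[of "r * (c - a)"] r \<open>a < c\<close>
      by (intro integrable_mult_right) (auto simp: has_bochner_integral_iff)
    ultimately have "(\<integral>\<^sup>+ x. ennreal (norm (g x) powr r) \<partial>\<mu>) < \<infinity>"
      using integrableD(2) by (fastforce simp: less_top dest: integrableD(2))
    then show ?thesis using False by (auto simp: Lp_mem_def r_def)
  qed
  moreover have "Lp_mem \<mu> q (\<lambda>x. 0)" by (auto simp: Lp_mem_def)
  ultimately show "Lp_plus_Lq \<mu> p q (\<lambda>x. complex_of_real (exp (real n * a * \<bar>x\<bar> powr (2 / real n))) * (v * gauss c x))"
    unfolding Lp_plus_Lq_def g_def[symmetric]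
    by (intro exI[of _ g] exI[of _ "\<lambda>x. 0"]) (simp add: g_def)
  have "log_plus (norm (complex_of_real (exp (real n * b * \<bar>x\<bar> powr (2 / real n))) * F_kn k n (\<lambda>x. v * gauss c x) x) / C) = 0" for x
  proof -
    have "real n * b * (rad x)\<^sup>2 \<le> real n * (1 / (4 * c)) * (rad x)\<^sup>2"
      using assms(2) by (intro mult_right_mono mult_left_mono) auto
    then have "exp (real n * b * (rad x)\<^sup>2) * exp (- (real n / (4 * c) * (rad x)\<^sup>2)) \<le> 1"
      by (simp flip: exp_add)
    then have "(norm v * (2 * c) powr (- (\<alpha> + 1))) * (exp (real n * b * (rad x)\<^sup>2) * exp (- (real n / (4 * c) * (rad x)\<^sup>2))) \<le> C * 1"
      using v C by (intro mult_mono) auto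
    moreover have "norm (complex_of_real (exp (real n * b * \<bar>x\<bar> powr (2 / real n))) * F_kn k n (\<lambda>x. v * gauss c x) x)
      = (norm v * (2 * c) powr (- (\<alpha> + 1))) * (exp (real n * b * (rad x)\<^sup>2) * exp (- (real n / (4 * c) * (rad x)\<^sup>2)))"
      unfolding F_kn_gauss[OF c] rad_square by (simp add: norm_mult)
    ultimately show ?thesis using C by (simp add: log_plus_def)
  qed
  then show "(\<integral>\<^sup>+ x. ennreal (log_plus (norm (complex_of_real (exp (real n * b * \<bar>x\<bar> powr (2 / real n)))
       * F_kn k n (\<lambda>x. v * gauss c x) x) / C)) \<partial>\<mu>) < \<infinity>" by simp
qed

end

theorem theorem5p3:
  fixes n :: nat and k a b C :: real and p q :: ennreal and f :: "real \<Rightarrow> complex"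
  assumes "n \<ge> 1"
    and "k \<ge> (real n - 1) / (2 * real n)"
    and "a > 0" and "b > 0" and "C > 0"
    and "1 \<le> p" and "1 \<le> q"
    and "GH_cond n k a b C p q f"
  shows "(a * b > 1 / 4 \<longrightarrow> (AE x in lborel. f x = 0))
       \<and> (a * b = 1 / 4 \<longrightarrow>
            (\<exists>c::complex. cmod c \<le> (2 * a) powr (k * real n - real n / 2 + 1) * C
               \<and> (AE x in lborel. f x = c * complex_of_real (exp (- real n * a * \<bar>x\<bar> powr (2 / real n))))))
       \<and> (a * b < 1 / 4 \<longrightarrow>
            (\<exists>g1 g2. GH_cond n k a b C p q g1 \<and> GH_cond n k a b C p q g2
               \<and> \<not> (AE x in lborel. g1 x = 0) \<and> \<not> (AE x in lborel. g2 x = 0)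
               \<and> \<not> (AE x in lborel. g1 x = g2 x)))"
proof -
  interpret generalized_fourier k n using assms by unfold_locales auto
  have "\<exists>c::complex. cmod c \<le> (2 * a) powr (k * real n - real n / 2 + 1) * C
      \<and> (AE x in lborel. f x = c * complex_of_real (exp (- real n * a * \<bar>x\<bar> powr (2 / real n))))"
    if "a * b = 1 / 4"
  proof -
    have b: "b = 1 / (4 * a)" using that \<open>a > 0\<close> by (simp add: field_simps)
    obtain c where c: "norm c \<le> C" "AE x in lborel. f x = c * of_real ((2 * a) powr (\<alpha> + 1)) * gauss a x"
      by (rule GH_cond_critical[OF assms(8) assms(3) b assms(5-7)])
    show ?thesis
    proof (intro exI[of _ "c * of_real ((2 * a) powr (\<alpha> + 1))"] conjI)
      show "norm (c * of_real ((2 * a) powr (\<alpha> + 1))) \<le> (2 * a) powr (k * real n - real n / 2 + 1) * C"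
        using c(1) by (simp add: norm_mult alpha_kn_def mult.commute[of _ C] mult_right_mono)
      show "AE x in lborel. f x = c * of_real ((2 * a) powr (\<alpha> + 1)) * complex_of_real (exp (- real n * a * \<bar>x\<bar> powr (2 / real n)))"
        using c(2) unfolding rad_square gauss_def by simp
    qed
  qed
  moreover have "\<exists>g1 g2. GH_cond n k a b C p q g1 \<and> GH_cond n k a b C p q g2
               \<and> \<not> (AE x in lborel. g1 x = 0) \<and> \<not> (AE x in lborel. g2 x = 0)
               \<and> \<not> (AE x in lborel. g1 x = g2 x)"
    if "a * b < 1 / 4"
  proof -
    \<comment> \<open>With this choice \<open>b \<le> 1 / (4 * c)\<close> holds with equality, and
      \<open>a < c\<close> is the assumption \<open>a * b < 1 / 4\<close>.\<close>
    define c where "c = 1 / (4 * b)"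
    have c: "a < c" "b \<le> 1 / (4 * c)" "c > 0"
      using that \<open>a > 0\<close> \<open>b > 0\<close> by (auto simp: c_def field_simps)
    define P where "P = (2 * c) powr (- (\<alpha> + 1))"
    have P: "P > 0" using c by (simp add: P_def)
    \<comment> \<open>Dividing by \<open>P\<close> makes the transform of \<open>g s\<close> equal
      to \<open>s * C\<close> at the origin, so \<open>s\<close> in \<open>{0..1}\<close> is
      admissible. The parameters 1 and 1/2 give the two witnesses, and \<open>g 0 = 0\<close> serves
      to show that they are nonzero.\<close>
    define g where "g = (\<lambda>s x. complex_of_real (s * C / P) * gauss c x)"
    have GH: "GH_cond n k a b C p q (g s)" if "0 \<le> s" "s \<le> 1" for s
      unfolding g_def
    proof (rule GH_cond_gauss[OF c \<open>C > 0\<close> \<open>1 \<le> p\<close>])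
      have "s * C \<le> C" using that \<open>C > 0\<close> by simp
      then show "norm (complex_of_real (s * C / P)) * (2 * c) powr (- (\<alpha> + 1)) \<le> C"
        unfolding P_def[symmetric] norm_of_real using that P \<open>C > 0\<close> by (simp add: abs_mult)
    qed
    have ne: "\<not> (AE x in lborel. g s x = g s' x)" if "s \<noteq> s'" for s s'
    proof
      assume "AE x in lborel. g s x = g s' x"
      moreover have "g s x \<noteq> g s' x" for x using that P \<open>C > 0\<close> by (simp add: g_def gauss_def)
      ultimately have "AE x in (lborel :: real measure). False" by simp
      then have "emeasure lborel (UNIV :: real set) = 0" by (simp add: AE_iff_measurable[of UNIV])
      then show False by simp
    qed
    have "g 0 x = 0" for x by (simp add: g_def)
    then show ?thesis
      using GH[of 1] GH[of "1/2"] ne[of 1 0] ne[of "1/2" 0] ne[of 1 "1/2"]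
      by (intro exI[of _ "g 1"] exI[of _ "g (1/2)"]) simp
  qed
  ultimately show ?thesis using GH_cond_supercritical[OF assms(8,3,5,6,7)] by blast
qed

end
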